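(* Let $\mathcal D$ be a directed acyclic graph with finite vertex set $V$. A state $\sigma\in\mathbb S_1^+(\mathcal H_V)$ satisfies any one, and hence all, of the directed Markov properties (O), (L) and (G) with respect to $\mathcal D$ if and only if $T_{\mathcal D}(\sigma)=\sigma$, where $$T_{\mathcal D}(\sigma)=\exp\Bigl\{\sum_{v\in V}\bigl(\log\sigma_{\{v\}\cup\operatorname{pa}(v)}-\log\sigma_{\operatorname{pa}(v)}\bigr)\Bigr\}.$$
   Context: For each $v\in V$, $\mathcal H_v$ is a finite-dimensional complex Hilbert space; $\mathcal H_A=\bigotimes_{v\in A}\mathcal H_v$ for $A\subseteq V$, with $\mathcal H_\varnothing=\mathbb C$. $\mathbb S_1^+(\mathcal H_A)$ is the set of positive definite (self-adjoint) operators on $\mathcal H_A$ of trace one. For $A\subseteq V$, $\sigma_A=\operatorname{Tr}_{V\setminus A}(\sigma)$ is the marginal; operators $\log\sigma_A$ are embedded into operators on $\mathcal H_V$ by tensoring with the identity on the complementary factors, and $\log\sigma_\varnothing=0$. The von Neumann entropy is $\operatorname S(A)_\sigma=-\operatorname{Tr}(\sigma_A\log\sigma_A)$, with $\operatorname S(\varnothing)_\sigma=0$. For pairwise disjoint $A,B,C\subseteq V$, $I(A:B\mid C)_\sigma=\operatorname S(A\cup C)_\sigma+\operatorname S(B\cup C)_\sigma-\operatorname S(C)_\sigma-\operatorname S(A\cup B\cup C)_\sigma$, and $A\perp\!\!\!\perp_Q B\mid C$ means $I(A:B\mid C)_\sigma=0$. For a vertex $v$ of $\mathcal D$: $\operatorname{pa}(v)$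 is its set of parents, $\operatorname{de}(v)$ its set of descendants (excluding $v$), $\operatorname{nd}(v)=V\setminus(\{v\}\cup\operatorname{de}(v))$. A total ordering $<$ of $V$ is topological if $u<w$ for every arrow $u\to w$; $\operatorname{pr}(v)=\{u\in V:u<v\}$. A walk (repeated vertices allowed, arrows traversable in either direction) has a collider at a non-endpoint $\alpha_i$ if $\alpha_{i-1}\to\alpha_i\leftarrow\alpha_{i+1}$. A walk is active relative to $S$ if every non-collider on it is outside $S$ and every collider on it is in $S$; otherwise it is blocked by $S$. Disjoint $A,B$ are $d$-separated by $S$ if every walk from $A$ to $B$ is blocked by $S$. Markov properties of $\sigma$: (O), for a given topological ordering: $v\perp\!\!\!\perp_Q(\operatorname{pr}(v)\setminus\operatorname{pa}(v))\mid\operatorname{pa}(v)$ for all $v\in V$. (L): $v\perp\!\!\!\perp_Q(\operatorname{nd}(v)\setminus\operatorname{pa}(v))\mid\operatorname{pa}(v)$ for all $v\in V$. (G): for all pairwise disjoint $A,B,S\subseteq V$, if $A,B$ are $d$-separated by $S$ then $A\perp\!\!\!\perp_Q B\mid S$. *)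

theory Defs
  imports Complex_Main "HOL-Library.FuncSet"
begin

section \<open>Operators on finite-dimensional Hilbert spaces\<close>

text \<open>
  An operator on the Hilbert space with orthonormal basis indexed by a finite set \<open>I\<close> is
  represented by its matrix in that basis, as a function that vanishes outside \<open>I \<times> I\<close>
  (so that equality of operators is equality of functions).
\<close>

type_synonym 'i opr = "'i \<Rightarrow> 'i \<Rightarrow> complex"

definition oprs :: "'i set \<Rightarrow> 'i opr set" where
  "oprs I = {M. \<forall>x y. x \<notin> I \<or> y \<notin> I \<longrightarrow> M x y = 0}"

definition opr_id :: "'i set \<Rightarrow> 'i opr" where
  "opr_id I = (\<lambda>x y. if x \<in> I \<and> x = y then 1 else 0)"

definition opr_mult :: "'i set \<Rightarrow> 'i opr \<Rightarrow> 'i opr \<Rightarrow> 'i opr" where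
  "opr_mult I M N = (\<lambda>x y. \<Sum>z\<in>I. M x z * N z y)"

primrec opr_power :: "'i set \<Rightarrow> 'i opr \<Rightarrow> nat \<Rightarrow> 'i opr" where
  "opr_power I M 0 = opr_id I"
| "opr_power I M (Suc n) = opr_mult I M (opr_power I M n)"

definition opr_trace :: "'i set \<Rightarrow> 'i opr \<Rightarrow> complex" where
  "opr_trace I M = (\<Sum>x\<in>I. M x x)"

definition self_adjoint :: "'i set \<Rightarrow> 'i opr \<Rightarrow> bool" where
  "self_adjoint I M \<longleftrightarrow> (\<forall>x\<in>I. \<forall>y\<in>I. M y x = cnj (M x y))"

definition positive_definite :: "'i set \<Rightarrow> 'i opr \<Rightarrow> bool" where
  "positive_definite I M \<longleftrightarrow> self_adjoint I M \<and>
    (\<forall>\<psi>. (\<exists>x\<in>I. \<psi> x \<noteq> 0) \<longrightarrow> 0 < Re (\<Sum>x\<in>I. \<Sum>y\<in>I. cnj (\<psi> x) * M x y * \<psi> y))"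

definition opr_exp :: "'i set \<Rightarrow> 'i opr \<Rightarrow> 'i opr" where
  "opr_exp I M = (\<lambda>x y. \<Sum>n. opr_power I M n x y / fact n)"

text \<open>
  The logarithm is given by the spectral calculus: if \<open>M = (\<Sum>k. \<lambda>\<^sub>k |u\<^sub>k><u\<^sub>k|)\<close> for an
  orthonormal basis \<open>u\<close>, then \<open>log M = (\<Sum>k. ln \<lambda>\<^sub>k |u\<^sub>k><u\<^sub>k|)\<close>. For positive definite \<open>M\<close> such
  a decomposition exists, and the result does not depend on its choice.
\<close>

definition orthonormal_basis :: "'i set \<Rightarrow> ('i \<Rightarrow> 'i \<Rightarrow> complex) \<Rightarrow> bool" where
  "orthonormal_basis I u \<longleftrightarrow>
    (\<forall>j\<in>I. \<forall>k\<in>I. (\<Sum>x\<in>I. cnj (u j x) * u k x) = (if j = k then 1 else 0))"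

definition spectral_opr :: "'i set \<Rightarrow> ('i \<Rightarrow> 'i \<Rightarrow> complex) \<Rightarrow> ('i \<Rightarrow> real) \<Rightarrow> 'i opr" where
  "spectral_opr I u l =
    (\<lambda>x y. if x \<in> I \<and> y \<in> I
           then \<Sum>k\<in>I. complex_of_real (l k) * u k x * cnj (u k y) else 0)"

definition opr_log :: "'i set \<Rightarrow> 'i opr \<Rightarrow> 'i opr" where
  "opr_log I M = (THE L. \<exists>u l. orthonormal_basis I u \<and> M = spectral_opr I u l \<and>
                               L = spectral_opr I u (\<lambda>k. ln (l k)))"


section \<open>Composite systems\<close>

text \<open>
  The space at \<open>v\<close> is \<open>\<complex>\<close> to the power \<open>d v\<close>, with basis labels \<open>{..<d v}\<close>. The product basis of
  the tensor product over \<open>A\<close> is indexed by \<open>conf d A\<close>; \<open>conf d {}\<close> has exactly one element.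
\<close>

definition conf :: "('v \<Rightarrow> nat) \<Rightarrow> 'v set \<Rightarrow> ('v \<Rightarrow> nat) set" where
  "conf d A = (\<Pi>\<^sub>E v\<in>A. {..<d v})"

definition states :: "('v \<Rightarrow> nat) \<Rightarrow> 'v set \<Rightarrow> ('v \<Rightarrow> nat) opr set" where
  "states d A =
    {\<sigma> \<in> oprs (conf d A). positive_definite (conf d A) \<sigma> \<and> opr_trace (conf d A) \<sigma> = 1}"

text \<open>Partial trace over \<open>V - A\<close>; \<open>override_on z x A\<close> is the configuration of \<open>V\<close> that is \<open>x\<close> on
  \<open>A\<close> and \<open>z\<close> on \<open>V - A\<close>.\<close>

definition marginal ::
  "('v \<Rightarrow> nat) \<Rightarrow> 'v set \<Rightarrow> ('v \<Rightarrow> nat) opr \<Rightarrow> 'v set \<Rightarrow> ('v \<Rightarrow> nat) opr" where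
  "marginal d V \<sigma> A =
    (\<lambda>x y. if x \<in> conf d A \<and> y \<in> conf d A
           then \<Sum>z\<in>conf d (V - A). \<sigma> (override_on z x A) (override_on z y A) else 0)"

text \<open>\<open>M \<otimes> 1\<close>, for \<open>M\<close> an operator on the factor \<open>A\<close> and \<open>1\<close> the identity on the factor \<open>V - A\<close>.\<close>

definition embed ::
  "('v \<Rightarrow> nat) \<Rightarrow> 'v set \<Rightarrow> 'v set \<Rightarrow> ('v \<Rightarrow> nat) opr \<Rightarrow> ('v \<Rightarrow> nat) opr" where
  "embed d V A M =
    (\<lambda>x y. if x \<in> conf d V \<and> y \<in> conf d V \<and> (\<forall>v\<in>V - A. x v = y v)
           then M (restrict x A) (restrict y A) else 0)"

definition log_marginal ::
  "('v \<Rightarrow> nat) \<Rightarrow> 'v set \<Rightarrow> ('v \<Rightarrow> nat) opr \<Rightarrow> 'v set \<Rightarrow> ('v \<Rightarrow> nat) opr" where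
  "log_marginal d V \<sigma> A = opr_log (conf d A) (marginal d V \<sigma> A)"

text \<open>The trace below is real, being that of a product of two self-adjoint operators. Since the
  marginal of a state on \<open>{}\<close> is the scalar \<open>1\<close>, both \<open>log_marginal\<close> and \<open>entropy\<close> vanish on \<open>{}\<close>.\<close>

definition entropy :: "('v \<Rightarrow> nat) \<Rightarrow> 'v set \<Rightarrow> ('v \<Rightarrow> nat) opr \<Rightarrow> 'v set \<Rightarrow> real" where
  "entropy d V \<sigma> A =
    - Re (opr_trace (conf d A) (opr_mult (conf d A) (marginal d V \<sigma> A) (log_marginal d V \<sigma> A)))"

definition cond_mutual_info ::
  "('v \<Rightarrow> nat) \<Rightarrow> 'v set \<Rightarrow> ('v \<Rightarrow> nat) opr \<Rightarrow> 'v set \<Rightarrow> 'v set \<Rightarrow> 'v set \<Rightarrow> real" where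
  "cond_mutual_info d V \<sigma> A B C =
    entropy d V \<sigma> (A \<union> C) + entropy d V \<sigma> (B \<union> C) - entropy d V \<sigma> C - entropy d V \<sigma> (A \<union> B \<union> C)"

definition cond_indep ::
  "('v \<Rightarrow> nat) \<Rightarrow> 'v set \<Rightarrow> ('v \<Rightarrow> nat) opr \<Rightarrow> 'v set \<Rightarrow> 'v set \<Rightarrow> 'v set \<Rightarrow> bool" where
  "cond_indep d V \<sigma> A B C \<longleftrightarrow> cond_mutual_info d V \<sigma> A B C = 0"


section \<open>Directed acyclic graphs\<close>

definition dag :: "'v set \<Rightarrow> ('v \<times> 'v) set \<Rightarrow> bool" where
  "dag V E \<longleftrightarrow> finite V \<and> E \<subseteq> V \<times> V \<and> acyclic E"

definition pa :: "('v \<times> 'v) set \<Rightarrow> 'v \<Rightarrow> 'v set" where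
  "pa E v = {u. (u, v) \<in> E}"

definition de :: "('v \<times> 'v) set \<Rightarrow> 'v \<Rightarrow> 'v set" where
  "de E v = {w. (v, w) \<in> E\<^sup>+}"

definition nd :: "'v set \<Rightarrow> ('v \<times> 'v) set \<Rightarrow> 'v \<Rightarrow> 'v set" where
  "nd V E v = V - ({v} \<union> de E v)"

definition topological_ordering :: "'v set \<Rightarrow> ('v \<times> 'v) set \<Rightarrow> ('v \<times> 'v) set \<Rightarrow> bool" where
  "topological_ordering V E r \<longleftrightarrow> r \<subseteq> V \<times> V \<and> strict_linear_order_on V r \<and> E \<subseteq> r"

definition pr :: "'v set \<Rightarrow> ('v \<times> 'v) set \<Rightarrow> 'v \<Rightarrow> 'v set" where
  "pr V r v = {u \<in> V. (u, v) \<in> r}"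

text \<open>In a directed acyclic graph two vertices are joined by at most one arrow, so a walk is
  determined by its sequence of vertices.\<close>

definition walk :: "'v set \<Rightarrow> ('v \<times> 'v) set \<Rightarrow> 'v list \<Rightarrow> bool" where
  "walk V E p \<longleftrightarrow> p \<noteq> [] \<and> set p \<subseteq> V \<and>
    (\<forall>i. Suc i < length p \<longrightarrow> (p ! i, p ! Suc i) \<in> E \<or> (p ! Suc i, p ! i) \<in> E)"

definition collider :: "('v \<times> 'v) set \<Rightarrow> 'v list \<Rightarrow> nat \<Rightarrow> bool" where
  "collider E p i \<longleftrightarrow> 0 < i \<and> Suc i < length p \<and>
    (p ! (i - 1), p ! i) \<in> E \<and> (p ! Suc i, p ! i) \<in> E"

text \<open>Being a collider is a property of a position on the walk, not of a vertex; the end points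
  are non-colliders.\<close>

definition active :: "('v \<times> 'v) set \<Rightarrow> 'v set \<Rightarrow> 'v list \<Rightarrow> bool" where
  "active E S p \<longleftrightarrow>
    (\<forall>i<length p. (\<not> collider E p i \<longrightarrow> p ! i \<notin> S) \<and> (collider E p i \<longrightarrow> p ! i \<in> S))"

definition d_separated ::
  "'v set \<Rightarrow> ('v \<times> 'v) set \<Rightarrow> 'v set \<Rightarrow> 'v set \<Rightarrow> 'v set \<Rightarrow> bool" where
  "d_separated V E A B S \<longleftrightarrow>
    (\<forall>p. walk V E p \<and> hd p \<in> A \<and> last p \<in> B \<longrightarrow> \<not> active E S p)"


section \<open>Directed Markov properties\<close>

definition markov_O ::
  "('v \<Rightarrow> nat) \<Rightarrow> 'v set \<Rightarrow> ('v \<times> 'v) set \<Rightarrow> ('v \<times> 'v) set \<Rightarrow> ('v \<Rightarrow> nat) opr \<Rightarrow> bool" where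
  "markov_O d V E r \<sigma> \<longleftrightarrow> (\<forall>v\<in>V. cond_indep d V \<sigma> {v} (pr V r v - pa E v) (pa E v))"

definition markov_L ::
  "('v \<Rightarrow> nat) \<Rightarrow> 'v set \<Rightarrow> ('v \<times> 'v) set \<Rightarrow> ('v \<Rightarrow> nat) opr \<Rightarrow> bool" where
  "markov_L d V E \<sigma> \<longleftrightarrow> (\<forall>v\<in>V. cond_indep d V \<sigma> {v} (nd V E v - pa E v) (pa E v))"

definition markov_G ::
  "('v \<Rightarrow> nat) \<Rightarrow> 'v set \<Rightarrow> ('v \<times> 'v) set \<Rightarrow> ('v \<Rightarrow> nat) opr \<Rightarrow> bool" where
  "markov_G d V E \<sigma> \<longleftrightarrow>
    (\<forall>A B S. A \<subseteq> V \<and> B \<subseteq> V \<and> S \<subseteq> V \<and> A \<inter> B = {} \<and> A \<inter> S = {} \<and> B \<inter> S = {} \<and>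
             d_separated V E A B S \<longrightarrow> cond_indep d V \<sigma> A B S)"

definition T_dag ::
  "('v \<Rightarrow> nat) \<Rightarrow> 'v set \<Rightarrow> ('v \<times> 'v) set \<Rightarrow> ('v \<Rightarrow> nat) opr \<Rightarrow> ('v \<Rightarrow> nat) opr" where
  "T_dag d V E \<sigma> = opr_exp (conf d V)
    (\<lambda>x y. \<Sum>v\<in>V. embed d V ({v} \<union> pa E v) (log_marginal d V \<sigma> ({v} \<union> pa E v)) x y
                - embed d V (pa E v) (log_marginal d V \<sigma> (pa E v)) x y)"

end

theory Submission
  imports Defs "HOL-Analysis.Analysis" "HOL-Real_Asymp.Real_Asymp"
begin

text \<open>
  Writing \<open>L\<^sub>A\<close> for the embedded logarithm of \<open>\<sigma>\<^sub>A\<close>, the equality case of strong subadditivity says that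
  \<open>I(A:B|C) = 0\<close> forces \<open>L\<^bsub>ABC\<^esub> - L\<^bsub>BC\<^esub> = L\<^bsub>AC\<^esub> - L\<^sub>C\<close>. Summed along a topological ordering, (O) therefore
  gives \<open>log \<sigma> = \<Sum>\<^sub>v (L\<^bsub>v pa(v)\<^esub> - L\<^bsub>pa(v)\<^esub>)\<close>. Conversely, \<open>T(\<sigma>) = \<sigma>\<close> means that the exponent is \<open>log \<sigma>\<close>; pairing
  it with \<open>\<sigma>\<close>, the conditional mutual informations in (O), which are nonnegative, telescope to a sum of zero.
  The properties (O), (L), (G) are equivalent for any ternary relation satisfying the semigraphoid axioms, and
  conditional quantum independence satisfies them by the chain rule and nonnegativity.

  Strong subadditivity with its equality case is monotonicity of the relative entropy \<open>D(\<rho>,\<tau>)\<close> under a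
  conditional expectation \<open>F\<close>. For \<open>s > 0\<close> let \<open>X\<close> and \<open>Y\<close> solve \<open>s X \<rho> + \<tau> X = \<rho>\<close> and \<open>s Y F(\<rho>) + F(\<tau>) Y = F(\<rho>)\<close>. By
  uniqueness \<open>F(Y) = Y\<close>, hence \<open>\<langle>X,\<rho>\<rangle> - \<langle>Y,F(\<rho>)\<rangle> = \<langle>D, s D \<rho> + \<tau> D\<rangle> \<ge> 0\<close> for \<open>D = X - Y\<close>. The left side is the
  \<open>s\<close>-derivative of a sum of terms \<open>c ln (s + t)\<close> that tends to \<open>0\<close> as \<open>s \<rightarrow> \<infinity>\<close> and whose value at \<open>s = 0\<close> is
  \<open>D(F(\<rho>),F(\<tau>)) - D(\<rho>,\<tau>)\<close>. Equality forces \<open>X = Y\<close> for all \<open>s > 0\<close>, and the same antiderivative, taken entrywise,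
  then identifies the differences of logarithms.
\<close>

section \<open>Spectral calculus\<close>

definition inner_prod :: "'i set \<Rightarrow> ('i \<Rightarrow> complex) \<Rightarrow> ('i \<Rightarrow> complex) \<Rightarrow> complex" where
  "inner_prod I f g = (\<Sum>x\<in>I. cnj (f x) * g x)"

definition opr_app :: "'i set \<Rightarrow> 'i opr \<Rightarrow> ('i \<Rightarrow> complex) \<Rightarrow> 'i \<Rightarrow> complex" where
  "opr_app I M f = (\<lambda>x. \<Sum>y\<in>I. M x y * f y)"

lemma ip_lincomb_right:
  "inner_prod I f (\<lambda>x. a * g x + b * h x) = a * inner_prod I f g + b * inner_prod I f h"
  by (simp add: inner_prod_def sum_distrib_left sum.distrib algebra_simps)

lemma ip_lincomb_left:
  "inner_prod I (\<lambda>x. a * g x + b * h x) f = cnj a * inner_prod I g f + cnj b * inner_prod I h f"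
  by (simp add: inner_prod_def sum_distrib_left sum.distrib algebra_simps)

lemma sum_rotate:
  "(\<Sum>z\<in>A. \<Sum>k\<in>B. \<Sum>j\<in>C. f z k j) = (\<Sum>k\<in>B. \<Sum>j\<in>C. \<Sum>z\<in>A. f z k j)"
  by (subst sum.swap) (simp add: sum.swap[of _ A C])

lemma ip_cong:
  "(\<And>x. x \<in> I \<Longrightarrow> f x = f' x) \<Longrightarrow> (\<And>x. x \<in> I \<Longrightarrow> g x = g' x) \<Longrightarrow> inner_prod I f g = inner_prod I f' g'"
  by (simp add: inner_prod_def)

lemma cnj_ip: "cnj (inner_prod I f g) = inner_prod I g f"
  by (simp add: inner_prod_def mult.commute)

lemma ip_self: "inner_prod I f f = of_real (\<Sum>x\<in>I. (cmod (f x))\<^sup>2)"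
  by (simp add: inner_prod_def complex_norm_square[symmetric] mult.commute)

lemma ip_self_eq_0: "finite I \<Longrightarrow> Re (inner_prod I f f) = 0 \<Longrightarrow> x \<in> I \<Longrightarrow> f x = 0"
  by (simp add: ip_self sum_nonneg_eq_0_iff)

lemma app_lincomb:
  "opr_app I M (\<lambda>x. a * g x + b * h x) = (\<lambda>x. a * opr_app I M g x + b * opr_app I M h x)"
  by (simp add: opr_app_def sum_distrib_left sum.distrib algebra_simps)

lemma ip_app_self_adjoint:
  assumes "self_adjoint I M"
  shows "inner_prod I f (opr_app I M g) = inner_prod I (opr_app I M f) g"
proof -
  have "inner_prod I f (opr_app I M g) = (\<Sum>x\<in>I. \<Sum>y\<in>I. cnj (f x) * M x y * g y)"
    by (simp add: inner_prod_def opr_app_def sum_distrib_left mult.assoc)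
  also have "\<dots> = (\<Sum>x\<in>I. \<Sum>y\<in>I. cnj (M y x * f x) * g y)"
  proof (intro sum.cong refl)
    fix x y assume "x \<in> I" "y \<in> I"
    then have "M x y = cnj (M y x)" using assms unfolding self_adjoint_def by blast
    then show "cnj (f x) * M x y * g y = cnj (M y x * f x) * g y" by (simp add: mult_ac)
  qed
  also have "\<dots> = (\<Sum>y\<in>I. \<Sum>x\<in>I. cnj (M y x * f x) * g y)"
    by (rule sum.swap)
  also have "\<dots> = inner_prod I (opr_app I M f) g"
    by (simp add: inner_prod_def opr_app_def sum_distrib_right)
  finally show ?thesis .
qed

text \<open>First-order condition at an extremum: for small negative \<open>t\<close> the linear
  term dominates the quadratic one, so a positive slope would make the expression negative.\<close>

lemma linear_term_zero:
  fixes a b :: real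
  assumes "\<And>t. 2 * a * t + b * t\<^sup>2 \<ge> 0" "a \<ge> 0"
  shows "a = 0"
proof (rule ccontr)
  assume "a \<noteq> 0"
  with assms(2) have a: "a > 0" by simp
  \<comment> \<open>The denominator makes the quadratic term at most \<open>- a * t\<close>, half
    the size of the linear term.\<close>
  define t where "t = - a / (\<bar>b\<bar> + 1)"
  have "b * t\<^sup>2 \<le> (\<bar>b\<bar> + 1) * t\<^sup>2" by (intro mult_right_mono) auto
  also have "\<dots> = - a * t" by (simp add: t_def power2_eq_square add_pos_nonneg)
  finally have "2 * a * t + b * t\<^sup>2 \<le> a * t" by (simp add: algebra_simps)
  moreover have "t < 0" using a by (simp add: t_def divide_neg_pos add_nonneg_pos)
  then have "a * t < 0" using a by (rule mult_pos_neg[rotated])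
  ultimately show False using assms(1)[of t] by linarith
qed

text \<open>Dimension count: if every standard basis vector lay in the span of fewer than
  \<open>card I\<close> orthonormal vectors, the projection onto that span would be the identity,
  and its trace would be both \<open>card I\<close> and \<open>card J\<close>.\<close>

lemma exists_orthogonal:
  assumes fin: "finite I" and J: "J \<subset> I"
    and orth: "\<And>j k. j \<in> J \<Longrightarrow> k \<in> J \<Longrightarrow> inner_prod I (u j) (u k) = (if j = k then 1 else 0)"
  shows "\<exists>f. (\<forall>x. x \<notin> I \<longrightarrow> f x = 0) \<and> (\<forall>j\<in>J. inner_prod I (u j) f = 0) \<and> inner_prod I f f = 1"
proof -
  have finJ: "finite J" using fin J finite_subset by blast
  \<comment> \<open>The residual of the standard basis vector at \<open>x\<close> after projecting
    off the \<open>u k\<close>, cut off outside \<open>I\<close>.\<close>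
  define r where "r = (\<lambda>x y. if y \<in> I then (if y = x then 1 else 0) - (\<Sum>k\<in>J. cnj (u k x) * u k y) else 0)"
  have ortho: "inner_prod I (u j) (r x) = 0" if "x \<in> I" "j \<in> J" for x j
  proof -
    have "inner_prod I (u j) (r x) = (\<Sum>y\<in>I. (if y = x then cnj (u j y) else 0)) -
         (\<Sum>y\<in>I. \<Sum>k\<in>J. cnj (u k x) * (cnj (u j y) * u k y))"
      unfolding inner_prod_def sum_subtractf[symmetric]
      by (intro sum.cong refl) (simp add: r_def right_diff_distrib sum_distrib_left mult_ac)
    also have "(\<Sum>y\<in>I. \<Sum>k\<in>J. cnj (u k x) * (cnj (u j y) * u k y)) = (\<Sum>k\<in>J. cnj (u k x) * inner_prod I (u j) (u k))"
      by (subst sum.swap) (simp add: inner_prod_def sum_distrib_left)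
    also have "\<dots> = (\<Sum>k\<in>J. if k = j then cnj (u k x) else 0)"
      using orth that by (intro sum.cong) auto
    finally show ?thesis using that fin finJ by simp
  qed
  have "\<exists>x\<in>I. \<exists>y\<in>I. r x y \<noteq> 0"
  proof (rule ccontr)
    assume "\<not> ?thesis"
    then have "(\<Sum>k\<in>J. cnj (u k x) * u k x) = 1" if "x \<in> I" for x
      using that by (force simp: r_def)
    then have "of_nat (card I) = (\<Sum>x\<in>I. \<Sum>k\<in>J. cnj (u k x) * u k x)"
      by simp
    also have "\<dots> = (\<Sum>k\<in>J. inner_prod I (u k) (u k))"
      by (subst sum.swap) (simp add: inner_prod_def)
    also have "\<dots> = of_nat (card J)" using orth by simp
    finally have "card I = card J" using of_nat_eq_iff by blast
    with psubset_card_mono[OF fin J] show False by simp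
  qed
  then obtain x y where xy: "x \<in> I" "y \<in> I" "r x y \<noteq> 0" by blast
  define n where "n = (\<Sum>y\<in>I. (cmod (r x y))\<^sup>2)"
  have "n \<noteq> 0" unfolding n_def using fin xy by (subst sum_nonneg_eq_0_iff) auto
  moreover have "n \<ge> 0" unfolding n_def by (intro sum_nonneg) auto
  ultimately have n: "n > 0" by simp
  define c :: complex where "c = of_real (1 / sqrt n)"
  have 1: "inner_prod I g (\<lambda>y. c * r x y) = c * inner_prod I g (r x)" for g
    using ip_lincomb_right[of I g c "r x" 0 "r x"] by simp
  have 2: "inner_prod I (\<lambda>y. c * r x y) g = cnj c * inner_prod I (r x) g" for g
    using ip_lincomb_left[of I c "r x" 0 "r x" g] by simp
  have "inner_prod I (r x) (r x) = of_real n" unfolding ip_self n_def ..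
  then have "inner_prod I (\<lambda>y. c * r x y) (\<lambda>y. c * r x y) = of_real (1 / sqrt n * (1 / sqrt n) * n)"
    unfolding 1 2 unfolding c_def by (simp only: complex_cnj_complex_of_real of_real_mult mult.assoc)
  also have "1 / sqrt n * (1 / sqrt n) * n = 1" using n by (simp add: field_simps)
  finally have "inner_prod I (\<lambda>y. c * r x y) (\<lambda>y. c * r x y) = 1" by simp
  moreover have "\<forall>j\<in>J. inner_prod I (u j) (\<lambda>y. c * r x y) = 0" unfolding 1 using ortho xy(1) by simp
  moreover have "\<forall>y. y \<notin> I \<longrightarrow> c * r x y = 0" by (simp add: r_def)
  ultimately show ?thesis by (intro exI[of _ "\<lambda>y. c * r x y"] conjI)
qed

text \<open>Rayleigh quotient: a maximizer of the quadratic form of \<open>M\<close> on the unit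
  sphere orthogonal to the earlier eigenvectors is a new eigenvector, and the maximum is its
  eigenvalue.\<close>

lemma exists_eigenvector:
  fixes M :: "'i opr"
  assumes fin: "finite I" and J: "J \<subset> I" and sa: "self_adjoint I M"
    and orth: "\<And>j k. j \<in> J \<Longrightarrow> k \<in> J \<Longrightarrow> inner_prod I (u j) (u k) = (if j = k then 1 else 0)"
    and eig: "\<And>j x. j \<in> J \<Longrightarrow> x \<in> I \<Longrightarrow> opr_app I M (u j) x = of_real (l j) * u j x"
  shows "\<exists>f a. (\<forall>j\<in>J. inner_prod I (u j) f = 0) \<and> inner_prod I f f = 1 \<and> (\<forall>x\<in>I. opr_app I M f x = of_real a * f x)"
proof -
  define W where "W = {f. (\<forall>x. x \<notin> I \<longrightarrow> f x = 0) \<and> (\<forall>j\<in>J. inner_prod I (u j) f = 0)}"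
  define S where "S = {f \<in> W. inner_prod I f f = 1}"
  define q where "q f = Re (inner_prod I f (opr_app I M f))" for f
  \<comment> \<open>Vectors are functions on the whole index type, so compactness comes from
    Tychonoff: the sphere is a closed subset of a product of unit discs.\<close>
  have "compactin euclidean (PiE UNIV (\<lambda>_::'i. cball (0::complex) 1))"
    unfolding euclidean_product_topology[symmetric]
    by (subst compactin_PiE) auto
  then have comp: "compact (PiE UNIV (\<lambda>_::'i. cball (0::complex) 1))" by simp
  have c1: "continuous_on UNIV (\<lambda>f::'i \<Rightarrow> complex. f x)" for x
    by (rule continuous_on_product_coordinates)
  have c2: "continuous_on UNIV (inner_prod I g)" for g unfolding inner_prod_def by (intro continuous_intros c1)
  have c3: "continuous_on UNIV (\<lambda>f. inner_prod I f f)" unfolding inner_prod_def by (intro continuous_intros c1)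
  have c4: "continuous_on UNIV q" unfolding q_def inner_prod_def opr_app_def by (intro continuous_intros c1)
  have "closed ((\<Inter>x\<in>-I. {f::'i \<Rightarrow> complex. f x = 0}) \<inter> (\<Inter>j\<in>J. {f. inner_prod I (u j) f = 0}) \<inter> {f. inner_prod I f f = 1})"
    by (intro closed_Int closed_INT ballI closed_Collect_eq c1 c2 c3 continuous_on_const)
  also have "((\<Inter>x\<in>-I. {f::'i \<Rightarrow> complex. f x = 0}) \<inter> (\<Inter>j\<in>J. {f. inner_prod I (u j) f = 0}) \<inter> {f. inner_prod I f f = 1}) = S"
    by (auto simp: S_def W_def)
  finally have clS: "closed S" .
  have "cmod (f x) \<le> 1" if "f \<in> S" for f x
  proof (cases "x \<in> I")
    case True
    have "complex_of_real (\<Sum>x\<in>I. (cmod (f x))\<^sup>2) = 1" using that by (simp add: S_def ip_self)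
    then have "(\<Sum>x\<in>I. (cmod (f x))\<^sup>2) = 1" using of_real_eq_1_iff by blast
    moreover have "(cmod (f x))\<^sup>2 \<le> (\<Sum>x\<in>I. (cmod (f x))\<^sup>2)"
      using True fin by (intro member_le_sum) auto
    ultimately show ?thesis by (metis norm_ge_zero one_power2 power2_le_imp_le zero_le_one)
  qed (use that in \<open>simp add: S_def W_def\<close>)
  then have "S = PiE UNIV (\<lambda>_::'i. cball (0::complex) 1) \<inter> S" by auto
  then have compS: "compact S" using compact_Int_closed[OF comp clS] by simp
  have "S \<noteq> {}" using exists_orthogonal[OF fin J orth] by (auto simp: S_def W_def)
  from continuous_attains_sup[OF compS this continuous_on_subset[OF c4 subset_UNIV]]
  obtain f where f: "f \<in> S" and max: "\<And>g. g \<in> S \<Longrightarrow> q g \<le> q f" by blast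
  define a where "a = q f"
  \<comment> \<open>Normalizing \<open>g\<close> carries the maximality of \<open>f\<close> from the
    unit sphere to all of \<open>W\<close>.\<close>
  have scale: "q g \<le> a * Re (inner_prod I g g)" if g: "g \<in> W" for g
  proof -
    define n where "n = Re (inner_prod I g g)"
    have n0: "n \<ge> 0" unfolding n_def ip_self by (simp add: sum_nonneg)
    have ngg: "inner_prod I g g = of_real n" by (simp add: n_def ip_self)
    show ?thesis
    proof (cases "n = 0")
      case True
      then have "g x = 0" for x using ip_self_eq_0[OF fin, of g x] g by (cases "x \<in> I") (auto simp: n_def W_def)
      then have "g = (\<lambda>_. 0)" by blast
      then show ?thesis by (simp add: q_def inner_prod_def)
    next
      case False
      with n0 have n: "n > 0" by simp
      define c :: complex where "c = of_real (1 / sqrt n)"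
      have 1: "inner_prod I h (\<lambda>y. c * g y) = c * inner_prod I h g" for h g
        using ip_lincomb_right[of I h c g 0 g] by simp
      have 2: "inner_prod I (\<lambda>y. c * g y) h = cnj c * inner_prod I g h" for h g
        using ip_lincomb_left[of I c g 0 g h] by simp
      have 3: "opr_app I M (\<lambda>y. c * g y) = (\<lambda>y. c * opr_app I M g y)"
        using app_lincomb[of I M c g 0 g] by simp
      have cc: "cnj c * c = of_real (1 / n)" using n by (simp add: c_def flip: of_real_mult)
      have "inner_prod I (\<lambda>y. c * g y) (\<lambda>y. c * g y) = of_real (1 / n) * of_real n"
        unfolding 1 2 ngg cc[symmetric] by (simp only: mult_ac)
      also have "\<dots> = 1" using n by (simp flip: of_real_mult)
      finally have "(\<lambda>y. c * g y) \<in> S" using g unfolding S_def W_def by (simp add: 1)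
      from max[OF this] have "q (\<lambda>y. c * g y) \<le> a" by (simp add: a_def)
      moreover have "inner_prod I (\<lambda>y. c * g y) (opr_app I M (\<lambda>y. c * g y)) = of_real (1 / n) * inner_prod I g (opr_app I M g)"
        unfolding 3 1 2 cc[symmetric] by (simp only: mult_ac)
      then have "q (\<lambda>y. c * g y) = q g / n" by (simp add: q_def)
      ultimately show ?thesis using n by (simp add: n_def[symmetric] field_simps)
    qed
  qed
  \<comment> \<open>\<open>a - M\<close> is positive semidefinite on \<open>W\<close> and its
    quadratic form vanishes at \<open>f\<close>; perturbing \<open>f\<close> will force
    \<open>N f\<close> itself to vanish on \<open>I\<close>.\<close>
  define N where "N g = (\<lambda>x. of_real a * g x + (-1) * opr_app I M g x)" for g
  have N_ip: "inner_prod I g (N h) = inner_prod I (N g) h" for g h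
    unfolding N_def ip_lincomb_right ip_lincomb_left ip_app_self_adjoint[OF sa] by simp
  have N_lin: "N (\<lambda>x. g x + of_real t * h x) = (\<lambda>x. N g x + of_real t * N h x)" for g h t
  proof
    fix x
    have "opr_app I M (\<lambda>x. g x + of_real t * h x) x = opr_app I M g x + of_real t * opr_app I M h x"
      using fun_cong[OF app_lincomb[of I M 1 g "of_real t" h], of x] by simp
    then show "N (\<lambda>x. g x + of_real t * h x) x = N g x + of_real t * N h x"
      unfolding N_def by (simp only:) (simp add: algebra_simps)
  qed
  have N_pos: "0 \<le> Re (inner_prod I g (N g))" if "g \<in> W" for g
    using scale[OF that] unfolding N_def ip_lincomb_right q_def by simp
  have N_f: "Re (inner_prod I f (N f)) = 0" using f unfolding N_def ip_lincomb_right by (simp add: S_def a_def q_def)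
  \<comment> \<open>The perturbation goes in the direction of \<open>N f\<close>, so that the linear
    coefficient becomes twice the squared norm of \<open>h\<close>. Orthogonality to the
    \<open>u j\<close> holds because \<open>N (u j)\<close> is a multiple of \<open>u j\<close> on
    \<open>I\<close>.\<close>
  define h where "h = (\<lambda>x. if x \<in> I then N f x else 0)"
  have hW: "h \<in> W"
  proof -
    have "inner_prod I (u j) h = 0" if j: "j \<in> J" for j
    proof -
      have "inner_prod I (u j) h = inner_prod I (N (u j)) f"
        by (subst N_ip[symmetric]) (auto simp: h_def intro!: ip_cong)
      also have "\<dots> = inner_prod I (\<lambda>x. (of_real a - of_real (l j)) * u j x + 0 * u j x) f"
        using eig[OF j] by (intro ip_cong) (auto simp: N_def algebra_simps)
      also have "\<dots> = 0" using f j by (subst ip_lincomb_left) (simp add: S_def W_def)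
      finally show ?thesis .
    qed
    then show ?thesis by (simp add: W_def h_def)
  qed
  have expand: "Re (inner_prod I (\<lambda>x. f x + of_real t * h x) (N (\<lambda>x. f x + of_real t * h x)))
      = 2 * Re (inner_prod I h h) * t + Re (inner_prod I h (N h)) * t\<^sup>2" for t
  proof -
    have *: "inner_prod I g (N f) = inner_prod I g h" for g by (auto simp: h_def intro!: ip_cong)
    have **: "inner_prod I f (N h) = inner_prod I h h" unfolding N_ip by (auto simp: h_def intro!: ip_cong)
    have r: "inner_prod I g (\<lambda>x. g1 x + of_real t * g2 x) = inner_prod I g g1 + of_real t * inner_prod I g g2" for g g1 g2
      using ip_lincomb_right[of I g 1 g1 "of_real t" g2] by simp
    have l: "inner_prod I (\<lambda>x. g1 x + of_real t * g2 x) g = inner_prod I g1 g + of_real t * inner_prod I g2 g" for g g1 g2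
      using ip_lincomb_left[of I 1 g1 "of_real t" g2 g] by simp
    have "inner_prod I (\<lambda>x. f x + of_real t * h x) (N (\<lambda>x. f x + of_real t * h x))
        = inner_prod I f (N f) + of_real t * (inner_prod I f (N h) + inner_prod I h (N f)) + of_real (t\<^sup>2) * inner_prod I h (N h)"
      unfolding N_lin r l by (simp only: of_real_power) (simp add: power2_eq_square algebra_simps)
    also have "\<dots> = inner_prod I f (N f) + of_real t * (2 * inner_prod I h h) + of_real (t\<^sup>2) * inner_prod I h (N h)"
      unfolding ** using *[of h] by (simp only: mult_2)
    finally show ?thesis using N_f by simp
  qed
  have "(\<lambda>x. f x + of_real t * h x) \<in> W" for t
    using f hW ip_lincomb_right[of I _ 1 f "of_real t" h] by (simp add: S_def W_def)
  from N_pos[OF this] have "0 \<le> 2 * Re (inner_prod I h h) * t + Re (inner_prod I h (N h)) * t\<^sup>2" for t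
    by (simp only: expand)
  then have "Re (inner_prod I h h) = 0"
    by (rule linear_term_zero) (simp add: ip_self sum_nonneg)
  from ip_self_eq_0[OF fin this] have "opr_app I M f x = of_real a * f x" if "x \<in> I" for x
    using that by (simp add: h_def N_def)
  then show ?thesis using f by (intro exI[of _ f] exI[of _ a]) (auto simp: S_def W_def)
qed

lemma orthonormal_basis_ip:
  "orthonormal_basis I u \<longleftrightarrow> (\<forall>j\<in>I. \<forall>k\<in>I. inner_prod I (u j) (u k) = (if j = k then 1 else 0))"
  by (simp add: orthonormal_basis_def inner_prod_def)

text \<open>\<open>P\<close> is idempotent with trace \<open>card I\<close>, so the squared
  Hilbert-Schmidt norm of \<open>1 - P\<close> equals the trace of \<open>1 - P\<close>, which is
  zero.\<close>

lemma orthonormal_completeness: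
  assumes fin: "finite I" and u: "orthonormal_basis I u" and xy: "x \<in> I" "y \<in> I"
  shows "(\<Sum>k\<in>I. u k x * cnj (u k y)) = (if x = y then 1 else 0)"
proof -
  define P where "P = (\<lambda>x y. \<Sum>k\<in>I. u k x * cnj (u k y))"
  define R where "R = (\<lambda>x y. (if x = y then 1 else 0) - P x y)"
  have cnjP: "cnj (P x y) = P y x" for x y by (simp add: P_def mult.commute)
  have trP: "(\<Sum>x\<in>I. P x x) = of_nat (card I)"
  proof -
    have "(\<Sum>x\<in>I. P x x) = (\<Sum>k\<in>I. inner_prod I (u k) (u k))"
      unfolding P_def inner_prod_def by (subst sum.swap) (simp add: mult.commute)
    then show ?thesis using u by (simp add: orthonormal_basis_ip)
  qed
  have PP: "(\<Sum>z\<in>I. P x z * P z y) = P x y" for x y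
  proof -
    have "(\<Sum>z\<in>I. P x z * P z y) = (\<Sum>z\<in>I. \<Sum>k\<in>I. \<Sum>j\<in>I. u k x * cnj (u j y) * (cnj (u k z) * u j z))"
      unfolding P_def sum_product by (simp add: mult_ac)
    also have "\<dots> = (\<Sum>k\<in>I. \<Sum>j\<in>I. u k x * cnj (u j y) * inner_prod I (u k) (u j))"
      unfolding inner_prod_def sum_distrib_left by (rule sum_rotate)
    also have "\<dots> = (\<Sum>k\<in>I. \<Sum>j\<in>I. if j = k then u k x * cnj (u j y) else 0)"
      using u by (intro sum.cong refl) (auto simp: orthonormal_basis_ip)
    also have "\<dots> = P x y" using fin by (simp add: P_def)
    finally show ?thesis .
  qed
  have "(\<Sum>x\<in>I. \<Sum>y\<in>I. of_real ((cmod (R x y))\<^sup>2)) = (\<Sum>x\<in>I. \<Sum>y\<in>I. R x y * cnj (R x y))"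
    by (simp add: complex_norm_square[symmetric])
  also have "\<dots> = (\<Sum>x\<in>I. \<Sum>y\<in>I. (if y = x then 1 - 2 * P x x else 0) + P x y * P y x)"
    by (intro sum.cong refl) (auto simp: R_def cnjP algebra_simps)
  also have "\<dots> = (\<Sum>x\<in>I. 1 - P x x)" using fin PP by (simp add: sum.distrib)
  also have "\<dots> = 0" using trP by (simp add: sum_subtractf)
  finally have "complex_of_real (\<Sum>x\<in>I. \<Sum>y\<in>I. (cmod (R x y))\<^sup>2) = 0" by simp
  then have "(\<Sum>x\<in>I. \<Sum>y\<in>I. (cmod (R x y))\<^sup>2) = 0" using of_real_eq_0_iff by blast
  then have "R x y = 0" using fin xy by (simp add: sum_nonneg_eq_0_iff sum_nonneg)
  then show ?thesis by (simp add: R_def P_def)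
qed

text \<open>Eigenvectors are collected one index at a time over growing \<open>J\<close>; taking
  \<open>I\<close> itself as the label set ends the induction with a full basis.\<close>

lemma self_adjoint_diagonalizable:
  assumes fin: "finite I" and sa: "self_adjoint I M"
  shows "\<exists>u l. orthonormal_basis I u \<and> (\<forall>k\<in>I. \<forall>x\<in>I. opr_app I M (u k) x = of_real (l k) * u k x)"
proof -
  have "J \<subseteq> I \<Longrightarrow> \<exists>u l. (\<forall>j\<in>J. \<forall>k\<in>J. inner_prod I (u j) (u k) = (if j = k then 1 else 0)) \<and>
        (\<forall>k\<in>J. \<forall>x\<in>I. opr_app I M (u k) x = complex_of_real (l k) * u k x)" if "finite J" for J
    using that
  proof (induction J rule: finite_induct)
    case (insert j J)
    then obtain u l where u: "\<And>j k. j \<in> J \<Longrightarrow> k \<in> J \<Longrightarrow> inner_prod I (u j) (u k) = (if j = k then 1 else 0)"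
      and l: "\<And>k x. k \<in> J \<Longrightarrow> x \<in> I \<Longrightarrow> opr_app I M (u k) x = complex_of_real (l k) * u k x"
      by (metis insert_subset)
    obtain f a where f: "\<forall>j\<in>J. inner_prod I (u j) f = 0" "inner_prod I f f = 1" "\<forall>x\<in>I. opr_app I M f x = complex_of_real a * f x"
      using exists_eigenvector[OF fin _ sa u l, of J] insert by blast
    have f': "inner_prod I f (u k) = 0" if "k \<in> J" for k
      using f(1) that cnj_ip[of I "u k" f] by (metis complex_cnj_zero)
    show ?case using u l f f' insert.hyps(2)
      by (intro exI[of _ "u(j := f)"] exI[of _ "l(j := a)"]) (auto simp: opr_app_def)
  qed auto
  from this[OF fin] show ?thesis by (auto simp: orthonormal_basis_ip)
qed

section \<open>Functional calculus in an eigenbasis\<close>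

lemma spectral_opr_oprs: "spectral_opr I u l \<in> oprs I"
  by (simp add: spectral_opr_def oprs_def)

lemma app_spectral_opr:
  assumes "finite I" "orthonormal_basis I u" "k \<in> I" "x \<in> I"
  shows "opr_app I (spectral_opr I u l) (u k) x = of_real (l k) * u k x"
proof -
  have "opr_app I (spectral_opr I u l) (u k) x = (\<Sum>y\<in>I. \<Sum>j\<in>I. of_real (l j) * u j x * (cnj (u j y) * u k y))"
    using assms(4) by (simp add: opr_app_def spectral_opr_def sum_distrib_right mult.assoc)
  also have "\<dots> = (\<Sum>j\<in>I. of_real (l j) * u j x * inner_prod I (u j) (u k))"
    by (subst sum.swap) (simp add: inner_prod_def sum_distrib_left)
  also have "\<dots> = (\<Sum>j\<in>I. if j = k then of_real (l j) * u j x else 0)"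
    using assms by (intro sum.cong) (auto simp: orthonormal_basis_ip)
  finally show ?thesis using assms by simp
qed

text \<open>Inserting the completeness relation shows that an operator supported on
  \<open>I \<times> I\<close> is determined by its action on a basis.\<close>

lemma spectral_opr_eqI:
  assumes fin: "finite I" and u: "orthonormal_basis I u" and M: "M \<in> oprs I"
    and eig: "\<And>k x. k \<in> I \<Longrightarrow> x \<in> I \<Longrightarrow> opr_app I M (u k) x = of_real (l k) * u k x"
  shows "M = spectral_opr I u l"
proof (intro ext)
  fix x y
  show "M x y = spectral_opr I u l x y"
  proof (cases "x \<in> I \<and> y \<in> I")
    case True
    have "M x y = (\<Sum>z\<in>I. M x z * (if z = y then 1 else 0))" using fin True by (simp add: if_distrib cong: if_cong)
    also have "\<dots> = (\<Sum>z\<in>I. \<Sum>k\<in>I. M x z * u k z * cnj (u k y))"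
      using True by (intro sum.cong refl)
        (simp add: orthonormal_completeness[OF fin u, symmetric] sum_distrib_left mult.assoc)
    also have "\<dots> = (\<Sum>k\<in>I. opr_app I M (u k) x * cnj (u k y))"
      by (subst sum.swap) (simp add: opr_app_def sum_distrib_right)
    also have "\<dots> = spectral_opr I u l x y" using True eig by (simp add: spectral_opr_def)
    finally show ?thesis .
  qed (use M in \<open>auto simp: oprs_def spectral_opr_def\<close>)
qed

lemma spectral_theorem:
  assumes "finite I" "self_adjoint I M" "M \<in> oprs I"
  obtains u l where "orthonormal_basis I u" "M = spectral_opr I u l"
proof -
  obtain u l where "orthonormal_basis I u"
    "\<And>k x. k \<in> I \<Longrightarrow> x \<in> I \<Longrightarrow> opr_app I M (u k) x = of_real (l k) * u k x"
    using self_adjoint_diagonalizable[OF assms(1,2)] by blast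
  then show ?thesis using spectral_opr_eqI[OF assms(1) _ assms(3)] that by blast
qed

lemma self_adjoint_spectral_opr: "self_adjoint I (spectral_opr I u l)"
  by (simp add: self_adjoint_def spectral_opr_def mult_ac)

lemma positive_definite_spectral:
  assumes fin: "finite I" and M: "positive_definite I M" "M \<in> oprs I"
  obtains u l where "orthonormal_basis I u" "M = spectral_opr I u l" "\<And>k. k \<in> I \<Longrightarrow> l k > 0"
proof -
  obtain u l where u: "orthonormal_basis I u" and Ml: "M = spectral_opr I u l"
    using spectral_theorem[OF fin] M by (auto simp: positive_definite_def)
  have "l k > 0" if k: "k \<in> I" for k
  proof -
    have "inner_prod I (u k) (u k) = 1" using u k by (simp add: orthonormal_basis_ip)
    then have "\<exists>x\<in>I. u k x \<noteq> 0" by (metis (no_types, lifting) inner_prod_def mult_zero_right sum.neutral zero_neq_one)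
    with M have "0 < Re (\<Sum>x\<in>I. \<Sum>y\<in>I. cnj (u k x) * M x y * u k y)" by (simp add: positive_definite_def)
    also have "(\<Sum>x\<in>I. \<Sum>y\<in>I. cnj (u k x) * M x y * u k y) = inner_prod I (u k) (opr_app I M (u k))"
      by (simp add: inner_prod_def opr_app_def sum_distrib_left mult.assoc)
    also have "\<dots> = inner_prod I (u k) (\<lambda>x. of_real (l k) * u k x + 0 * u k x)"
      using k u fin by (intro ip_cong) (auto simp: app_spectral_opr Ml)
    also have "\<dots> = of_real (l k)" using u k by (subst ip_lincomb_right) (simp add: orthonormal_basis_ip)
    finally show ?thesis by simp
  qed
  with u Ml that show ?thesis by blast
qed

text \<open>The overlap of \<open>u j\<close> and \<open>u' k\<close> vanishes unless the two eigenvalues agree.\<close>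

lemma spectral_opr_cong_fun:
  assumes fin: "finite I" and u: "orthonormal_basis I u" and u': "orthonormal_basis I u'"
    and eq: "spectral_opr I u l = spectral_opr I u' l'"
  shows "spectral_opr I u (\<lambda>k. f (l k)) = spectral_opr I u' (\<lambda>k. f (l' k))"
proof (rule spectral_opr_eqI[OF fin u' spectral_opr_oprs])
  fix k x assume k: "k \<in> I" and x: "x \<in> I"
  have "of_real (l' k) * inner_prod I (u j) (u' k) = of_real (l j) * inner_prod I (u j) (u' k)" if j: "j \<in> I" for j
  proof -
    have "of_real (l' k) * inner_prod I (u j) (u' k) = inner_prod I (u j) (\<lambda>x. of_real (l' k) * u' k x + 0 * u' k x)"
      by (subst ip_lincomb_right) simp
    also have "\<dots> = inner_prod I (u j) (opr_app I (spectral_opr I u l) (u' k))"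
      unfolding eq using app_spectral_opr[OF fin u' k] by (intro ip_cong) auto
    also have "\<dots> = inner_prod I (opr_app I (spectral_opr I u l) (u j)) (u' k)"
      by (rule ip_app_self_adjoint[OF self_adjoint_spectral_opr])
    also have "\<dots> = inner_prod I (\<lambda>x. of_real (l j) * u j x + 0 * u j x) (u' k)"
      using app_spectral_opr[OF fin u j] by (intro ip_cong) auto
    finally show ?thesis by (subst (asm) ip_lincomb_left) simp
  qed
  then have *: "of_real (f (l j)) * inner_prod I (u j) (u' k) = of_real (f (l' k)) * inner_prod I (u j) (u' k)" if "j \<in> I" for j
    using that by (metis mult_cancel_right of_real_eq_iff)
  have "opr_app I (spectral_opr I u (\<lambda>k. f (l k))) (u' k) x =
      (\<Sum>j\<in>I. of_real (f (l j)) * inner_prod I (u j) (u' k) * u j x)"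
    using x unfolding opr_app_def spectral_opr_def inner_prod_def
    by (simp add: sum_distrib_right sum_distrib_left, subst sum.swap) (simp add: algebra_simps)
  also have "\<dots> = of_real (f (l' k)) * (\<Sum>j\<in>I. inner_prod I (u j) (u' k) * u j x)"
    unfolding sum_distrib_left mult.assoc[symmetric] by (intro sum.cong refl) (simp only: *)
  also have "(\<Sum>j\<in>I. inner_prod I (u j) (u' k) * u j x) = (\<Sum>y\<in>I. u' k y * (\<Sum>j\<in>I. u j x * cnj (u j y)))"
    unfolding inner_prod_def by (simp add: sum_distrib_right sum_distrib_left, subst sum.swap) (simp add: algebra_simps)
  also have "\<dots> = u' k x" using fin x by (simp add: orthonormal_completeness[OF fin u] if_distrib cong: if_cong)
  finally show "opr_app I (spectral_opr I u (\<lambda>k. f (l k))) (u' k) x = of_real (f (l' k)) * u' k x" .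
qed

text \<open>The definite description is legitimate because, by \<open>spectral_opr_cong_fun\<close>
  applied to \<open>ln\<close>, every spectral decomposition yields the same operator.\<close>

lemma opr_log_spectral_opr:
  assumes "finite I" "orthonormal_basis I u"
  shows "opr_log I (spectral_opr I u l) = spectral_opr I u (\<lambda>k. ln (l k))"
  unfolding opr_log_def
proof (rule the_equality)
  show "\<exists>u' l'. orthonormal_basis I u' \<and> spectral_opr I u l = spectral_opr I u' l' \<and>
      spectral_opr I u (\<lambda>k. ln (l k)) = spectral_opr I u' (\<lambda>k. ln (l' k))"
    using assms(2) by blast
next
  fix L
  assume "\<exists>u' l'. orthonormal_basis I u' \<and> spectral_opr I u l = spectral_opr I u' l' \<and>
      L = spectral_opr I u' (\<lambda>k. ln (l' k))"
  then obtain u' l' where u': "orthonormal_basis I u'" "spectral_opr I u l = spectral_opr I u' l'"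
    and L: "L = spectral_opr I u' (\<lambda>k. ln (l' k))" by blast
  show "L = spectral_opr I u (\<lambda>k. ln (l k))"
    unfolding L by (rule spectral_opr_cong_fun[OF assms u', symmetric])
qed

lemma opr_power_spectral_opr:
  assumes fin: "finite I" and u: "orthonormal_basis I u"
  shows "opr_power I (spectral_opr I u l) n = spectral_opr I u (\<lambda>k. l k ^ n)"
proof (induction n)
  case 0
  show ?case
    by (auto simp: fun_eq_iff opr_id_def spectral_opr_def orthonormal_completeness[OF fin u])
next
  case (Suc n)
  have "opr_mult I (spectral_opr I u l) (spectral_opr I u (\<lambda>k. l k ^ n)) x y
      = spectral_opr I u (\<lambda>k. l k ^ Suc n) x y" for x y
  proof (cases "x \<in> I \<and> y \<in> I")
    case True
    have "opr_mult I (spectral_opr I u l) (spectral_opr I u (\<lambda>k. l k ^ n)) x y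
      = (\<Sum>k\<in>I. of_real (l k ^ n) * opr_app I (spectral_opr I u l) (u k) x * cnj (u k y))"
      using True unfolding opr_mult_def opr_app_def
      by (simp add: spectral_opr_def[of I u "\<lambda>k. l k ^ n"] sum_distrib_left sum_distrib_right, subst sum.swap)
        (simp add: algebra_simps)
    also have "\<dots> = (\<Sum>k\<in>I. of_real (l k ^ Suc n) * u k x * cnj (u k y))"
      using True by (intro sum.cong refl) (simp add: app_spectral_opr[OF fin u])
    finally show ?thesis using True by (simp add: spectral_opr_def)
  qed (auto simp: spectral_opr_def opr_mult_def)
  then show ?case unfolding opr_power.simps Suc by blast
qed

lemma opr_exp_spectral_opr:
  assumes fin: "finite I" and u: "orthonormal_basis I u"
  shows "opr_exp I (spectral_opr I u l) = spectral_opr I u (\<lambda>k. exp (l k))"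
proof (intro ext)
  fix x y
  show "opr_exp I (spectral_opr I u l) x y = spectral_opr I u (\<lambda>k. exp (l k)) x y"
  proof (cases "x \<in> I \<and> y \<in> I")
    case True
    have "(\<lambda>n. \<Sum>k\<in>I. complex_of_real (l k ^ n /\<^sub>R fact n) * (u k x * cnj (u k y))) sums
          (\<Sum>k\<in>I. complex_of_real (exp (l k)) * (u k x * cnj (u k y)))"
      by (intro sums_sum sums_mult2 sums_of_real exp_converges)
    moreover have "(\<lambda>n. \<Sum>k\<in>I. complex_of_real (l k ^ n /\<^sub>R fact n) * (u k x * cnj (u k y)))
        = (\<lambda>n. opr_power I (spectral_opr I u l) n x y / fact n)"
      using True unfolding opr_power_spectral_opr[OF fin u]
      by (simp add: spectral_opr_def sum_distrib_left divide_inverse algebra_simps)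
    ultimately have "(\<lambda>n. opr_power I (spectral_opr I u l) n x y / fact n) sums
          (\<Sum>k\<in>I. complex_of_real (exp (l k)) * (u k x * cnj (u k y)))" by simp
    then show ?thesis using True by (simp add: opr_exp_def sums_iff spectral_opr_def mult.assoc)
  next
    case False
    then show ?thesis
      unfolding opr_exp_def opr_power_spectral_opr[OF fin u] by (auto simp: spectral_opr_def)
  qed
qed

section \<open>Monotonicity of the relative entropy\<close>

lemma sum_swap_pairs:
  "(\<Sum>x\<in>A. \<Sum>y\<in>B. \<Sum>j\<in>C. \<Sum>k\<in>D. f x y j k) = (\<Sum>j\<in>C. \<Sum>k\<in>D. \<Sum>x\<in>A. \<Sum>y\<in>B. f x y j k)"
  unfolding sum_rotate[of _ D C B] by (rule sum_rotate)

text \<open>Equal total weights cancel the divergent \<open>ln s\<close>; what remains is a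
  combination of differences \<open>ln (s + a) - ln s\<close>, each tending to zero.\<close>

lemma log_sum_tendsto_0:
  fixes c t c1 t1 :: "'k \<Rightarrow> real"
  assumes "sum c K = sum c1 K"
  shows "((\<lambda>s. \<Sum>k\<in>K. c k * ln (s + t k) - c1 k * ln (s + t1 k)) \<longlongrightarrow> 0) at_top"
proof -
  have *: "((\<lambda>s::real. ln (s + a) - ln s) \<longlongrightarrow> 0) at_top" for a :: real
    by real_asymp
  have "((\<lambda>s. \<Sum>k\<in>K. c k * (ln (s + t k) - ln s) - c1 k * (ln (s + t1 k) - ln s)) \<longlongrightarrow> (\<Sum>k\<in>K. c k * 0 - c1 k * 0)) at_top"
    by (intro tendsto_intros *)
  moreover have "(\<Sum>k\<in>K. c k * (ln (s + t k) - ln s) - c1 k * (ln (s + t1 k) - ln s)) =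
      (\<Sum>k\<in>K. c k * ln (s + t k) - c1 k * ln (s + t1 k)) - (sum c K - sum c1 K) * ln s" for s
    by (simp add: right_diff_distrib left_diff_distrib sum_subtractf sum_distrib_right)
  ultimately show ?thesis using assms by simp
qed

text \<open>The rational sum is the derivative of the logarithmic sum \<open>G\<close>, which
  therefore increases on the nonnegative half line to its limit zero. If \<open>G\<close> starts at
  zero, it is squeezed to a constant and its derivative vanishes for \<open>s > 0\<close>.\<close>

lemma log_sum_mono:
  fixes c t c1 t1 :: "'k \<Rightarrow> real"
  assumes fin: "finite K" and t: "\<forall>k\<in>K. t k > 0" "\<forall>k\<in>K. t1 k > 0"
    and eq: "sum c K = sum c1 K"
    and nonneg: "\<forall>s>0. 0 \<le> (\<Sum>k\<in>K. c k / (s + t k) - c1 k / (s + t1 k))"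
  shows "(\<Sum>k\<in>K. c k * ln (t k) - c1 k * ln (t1 k)) \<le> 0"
    and "(\<Sum>k\<in>K. c k * ln (t k) - c1 k * ln (t1 k)) = 0 \<Longrightarrow> s > 0 \<Longrightarrow>
      (\<Sum>k\<in>K. c k / (s + t k) - c1 k / (s + t1 k)) = 0"
proof -
  define G where "G s = (\<Sum>k\<in>K. c k * ln (s + t k) - c1 k * ln (s + t1 k))" for s
  define g where "g s = (\<Sum>k\<in>K. c k / (s + t k) - c1 k / (s + t1 k))" for s
  have pos: "s + t k > 0" "s + t1 k > 0" if "s \<ge> 0" "k \<in> K" for s k
    using t that by (simp_all add: add_nonneg_pos)
  have der: "(G has_real_derivative g s) (at s)" if "s \<ge> 0" for s
    unfolding G_def g_def using pos[OF that]
    by (auto intro!: derivative_eq_intros sum.cong simp: divide_inverse)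
  have mono: "G a \<le> G b" if "0 \<le> a" "a \<le> b" for a b
    using \<open>a \<le> b\<close>
  proof (rule DERIV_nonneg_imp_increasing_open)
    fix x assume "a < x" "x < b"
    then show "\<exists>y. DERIV G x :> y \<and> 0 \<le> y"
      using der[of x] nonneg that by (auto simp: g_def)
  next
    show "continuous_on {a..b} G"
      using der that by (intro DERIV_continuous_on[of _ _ g]) (auto intro: has_field_derivative_at_within)
  qed
  have lim: "(G \<longlongrightarrow> 0) at_top" unfolding G_def by (rule log_sum_tendsto_0[OF eq])
  have le: "G a \<le> 0" if "0 \<le> a" for a
    using lim mono[OF that]
    by (intro tendsto_lowerbound[OF lim]) (auto simp: eventually_at_top_linorder)
  show "(\<Sum>k\<in>K. c k * ln (t k) - c1 k * ln (t1 k)) \<le> 0" using le[of 0] by (simp add: G_def)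
  show "(\<Sum>k\<in>K. c k / (s + t k) - c1 k / (s + t1 k)) = 0"
    if "(\<Sum>k\<in>K. c k * ln (t k) - c1 k * ln (t1 k)) = 0" "s > 0"
  proof -
    have "G a = 0" if a: "0 < a" for a
      using mono[of 0 a] le[of a] \<open>(\<Sum>k\<in>K. c k * ln (t k) - c1 k * ln (t1 k)) = 0\<close> a by (simp add: G_def)
    then have "\<forall>\<^sub>F x in nhds s. G x = 0"
      using eventually_nhds_in_open[of "{0<..}" s] \<open>s > 0\<close> by (auto elim!: eventually_mono)
    then have "(G has_real_derivative 0) (at s)"
      by (subst DERIV_cong_ev[OF refl _ refl, of _ "\<lambda>_. 0"]) auto
    then have "g s = 0" using der[of s] \<open>s > 0\<close> DERIV_unique by force
    then show ?thesis by (simp add: g_def)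
  qed
qed

text \<open>Real and imaginary parts are treated separately; for each, a vanishing derivative
  satisfies the sign condition of \<open>log_sum_mono\<close> in both directions.\<close>

lemma log_sum_eq:
  fixes c c1 :: "'k \<Rightarrow> complex" and t t1 :: "'k \<Rightarrow> real"
  assumes fin: "finite K" and t: "\<forall>k\<in>K. t k > 0" "\<forall>k\<in>K. t1 k > 0"
    and eq: "sum c K = sum c1 K"
    and res: "\<And>s. s > 0 \<Longrightarrow> (\<Sum>k\<in>K. c k / of_real (s + t k)) = (\<Sum>k\<in>K. c1 k / of_real (s + t1 k))"
  shows "(\<Sum>k\<in>K. c k * of_real (ln (t k))) = (\<Sum>k\<in>K. c1 k * of_real (ln (t1 k)))"
proof -
  have *: "(\<Sum>k\<in>K. b k * ln (t k) - b1 k * ln (t1 k)) = 0"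
    if b: "sum b K = sum b1 K"
      and r: "\<And>s. s > 0 \<Longrightarrow> (\<Sum>k\<in>K. b k / (s + t k)) = (\<Sum>k\<in>K. b1 k / (s + t1 k))"
    for b b1 :: "'k \<Rightarrow> real"
  proof (rule antisym)
    show "(\<Sum>k\<in>K. b k * ln (t k) - b1 k * ln (t1 k)) \<le> 0"
      using r by (intro log_sum_mono(1)[OF fin t b]) (auto simp: sum_subtractf)
    have "(\<Sum>k\<in>K. b1 k * ln (t1 k) - b k * ln (t k)) \<le> 0"
      using r by (intro log_sum_mono(1)[OF fin t(2,1) b[symmetric]]) (auto simp: sum_subtractf)
    then show "0 \<le> (\<Sum>k\<in>K. b k * ln (t k) - b1 k * ln (t1 k))" by (simp add: sum_subtractf)
  qed
  have "Re (sum c K) = Re (sum c1 K)" "Im (sum c K) = Im (sum c1 K)" using eq by simp_all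
  moreover have "Re (\<Sum>k\<in>K. c k / of_real (s + t k)) = Re (\<Sum>k\<in>K. c1 k / of_real (s + t1 k))"
    "Im (\<Sum>k\<in>K. c k / of_real (s + t k)) = Im (\<Sum>k\<in>K. c1 k / of_real (s + t1 k))" if "s > 0" for s
    using res[OF that] by simp_all
  ultimately show ?thesis
    using *[of "\<lambda>k. Re (c k)" "\<lambda>k. Re (c1 k)"] *[of "\<lambda>k. Im (c k)" "\<lambda>k. Im (c1 k)"]
    by (intro complex_eqI) (simp_all del: of_real_add add: sum_subtractf)
qed

section \<open>Hilbert-Schmidt inner product and expansion in two bases\<close>

definition hs_inner :: "'i set \<Rightarrow> 'i opr \<Rightarrow> 'i opr \<Rightarrow> complex" where
  "hs_inner I M N = (\<Sum>x\<in>I. \<Sum>y\<in>I. cnj (M x y) * N x y)"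

definition opr_adj :: "'i opr \<Rightarrow> 'i opr" where
  "opr_adj M = (\<lambda>x y. cnj (M y x))"

lemma adj_adj: "opr_adj (opr_adj M) = M"
  by (simp add: opr_adj_def)

lemma adj_mult: "opr_adj (opr_mult I M N) = opr_mult I (opr_adj N) (opr_adj M)"
  by (simp add: opr_adj_def opr_mult_def mult.commute)

lemma hs_trace: "hs_inner I M N = opr_trace I (opr_mult I (opr_adj M) N)"
  unfolding hs_inner_def opr_trace_def opr_mult_def opr_adj_def by (rule sum.swap)

lemma cnj_hs: "cnj (hs_inner I M N) = hs_inner I N M"
  by (simp add: hs_inner_def mult.commute)

lemma hs_lincomb_right: "hs_inner I L (\<lambda>x y. a * M x y + b * N x y) = a * hs_inner I L M + b * hs_inner I L N"
  by (simp add: hs_inner_def sum_distrib_left sum.distrib algebra_simps)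

lemma hs_lincomb_left: "hs_inner I (\<lambda>x y. a * M x y + b * N x y) L = cnj a * hs_inner I M L + cnj b * hs_inner I N L"
  by (simp add: hs_inner_def sum_distrib_left sum.distrib algebra_simps)

lemma hs_diff: "hs_inner I L (\<lambda>x y. M x y - N x y) = hs_inner I L M - hs_inner I L N"
  using hs_lincomb_right[of I L 1 M "-1" N] by simp

lemma hs_sum: "hs_inner I L (\<lambda>x y. \<Sum>v\<in>A. M v x y) = (\<Sum>v\<in>A. hs_inner I L (M v))"
proof -
  have "hs_inner I L (\<lambda>x y. \<Sum>v\<in>A. M v x y) = (\<Sum>x\<in>I. \<Sum>y\<in>I. \<Sum>v\<in>A. cnj (L x y) * M v x y)"
    by (simp add: hs_inner_def sum_distrib_left)
  also have "\<dots> = (\<Sum>v\<in>A. hs_inner I L (M v))"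
    unfolding hs_inner_def by (rule sum_rotate[symmetric])
  finally show ?thesis .
qed

lemma opr_mult_lincomb_left:
  "opr_mult I (\<lambda>x y. a * M x y + b * N x y) L = (\<lambda>x y. a * opr_mult I M L x y + b * opr_mult I N L x y)"
  by (simp add: opr_mult_def sum_distrib_left sum.distrib algebra_simps)

lemma opr_mult_lincomb_right:
  "opr_mult I L (\<lambda>x y. a * M x y + b * N x y) = (\<lambda>x y. a * opr_mult I L M x y + b * opr_mult I L N x y)"
  by (simp add: opr_mult_def sum_distrib_left sum.distrib algebra_simps)

text \<open>Operators expanded in two orthonormal bases: \<open>C j k\<close> is the coefficient of \<open>|w\<^sub>j><u\<^sub>k|\<close>. Left multiplication by an
  operator diagonal in \<open>w\<close> and right multiplication by one diagonal in \<open>u\<close> then act on \<open>C\<close> entrywise.\<close>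

definition mixed :: "'i set \<Rightarrow> ('i \<Rightarrow> 'i \<Rightarrow> complex) \<Rightarrow> ('i \<Rightarrow> 'i \<Rightarrow> complex) \<Rightarrow> ('i \<Rightarrow> 'i \<Rightarrow> complex) \<Rightarrow> 'i opr" where
  "mixed I w u C = (\<lambda>x y. if x \<in> I \<and> y \<in> I then \<Sum>j\<in>I. \<Sum>k\<in>I. C j k * w j x * cnj (u k y) else 0)"

definition coef :: "'i set \<Rightarrow> ('i \<Rightarrow> 'i \<Rightarrow> complex) \<Rightarrow> ('i \<Rightarrow> 'i \<Rightarrow> complex) \<Rightarrow> 'i opr \<Rightarrow> 'i \<Rightarrow> 'i \<Rightarrow> complex" where
  "coef I w u M j k = (\<Sum>x\<in>I. \<Sum>y\<in>I. cnj (w j x) * M x y * u k y)"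

lemma mixed_oprs: "mixed I w u C \<in> oprs I"
  by (simp add: mixed_def oprs_def)

lemma mixed_cong: "(\<And>j k. j \<in> I \<Longrightarrow> k \<in> I \<Longrightarrow> C j k = D j k) \<Longrightarrow> mixed I w u C = mixed I w u D"
  unfolding mixed_def by (intro ext if_cong sum.cong refl) auto

lemma mixed_lincomb:
  "mixed I w u (\<lambda>j k. a * C j k + b * D j k) = (\<lambda>x y. a * mixed I w u C x y + b * mixed I w u D x y)"
  by (simp add: mixed_def fun_eq_iff sum_distrib_left sum.distrib algebra_simps)

lemma mixed_coef:
  assumes fin: "finite I" and w: "orthonormal_basis I w" and u: "orthonormal_basis I u" and M: "M \<in> oprs I"
  shows "mixed I w u (coef I w u M) = M"
proof (intro ext)
  fix x y
  show "mixed I w u (coef I w u M) x y = M x y"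
  proof (cases "x \<in> I \<and> y \<in> I")
    case True
    have "mixed I w u (coef I w u M) x y =
       (\<Sum>j\<in>I. \<Sum>k\<in>I. \<Sum>x'\<in>I. \<Sum>y'\<in>I. M x' y' * ((w j x * cnj (w j x')) * (u k y' * cnj (u k y))))"
      using True unfolding mixed_def coef_def by (simp add: sum_distrib_left sum_distrib_right mult_ac)
    also have "\<dots> = (\<Sum>x'\<in>I. \<Sum>y'\<in>I. \<Sum>j\<in>I. \<Sum>k\<in>I. M x' y' * ((w j x * cnj (w j x')) * (u k y' * cnj (u k y))))"
      by (rule sum_swap_pairs)
    also have "\<dots> = (\<Sum>x'\<in>I. \<Sum>y'\<in>I. M x' y' * ((\<Sum>j\<in>I. w j x * cnj (w j x')) * (\<Sum>k\<in>I. u k y' * cnj (u k y))))"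
      unfolding sum_product unfolding sum_distrib_left ..
    also have "\<dots> = (\<Sum>x'\<in>I. \<Sum>y'\<in>I. if x = x' then (if y' = y then M x' y' else 0) else 0)"
      using True by (intro sum.cong refl)
        (simp add: orthonormal_completeness[OF fin w] orthonormal_completeness[OF fin u])
    also have "\<dots> = (\<Sum>x'\<in>I. if x = x' then M x' y else 0)"
      using True fin by (intro sum.cong refl) auto
    also have "\<dots> = M x y" using True fin by simp
    finally show ?thesis .
  qed (use M in \<open>auto simp: mixed_def oprs_def\<close>)
qed

lemma coef_mixed:
  assumes fin: "finite I" and w: "orthonormal_basis I w" and u: "orthonormal_basis I u" and jk: "j \<in> I" "k \<in> I"
  shows "coef I w u (mixed I w u C) j k = C j k"
proof -
  have "coef I w u (mixed I w u C) j k =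
     (\<Sum>x\<in>I. \<Sum>y\<in>I. \<Sum>j'\<in>I. \<Sum>k'\<in>I. C j' k' * ((cnj (w j x) * w j' x) * (cnj (u k' y) * u k y)))"
    unfolding mixed_def coef_def by (simp add: sum_distrib_left sum_distrib_right mult_ac)
  also have "\<dots> = (\<Sum>j'\<in>I. \<Sum>k'\<in>I. C j' k' * (inner_prod I (w j) (w j') * inner_prod I (u k') (u k)))"
    unfolding inner_prod_def sum_product unfolding sum_distrib_left by (rule sum_swap_pairs)
  also have "\<dots> = (\<Sum>j'\<in>I. \<Sum>k'\<in>I. if j = j' then (if k' = k then C j' k' else 0) else 0)"
    using jk w u by (intro sum.cong refl) (auto simp: orthonormal_basis_ip)
  also have "\<dots> = (\<Sum>j'\<in>I. if j = j' then C j' k else 0)"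
    using jk fin by (intro sum.cong refl) auto
  also have "\<dots> = C j k" using jk fin by simp
  finally show ?thesis .
qed

text \<open>Parseval's identity for the operators built from the pairs \<open>w j\<close>,
  \<open>u k\<close>, which form an orthonormal basis in the Hilbert-Schmidt sense.\<close>

lemma hs_mixed:
  assumes fin: "finite I" and w: "orthonormal_basis I w" and u: "orthonormal_basis I u"
  shows "hs_inner I (mixed I w u C) (mixed I w u D) = (\<Sum>j\<in>I. \<Sum>k\<in>I. cnj (C j k) * D j k)"
proof -
  have "hs_inner I (mixed I w u C) (mixed I w u D) =
    (\<Sum>x\<in>I. \<Sum>y\<in>I. \<Sum>j\<in>I. \<Sum>k\<in>I. cnj (C j k) * (cnj (w j x) * mixed I w u D x y * u k y))"
    unfolding hs_inner_def by (intro sum.cong refl)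
      (subst mixed_def, simp add: sum_distrib_left sum_distrib_right mult_ac)
  also have "\<dots> = (\<Sum>j\<in>I. \<Sum>k\<in>I. cnj (C j k) * coef I w u (mixed I w u D) j k)"
    unfolding coef_def sum_distrib_left by (rule sum_swap_pairs)
  also have "\<dots> = (\<Sum>j\<in>I. \<Sum>k\<in>I. cnj (C j k) * D j k)"
    by (intro sum.cong refl) (simp add: coef_mixed[OF fin w u])
  finally show ?thesis .
qed

lemma spectral_mult_mixed:
  assumes fin: "finite I" and w: "orthonormal_basis I w"
  shows "opr_mult I (spectral_opr I w q) (mixed I w u C) = mixed I w u (\<lambda>j k. of_real (q j) * C j k)"
proof (intro ext)
  fix x y
  show "opr_mult I (spectral_opr I w q) (mixed I w u C) x y = mixed I w u (\<lambda>j k. of_real (q j) * C j k) x y"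
  proof (cases "x \<in> I \<and> y \<in> I")
    case True
    have "opr_mult I (spectral_opr I w q) (mixed I w u C) x y =
       (\<Sum>z\<in>I. \<Sum>j\<in>I. \<Sum>k\<in>I. C j k * (spectral_opr I w q x z * w j z) * cnj (u k y))"
      using True unfolding opr_mult_def mixed_def by (simp add: sum_distrib_left mult_ac)
    also have "\<dots> = (\<Sum>j\<in>I. \<Sum>k\<in>I. C j k * opr_app I (spectral_opr I w q) (w j) x * cnj (u k y))"
      unfolding opr_app_def sum_distrib_left sum_distrib_right by (rule sum_rotate)
    also have "\<dots> = mixed I w u (\<lambda>j k. of_real (q j) * C j k) x y"
      using True unfolding mixed_def by (simp add: app_spectral_opr[OF fin w] mult_ac)
    finally show ?thesis .
  qed (auto simp: opr_mult_def mixed_def spectral_opr_def)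
qed

lemma adj_spectral_opr: "opr_adj (spectral_opr I u l) = spectral_opr I u l"
  by (auto simp: opr_adj_def spectral_opr_def fun_eq_iff mult_ac)

lemma adj_mixed: "opr_adj (mixed I w u C) = mixed I u w (\<lambda>j k. cnj (C k j))"
proof (intro ext)
  fix x y
  have "(\<Sum>j\<in>I. \<Sum>k\<in>I. cnj (C j k * w j y * cnj (u k x))) = (\<Sum>k\<in>I. \<Sum>j\<in>I. cnj (C j k * w j y * cnj (u k x)))"
    by (rule sum.swap)
  then show "opr_adj (mixed I w u C) x y = mixed I u w (\<lambda>j k. cnj (C k j)) x y"
    by (simp add: opr_adj_def mixed_def mult_ac)
qed

lemma mixed_mult_spectral:
  assumes fin: "finite I" and u: "orthonormal_basis I u"
  shows "opr_mult I (mixed I w u C) (spectral_opr I u p) = mixed I w u (\<lambda>j k. of_real (p k) * C j k)"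
proof -
  have "opr_adj (opr_mult I (mixed I w u C) (spectral_opr I u p)) = opr_adj (mixed I w u (\<lambda>j k. of_real (p k) * C j k))"
    by (simp add: adj_mult adj_spectral_opr adj_mixed spectral_mult_mixed[OF fin u])
  then show ?thesis by (metis adj_adj)
qed

text \<open>Since \<open>u k\<close> is an eigenvector, the coefficients are the overlaps of the two
  bases, weighted by the eigenvalue of the column.\<close>

lemma spectral_right_mixed:
  assumes fin: "finite I" and w: "orthonormal_basis I w" and u: "orthonormal_basis I u"
  shows "spectral_opr I u p = mixed I w u (\<lambda>j k. of_real (p k) * inner_prod I (w j) (u k))"
proof -
  have "coef I w u (spectral_opr I u p) j k = of_real (p k) * inner_prod I (w j) (u k)" if "j \<in> I" "k \<in> I" for j k
  proof -
    have "coef I w u (spectral_opr I u p) j k = (\<Sum>x\<in>I. cnj (w j x) * opr_app I (spectral_opr I u p) (u k) x)"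
      by (simp add: coef_def opr_app_def sum_distrib_left mult.assoc)
    then show ?thesis using that by (simp add: app_spectral_opr[OF fin u] inner_prod_def sum_distrib_left mult_ac)
  qed
  then have "mixed I w u (coef I w u (spectral_opr I u p)) = mixed I w u (\<lambda>j k. of_real (p k) * inner_prod I (w j) (u k))"
    by (rule mixed_cong)
  then show ?thesis unfolding mixed_coef[OF fin w u spectral_opr_oprs] .
qed

lemma spectral_left_mixed:
  assumes fin: "finite I" and w: "orthonormal_basis I w" and u: "orthonormal_basis I u"
  shows "spectral_opr I w q = mixed I w u (\<lambda>j k. of_real (q j) * inner_prod I (w j) (u k))"
  using arg_cong[OF spectral_right_mixed[OF fin u w, of q], of opr_adj]
  by (simp add: adj_spectral_opr adj_mixed cnj_ip)

section \<open>The Sylvester equation\<close>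

text \<open>For invertible \<open>R\<close> this is, up to right multiplication by \<open>R\<close>,
  the map \<open>s + \<Delta>\<close>, where \<open>\<Delta>\<close> sends \<open>M\<close> to
  \<open>T M R^(-1)\<close>: the relative modular operator. The factor \<open>1\<close> keeps the
  body in the shape of the linear combination rules.\<close>

definition sylvester :: "'i set \<Rightarrow> real \<Rightarrow> 'i opr \<Rightarrow> 'i opr \<Rightarrow> 'i opr \<Rightarrow> 'i opr" where
  "sylvester I s R T M = (\<lambda>x y. of_real s * opr_mult I M R x y + 1 * opr_mult I T M x y)"

lemma sylvester_lincomb:
  "sylvester I s R T (\<lambda>x y. a * M x y + b * N x y) =
    (\<lambda>x y. a * sylvester I s R T M x y + b * sylvester I s R T N x y)"
  unfolding sylvester_def opr_mult_lincomb_left opr_mult_lincomb_right by (simp add: algebra_simps)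

text \<open>In the eigenbases of the two operators the Sylvester map is diagonal; self-adjointness,
  positivity and invertibility are read off from its eigenvalues.\<close>

lemma sylvester_mixed:
  assumes "finite I" "orthonormal_basis I w" "orthonormal_basis I u"
  shows "sylvester I s (spectral_opr I u p) (spectral_opr I w q) (mixed I w u C) =
    mixed I w u (\<lambda>j k. of_real (s * p k + q j) * C j k)"
  unfolding sylvester_def mixed_mult_spectral[OF assms(1,3)] spectral_mult_mixed[OF assms(1,2)]
    mixed_lincomb[symmetric] by (simp add: algebra_simps)

lemma sylvester_self_adjoint:
  assumes fin: "finite I" and w: "orthonormal_basis I w" and u: "orthonormal_basis I u"
    and M: "M \<in> oprs I" and N: "N \<in> oprs I"
  shows "hs_inner I M (sylvester I s (spectral_opr I u p) (spectral_opr I w q) N) =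
    hs_inner I (sylvester I s (spectral_opr I u p) (spectral_opr I w q) M) N"
proof -
  obtain C D where M': "M = mixed I w u C" and N': "N = mixed I w u D"
    using mixed_coef[OF fin w u] M N by metis
  show ?thesis unfolding M' N' sylvester_mixed[OF fin w u] hs_mixed[OF fin w u]
    by (simp add: mult_ac)
qed

lemma sylvester_positive:
  assumes fin: "finite I" and w: "orthonormal_basis I w" and u: "orthonormal_basis I u"
    and p: "\<forall>k\<in>I. p k > 0" and q: "\<forall>k\<in>I. q k > 0" and s: "s \<ge> 0"
    and M: "M \<in> oprs I"
  shows "0 \<le> Re (hs_inner I M (sylvester I s (spectral_opr I u p) (spectral_opr I w q) M))"
    and "Re (hs_inner I M (sylvester I s (spectral_opr I u p) (spectral_opr I w q) M)) = 0 \<Longrightarrow> M = (\<lambda>x y. 0)"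
proof -
  obtain C where M': "M = mixed I w u C" using mixed_coef[OF fin w u] M by metis
  have pos: "s * p k + q j > 0" if "j \<in> I" "k \<in> I" for j k
    using p q s that by (simp add: add_nonneg_pos less_imp_le)
  have sq: "cnj (C j k) * (of_real (s * p k + q j) * C j k) = of_real ((s * p k + q j) * (cmod (C j k))\<^sup>2)" for j k
    unfolding of_real_mult complex_norm_square by (simp only: mult_ac)
  have eq: "Re (hs_inner I M (sylvester I s (spectral_opr I u p) (spectral_opr I w q) M)) =
      (\<Sum>j\<in>I. \<Sum>k\<in>I. (s * p k + q j) * (cmod (C j k))\<^sup>2)"
    unfolding M' sylvester_mixed[OF fin w u] hs_mixed[OF fin w u] sq by simp
  have nn: "0 \<le> (s * p k + q j) * (cmod (C j k))\<^sup>2" if "j \<in> I" "k \<in> I" for j k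
    using pos[OF that] by simp
  show "0 \<le> Re (hs_inner I M (sylvester I s (spectral_opr I u p) (spectral_opr I w q) M))"
    unfolding eq by (intro sum_nonneg nn)
  assume "Re (hs_inner I M (sylvester I s (spectral_opr I u p) (spectral_opr I w q) M)) = 0"
  then have "\<forall>j\<in>I. \<forall>k\<in>I. (s * p k + q j) * (cmod (C j k))\<^sup>2 = 0"
    unfolding eq using fin nn by (simp add: sum_nonneg_eq_0_iff sum_nonneg)
  then have "\<forall>j\<in>I. \<forall>k\<in>I. C j k = 0" using pos by (metis less_irrefl mult_eq_0_iff norm_eq_zero power2_eq_square)
  then show "M = (\<lambda>x y. 0)" by (auto simp: M' mixed_def fun_eq_iff)
qed

text \<open>The resolvent of the relative modular operator applied to the identity, whose
  coefficients are the overlaps. Dividing by \<open>s + q j / p k\<close> rather than by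
  \<open>s * p k + q j\<close> exposes the logarithm of \<open>s + q j / p k\<close> as
  antiderivative in \<open>s\<close>.\<close>

definition sylvester_solution ::
  "'i set \<Rightarrow> real \<Rightarrow> ('i \<Rightarrow> 'i \<Rightarrow> complex) \<Rightarrow> ('i \<Rightarrow> real) \<Rightarrow> ('i \<Rightarrow> 'i \<Rightarrow> complex) \<Rightarrow> ('i \<Rightarrow> real) \<Rightarrow> 'i opr" where
  "sylvester_solution I s u p w q = mixed I w u (\<lambda>j k. inner_prod I (w j) (u k) / of_real (s + q j / p k))"

lemma sylvester_sylvester_solution:
  assumes fin: "finite I" and w: "orthonormal_basis I w" and u: "orthonormal_basis I u"
    and p: "\<forall>k\<in>I. p k > 0" and q: "\<forall>k\<in>I. q k > 0" and s: "s \<ge> 0"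
  shows "sylvester I s (spectral_opr I u p) (spectral_opr I w q) (sylvester_solution I s u p w q) = spectral_opr I u p"
  unfolding sylvester_solution_def sylvester_mixed[OF fin w u]
  unfolding spectral_right_mixed[OF fin w u]
proof (rule mixed_cong)
  fix j k assume jk: "j \<in> I" "k \<in> I"
  have "s + q j / p k > 0" using p q s jk by (simp add: add_nonneg_pos)
  moreover have "s * p k + q j = p k * (s + q j / p k)" using bspec[OF p jk(2)] by (simp add: field_simps)
  ultimately show "complex_of_real (s * p k + q j) * (inner_prod I (w j) (u k) / complex_of_real (s + q j / p k)) =
         complex_of_real (p k) * inner_prod I (w j) (u k)"
    by (simp del: of_real_add add: of_real_mult)
qed

text \<open>This is the form that \<open>log_sum_mono\<close> works with: the weights are
  \<open>p k\<close> times squared overlaps, the nodes are \<open>q j / p k\<close>.\<close>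

lemma hs_sylvester_solution:
  assumes fin: "finite I" and w: "orthonormal_basis I w" and u: "orthonormal_basis I u"
  shows "hs_inner I (sylvester_solution I s u p w q) (spectral_opr I u p) =
    of_real (\<Sum>(j,k)\<in>I \<times> I. p k * (cmod (inner_prod I (w j) (u k)))\<^sup>2 / (s + q j / p k))"
proof -
  have sq: "cnj (inner_prod I (w j) (u k) / of_real a) * (of_real b * inner_prod I (w j) (u k)) =
      of_real (b * (cmod (inner_prod I (w j) (u k)))\<^sup>2 / a)" for j k a b
    unfolding of_real_mult of_real_divide complex_norm_square by simp
  show ?thesis
    unfolding sylvester_solution_def spectral_right_mixed[OF fin w u] hs_mixed[OF fin w u] sq
    by (simp add: sum.cartesian_product case_prod_beta)
qed

lemma opr_id_spectral_opr:
  "finite I \<Longrightarrow> orthonormal_basis I u \<Longrightarrow> opr_id I = spectral_opr I u (\<lambda>k. 1)"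
  using opr_power_spectral_opr[of I u l 0] by simp

lemma opr_id_mixed:
  assumes "finite I" "orthonormal_basis I w" "orthonormal_basis I u"
  shows "opr_id I = mixed I w u (\<lambda>j k. inner_prod I (w j) (u k))"
  unfolding opr_id_spectral_opr[OF assms(1,3)] spectral_right_mixed[OF assms] by simp

lemma hs_opr_id: "finite I \<Longrightarrow> hs_inner I (opr_id I) M = opr_trace I M"
  by (simp add: hs_inner_def opr_id_def opr_trace_def if_distrib[of cnj] if_distrib[of "\<lambda>a. a * _"] cong: if_cong)

text \<open>Both logarithms scale the same overlap, one by row and one by column, so their
  difference scales it by the logarithm of an eigenvalue ratio even when the operators do not
  commute.\<close>

lemma log_ratio_mixed:
  assumes fin: "finite I" and w: "orthonormal_basis I w" and u: "orthonormal_basis I u"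
    and p: "\<forall>k\<in>I. p k > 0" and q: "\<forall>k\<in>I. q k > 0"
  shows "(\<lambda>x y. 1 * spectral_opr I w (\<lambda>k. ln (q k)) x y + (-1) * spectral_opr I u (\<lambda>k. ln (p k)) x y) =
    mixed I w u (\<lambda>j k. of_real (ln (q j / p k)) * inner_prod I (w j) (u k))"
  unfolding spectral_right_mixed[OF fin w u] spectral_left_mixed[OF fin w u] mixed_lincomb[symmetric]
proof (rule mixed_cong)
  fix j k assume "j \<in> I" "k \<in> I"
  then have "ln (q j / p k) = ln (q j) - ln (p k)" using bspec[OF p, of k] bspec[OF q, of j] by (simp add: ln_div)
  then show "1 * (of_real (ln (q j)) * inner_prod I (w j) (u k)) + (-1) * (of_real (ln (p k)) * inner_prod I (w j) (u k)) =
      of_real (ln (q j / p k)) * inner_prod I (w j) (u k)"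
    by (simp only:) (simp add: algebra_simps)
qed

text \<open>The negative of the relative entropy, written with the weights and nodes of
  \<open>hs_sylvester_solution\<close>.\<close>

lemma hs_log_ratio:
  assumes fin: "finite I" and w: "orthonormal_basis I w" and u: "orthonormal_basis I u"
    and p: "\<forall>k\<in>I. p k > 0" and q: "\<forall>k\<in>I. q k > 0"
  shows "Re (hs_inner I (spectral_opr I u p) (\<lambda>x y. 1 * spectral_opr I w (\<lambda>k. ln (q k)) x y
        + (-1) * spectral_opr I u (\<lambda>k. ln (p k)) x y)) =
    (\<Sum>z\<in>I \<times> I. (\<lambda>(j,k). p k * (cmod (inner_prod I (w j) (u k)))\<^sup>2) z * ln ((\<lambda>(j,k). q j / p k) z))"
proof -
  have sq: "cnj (of_real (p k) * inner_prod I (w j) (u k)) * (of_real (ln (q j / p k)) * inner_prod I (w j) (u k))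
     = of_real (p k * (cmod (inner_prod I (w j) (u k)))\<^sup>2 * ln (q j / p k))" for j k
    unfolding of_real_mult complex_norm_square by (simp add: mult_ac)
  show ?thesis
    by (subst log_ratio_mixed[OF assms])
      (simp only: spectral_right_mixed[OF fin w u] hs_mixed[OF fin w u] sq, simp add: sum.cartesian_product case_prod_beta)
qed

text \<open>The total weight is a trace, so a trace-preserving map preserves it, as the limit
  argument at infinity requires.\<close>

lemma sum_overlaps:
  assumes fin: "finite I" and w: "orthonormal_basis I w" and u: "orthonormal_basis I u"
  shows "of_real (\<Sum>z\<in>I \<times> I. (\<lambda>(j,k). p k * (cmod (inner_prod I (w j) (u k)))\<^sup>2) z) = opr_trace I (spectral_opr I u p)"
proof -
  have sq: "cnj (inner_prod I (w j) (u k)) * (of_real (p k) * inner_prod I (w j) (u k)) = of_real (p k * (cmod (inner_prod I (w j) (u k)))\<^sup>2)" for j k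
    unfolding of_real_mult complex_norm_square by (simp add: mult_ac)
  show ?thesis
    unfolding hs_opr_id[OF fin, symmetric] opr_id_mixed[OF assms] spectral_right_mixed[OF fin w u]
      hs_mixed[OF fin w u] sq
    by (simp add: sum.cartesian_product case_prod_beta)
qed

section \<open>Abstract conditional expectations and monotonicity\<close>

text \<open>The fixed points of \<open>F\<close> stand in for the subalgebra onto which it projects;
  \<open>F_mult_right\<close> is the module property over that subalgebra.\<close>

locale conditional_expectation =
  fixes I :: "'i set" and F :: "'i opr \<Rightarrow> 'i opr"
  assumes finite_I: "finite I"
    and F_oprs: "F M \<in> oprs I"
    and F_lincomb: "F (\<lambda>x y. a * M x y + b * N x y) = (\<lambda>x y. a * F M x y + b * F N x y)"
    and F_adj: "F (opr_adj M) = opr_adj (F M)"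
    and F_trace: "opr_trace I (F M) = opr_trace I M"
    and F_idem: "F (F M) = F M"
    and F_mult_right: "F N = N \<Longrightarrow> F (opr_mult I M N) = opr_mult I (F M) N"
begin

lemma F_mult_left:
  assumes "F N = N"
  shows "F (opr_mult I N M) = opr_mult I N (F M)"
proof -
  have "F (opr_adj N) = opr_adj N" using assms by (simp add: F_adj)
  from F_mult_right[OF this, of "opr_adj M"] have "F (opr_adj (opr_mult I N M)) = opr_adj (opr_mult I N (F M))"
    by (simp add: adj_mult F_adj)
  then show ?thesis by (metis F_adj adj_adj)
qed

text \<open>By the module property and trace preservation, \<open>F\<close> behaves as an orthogonal
  projection for the Hilbert-Schmidt inner product.\<close>

lemma hs_F:
  assumes "F N = N"
  shows "hs_inner I N (F M) = hs_inner I N M"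
proof -
  have "F (opr_adj N) = opr_adj N" using assms by (simp add: F_adj)
  from F_mult_left[OF this] show ?thesis unfolding hs_trace by (metis F_trace)
qed

lemma F_sylvester:
  assumes "F N = N"
  shows "F (sylvester I s R T N) = sylvester I s (F R) (F T) N"
  unfolding sylvester_def F_lincomb F_mult_left[OF assms] F_mult_right[OF assms] ..

context
  fixes u p w q u1 p1 w1 q1
  assumes u: "orthonormal_basis I u" and w: "orthonormal_basis I w"
    and u1: "orthonormal_basis I u1" and w1: "orthonormal_basis I w1"
    and p: "\<forall>k\<in>I. p k > 0" and q: "\<forall>k\<in>I. q k > 0"
    and p1: "\<forall>k\<in>I. p1 k > 0" and q1: "\<forall>k\<in>I. q1 k > 0"
    and F_p: "F (spectral_opr I u p) = spectral_opr I u1 p1"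
    and F_q: "F (spectral_opr I w q) = spectral_opr I w1 q1"
begin

text \<open>Once \<open>Y\<close> is known to be fixed by \<open>F\<close>, every term in the
  expansion of \<open>\<langle>X - Y, S (X - Y)\<rangle>\<close> except the first is, up to sign,
  \<open>\<langle>Y, F(\<rho>)\<rangle>\<close> or its conjugate. The gap between the two sides is
  thus a positive definite form in \<open>X - Y\<close>.\<close>

lemma sylvester_gap:
  assumes s: "s \<ge> 0"
  defines "X \<equiv> sylvester_solution I s u p w q"
  defines "Y \<equiv> sylvester_solution I s u1 p1 w1 q1"
  shows "Re (hs_inner I Y (spectral_opr I u1 p1)) \<le> Re (hs_inner I X (spectral_opr I u p))"
    and "Re (hs_inner I Y (spectral_opr I u1 p1)) = Re (hs_inner I X (spectral_opr I u p)) \<Longrightarrow> X = Y"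
proof -
  let ?R = "spectral_opr I u p" and ?T = "spectral_opr I w q"
  let ?R1 = "spectral_opr I u1 p1" and ?T1 = "spectral_opr I w1 q1"
  let ?S = "sylvester I s ?R ?T" and ?S1 = "sylvester I s ?R1 ?T1"
  have X_oprs: "X \<in> oprs I" and Y_oprs: "Y \<in> oprs I"
    unfolding X_def Y_def sylvester_solution_def by (rule mixed_oprs)+
  have SX: "?S X = ?R" unfolding X_def by (rule sylvester_sylvester_solution[OF finite_I w u p q s])
  have S1Y: "?S1 Y = ?R1" unfolding Y_def by (rule sylvester_sylvester_solution[OF finite_I w1 u1 p1 q1 s])
  have R1: "F ?R1 = ?R1" and T1: "F ?T1 = ?T1" using F_idem F_p F_q by metis+
  \<comment> \<open>\<open>F Y\<close> solves the same equation as \<open>Y\<close>, because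
    \<open>F\<close> commutes with multiplication by its fixed points; positive definiteness gives
    uniqueness.\<close>
  have FY: "F Y = Y"
  proof -
    define D where "D = (\<lambda>x y. 1 * F Y x y + (-1) * Y x y)"
    have D: "D \<in> oprs I" using F_oprs[of Y] Y_oprs by (auto simp: D_def oprs_def)
    have "?S1 (F Y) = F (?S1 Y)"
      unfolding sylvester_def F_lincomb F_mult_left[OF T1] F_mult_right[OF R1] ..
    then have "?S1 (F Y) = ?R1" by (simp add: S1Y R1)
    then have "?S1 D = (\<lambda>x y. 0)" unfolding D_def sylvester_lincomb S1Y by simp
    then have "Re (hs_inner I D (?S1 D)) = 0" by (simp add: hs_inner_def)
    from sylvester_positive(2)[OF finite_I w1 u1 p1 q1 s D this]
    have "D = (\<lambda>x y. 0)" .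
    then show ?thesis by (simp add: D_def fun_eq_iff)
  qed
  have YR: "hs_inner I Y ?R = hs_inner I Y ?R1" using hs_F[OF FY, of ?R] by (simp add: F_p)
  have YSY: "hs_inner I Y (?S Y) = hs_inner I Y ?R1"
    using hs_F[OF FY, of "?S Y"] by (simp add: F_sylvester[OF FY] F_p F_q S1Y)
  have XSY: "hs_inner I X (?S Y) = cnj (hs_inner I Y ?R1)"
    unfolding sylvester_self_adjoint[OF finite_I w u X_oprs Y_oprs] SX by (simp add: cnj_hs YR[symmetric])
  define D where "D = (\<lambda>x y. 1 * X x y + (-1) * Y x y)"
  have D: "D \<in> oprs I" using X_oprs Y_oprs by (auto simp: D_def oprs_def)
  have "hs_inner I D (?S D) = hs_inner I X ?R - cnj (hs_inner I Y ?R1)"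
    unfolding D_def sylvester_lincomb SX hs_lincomb_left hs_lincomb_right
    by (simp add: YR YSY XSY)
  then have eq: "Re (hs_inner I D (?S D)) = Re (hs_inner I X ?R) - Re (hs_inner I Y ?R1)" by simp
  show "Re (hs_inner I Y ?R1) \<le> Re (hs_inner I X ?R)"
    using sylvester_positive(1)[OF finite_I w u p q s D] eq by simp
  assume "Re (hs_inner I Y ?R1) = Re (hs_inner I X ?R)"
  then have "Re (hs_inner I D (?S D)) = 0" using eq by simp
  from sylvester_positive(2)[OF finite_I w u p q s D this]
  show "X = Y" by (simp add: D_def fun_eq_iff)
qed

text \<open>The scalar lemmas integrate the gap of \<open>sylvester_gap\<close> over
  \<open>s\<close>. In the equality case they return a vanishing gap for each \<open>s > 0\<close>,
  hence equal solutions.\<close>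

theorem relative_entropy_mono:
  defines "L \<equiv> (\<lambda>x y. 1 * spectral_opr I w (\<lambda>k. ln (q k)) x y + (-1) * spectral_opr I u (\<lambda>k. ln (p k)) x y)"
  defines "L1 \<equiv> (\<lambda>x y. 1 * spectral_opr I w1 (\<lambda>k. ln (q1 k)) x y + (-1) * spectral_opr I u1 (\<lambda>k. ln (p1 k)) x y)"
  shows "Re (hs_inner I (spectral_opr I u p) L) \<le> Re (hs_inner I (spectral_opr I u1 p1) L1)"
    and "Re (hs_inner I (spectral_opr I u p) L) = Re (hs_inner I (spectral_opr I u1 p1) L1) \<Longrightarrow> L = L1"
proof -
  define c where "c = (\<lambda>(j,k). p k * (cmod (inner_prod I (w j) (u k)))\<^sup>2)"
  define c1 where "c1 = (\<lambda>(j,k). p1 k * (cmod (inner_prod I (w1 j) (u1 k)))\<^sup>2)"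
  define t where "t = (\<lambda>(j,k). q j / p k)"
  define t1 where "t1 = (\<lambda>(j,k). q1 j / p1 k)"
  have fin: "finite (I \<times> I)" using finite_I by simp
  have tpos: "\<forall>z\<in>I \<times> I. t z > 0" "\<forall>z\<in>I \<times> I. t1 z > 0"
    using p q p1 q1 by (auto simp: t_def t1_def)
  note facts = finite_I w u p q
  note facts1 = finite_I w1 u1 p1 q1
  have sum_c: "of_real (sum c (I \<times> I)) = opr_trace I (spectral_opr I u p)"
    unfolding c_def by (rule sum_overlaps[OF finite_I w u])
  have sum_c1: "of_real (sum c1 (I \<times> I)) = opr_trace I (spectral_opr I u1 p1)"
    unfolding c1_def by (rule sum_overlaps[OF finite_I w1 u1])
  have "complex_of_real (sum c (I \<times> I)) = complex_of_real (sum c1 (I \<times> I))"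
    unfolding sum_c sum_c1 F_p[symmetric] F_trace ..
  then have eq: "sum c (I \<times> I) = sum c1 (I \<times> I)" unfolding of_real_eq_iff .
  let ?X = "\<lambda>s. sylvester_solution I s u p w q" and ?Y = "\<lambda>s. sylvester_solution I s u1 p1 w1 q1"
  have f: "Re (hs_inner I (?X s) (spectral_opr I u p)) = (\<Sum>z\<in>I \<times> I. c z / (s + t z))" for s
    unfolding hs_sylvester_solution[OF finite_I w u] by (simp add: c_def t_def case_prod_beta)
  have f1: "Re (hs_inner I (?Y s) (spectral_opr I u1 p1)) = (\<Sum>z\<in>I \<times> I. c1 z / (s + t1 z))" for s
    unfolding hs_sylvester_solution[OF finite_I w1 u1] by (simp add: c1_def t1_def case_prod_beta)
  have nonneg: "\<forall>s>0. 0 \<le> (\<Sum>z\<in>I \<times> I. c z / (s + t z) - c1 z / (s + t1 z))"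
    using sylvester_gap(1) by (simp add: f f1 sum_subtractf)
  have L: "Re (hs_inner I (spectral_opr I u p) L) = (\<Sum>z\<in>I \<times> I. c z * ln (t z))"
    unfolding L_def c_def t_def using facts by (rule hs_log_ratio)
  have L1: "Re (hs_inner I (spectral_opr I u1 p1) L1) = (\<Sum>z\<in>I \<times> I. c1 z * ln (t1 z))"
    unfolding L1_def c1_def t1_def using facts1 by (rule hs_log_ratio)
  show "Re (hs_inner I (spectral_opr I u p) L) \<le> Re (hs_inner I (spectral_opr I u1 p1) L1)"
    using log_sum_mono(1)[OF fin tpos eq nonneg] unfolding L L1 by (simp add: sum_subtractf)
  assume "Re (hs_inner I (spectral_opr I u p) L) = Re (hs_inner I (spectral_opr I u1 p1) L1)"
  then have "(\<Sum>z\<in>I \<times> I. c z * ln (t z) - c1 z * ln (t1 z)) = 0" unfolding L L1 by (simp add: sum_subtractf)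
  from log_sum_mono(2)[OF fin tpos eq nonneg this]
  have "(\<Sum>z\<in>I \<times> I. c z / (s + t z) - c1 z / (s + t1 z)) = 0" if "s > 0" for s
    using that by blast
  then have XY: "?X s = ?Y s" if "s > 0" for s
    using sylvester_gap(2)[of s] that by (simp add: f f1 sum_subtractf)
  show "L = L1"
  proof (intro ext)
    fix x y
    show "L x y = L1 x y"
    proof (cases "x \<in> I \<and> y \<in> I")
      case True
      \<comment> \<open>For the entry at \<open>x\<close> and \<open>y\<close> the weights become
        complex; both families sum to the same entry of the identity, as \<open>log_sum_eq\<close>
        demands.\<close>
      define b where "b = (\<lambda>(j,k). inner_prod I (w j) (u k) * w j x * cnj (u k y))"
      define b1 where "b1 = (\<lambda>(j,k). inner_prod I (w1 j) (u1 k) * w1 j x * cnj (u1 k y))"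
      have id: "sum b (I \<times> I) = opr_id I x y"
        using True unfolding opr_id_mixed[OF finite_I w u] b_def
        by (simp add: mixed_def sum.cartesian_product)
      have id1: "sum b1 (I \<times> I) = opr_id I x y"
        using True unfolding opr_id_mixed[OF finite_I w1 u1] b1_def
        by (simp add: mixed_def sum.cartesian_product)
      have "(\<Sum>z\<in>I \<times> I. b z * of_real (ln (t z))) = (\<Sum>z\<in>I \<times> I. b1 z * of_real (ln (t1 z)))"
      proof (rule log_sum_eq[OF fin tpos])
        fix s :: real assume "s > 0"
        from XY[OF this] have "?X s x y = ?Y s x y" by simp
        then show "(\<Sum>z\<in>I \<times> I. b z / of_real (s + t z)) = (\<Sum>z\<in>I \<times> I. b1 z / of_real (s + t1 z))"
          using True unfolding sylvester_solution_def mixed_def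
          by (simp add: sum.cartesian_product b_def b1_def t_def t1_def case_prod_beta)
      qed (simp add: id id1)
      moreover have "L x y = (\<Sum>z\<in>I \<times> I. b z * of_real (ln (t z)))"
        using True log_ratio_mixed[OF facts, folded L_def]
        by (simp add: mixed_def sum.cartesian_product b_def t_def case_prod_beta mult_ac)
      moreover have "L1 x y = (\<Sum>z\<in>I \<times> I. b1 z * of_real (ln (t1 z)))"
        using True log_ratio_mixed[OF facts1, folded L1_def]
        by (simp add: mixed_def sum.cartesian_product b1_def t1_def case_prod_beta mult_ac)
      ultimately show ?thesis by simp
    qed (auto simp: L_def L1_def spectral_opr_def)
  qed
qed

end
end

section \<open>Conditional expectations on composite systems\<close>

lemma conf_iff: "x \<in> conf d A \<longleftrightarrow> (\<forall>v\<in>A. x v < d v) \<and> (\<forall>v. v \<notin> A \<longrightarrow> x v = undefined)"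
  by (auto simp: conf_def PiE_iff extensional_def)

lemma finite_conf: "finite A \<Longrightarrow> finite (conf d A)"
  by (simp add: conf_def finite_PiE)

lemma card_conf: "finite A \<Longrightarrow> card (conf d A) = prod d A"
  by (simp add: conf_def card_PiE)

lemma override_on_conf: "z \<in> conf d V \<Longrightarrow> x \<in> conf d V \<Longrightarrow> override_on z x A \<in> conf d V"
  by (auto simp: conf_iff override_on_def)

lemma override_on_conf_split:
  "A \<subseteq> V \<Longrightarrow> c \<in> conf d (V - A) \<Longrightarrow> a \<in> conf d A \<Longrightarrow> override_on c a A \<in> conf d V"
  by (auto simp: conf_iff override_on_def)

lemma restrict_conf: "x \<in> conf d V \<Longrightarrow> A \<subseteq> V \<Longrightarrow> restrict x A \<in> conf d A"
  by (auto simp: conf_iff)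

lemma restrict_override_on: "a \<in> conf d A \<Longrightarrow> restrict (override_on c a A) A = a"
  by (auto simp: conf_iff override_on_def fun_eq_iff)

lemma restrict_override_on_diff: "c \<in> conf d (V - A) \<Longrightarrow> restrict (override_on c a A) (V - A) = c"
  by (auto simp: conf_iff override_on_def fun_eq_iff)

lemma override_on_restrict:
  assumes "z \<in> conf d V"
  shows "override_on (restrict z (V - A)) (restrict z A) A = z"
proof
  fix v
  show "override_on (restrict z (V - A)) (restrict z A) A v = z v"
    using assms by (cases "v \<in> A") (auto simp: conf_iff)
qed

lemma override_on_override_on: "override_on w (override_on z x A) B = override_on (override_on w z B) x (A \<inter> B)"
  by (auto simp: override_on_def fun_eq_iff)

lemma override_on_collapse: "override_on w (override_on z x A) A = override_on w x A"
  by (auto simp: override_on_def fun_eq_iff)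

text \<open>The pair \<open>(z, w)\<close> is reindexed by exchanging the coordinates of \<open>z\<close> and \<open>w\<close> in \<open>V - B\<close>.\<close>

lemma sum_conf_swap:
  "(\<Sum>z\<in>conf d V. \<Sum>w\<in>conf d V. g (override_on w z B)) = of_nat (card (conf d V)) * (\<Sum>z\<in>conf d V. g z :: complex)"
proof -
  have "(\<Sum>z\<in>conf d V. \<Sum>w\<in>conf d V. g (override_on w z B)) = (\<Sum>(z,w)\<in>conf d V \<times> conf d V. g (override_on w z B))"
    by (rule sum.cartesian_product)
  also have "\<dots> = (\<Sum>(z,w)\<in>conf d V \<times> conf d V. g z)"
    by (rule sum.reindex_bij_witness[where i = "\<lambda>(z,w). (override_on w z B, override_on z w B)"
          and j = "\<lambda>(z,w). (override_on w z B, override_on z w B)"])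
      (auto simp: override_on_conf, auto simp: override_on_def fun_eq_iff)
  also have "\<dots> = (\<Sum>z\<in>conf d V. \<Sum>w\<in>conf d V. g z)"
    by (rule sum.cartesian_product[symmetric])
  finally show ?thesis by (simp add: sum_distrib_left)
qed

lemma sum_conf_split:
  assumes "A \<subseteq> V"
  shows "(\<Sum>z\<in>conf d V. g z) = (\<Sum>c\<in>conf d (V - A). \<Sum>a\<in>conf d A. g (override_on c a A))"
proof -
  have "(\<Sum>z\<in>conf d V. g z) = (\<Sum>(c,a)\<in>conf d (V - A) \<times> conf d A. g (override_on c a A))"
    using assms
    by (intro sum.reindex_bij_witness[where i = "\<lambda>(c,a). override_on c a A"
          and j = "\<lambda>z. (restrict z (V - A), restrict z A)"])
      (auto simp: override_on_restrict restrict_conf override_on_conf_split restrict_override_on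
        restrict_override_on_diff)
  then show ?thesis by (simp add: sum.cartesian_product)
qed

section \<open>Conditional expectation onto a factor\<close>

text \<open>An operator of the form \<open>M \<otimes> 1\<close>, with the identity on
  \<open>V - A\<close>, has nonzero entries only at pairs of configurations related in this
  way.\<close>

definition agree :: "'v set \<Rightarrow> 'v set \<Rightarrow> ('v \<Rightarrow> nat) \<Rightarrow> ('v \<Rightarrow> nat) \<Rightarrow> bool" where
  "agree V A x y \<longleftrightarrow> (\<forall>v\<in>V - A. x v = y v)"

lemma agree_override_on: "agree V B (override_on z x A) (override_on z y A) \<longleftrightarrow> (\<forall>v\<in>V \<inter> A - B. x v = y v)"
  by (auto simp: agree_def override_on_def)

lemma override_on_agree:
  assumes "agree V A w z" "w \<in> conf d V" "z \<in> conf d V"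
  shows "override_on z w A = w"
proof
  fix v
  show "override_on z w A v = w v"
    using assms by (cases "v \<in> V") (auto simp: agree_def conf_iff override_on_def)
qed

lemma agree_split_iff:
  assumes "c \<in> conf d (V - A)" "x \<in> conf d V" "A \<subseteq> V"
  shows "agree V A (override_on c a A) x \<longleftrightarrow> c = restrict x (V - A)"
    and "agree V A x (override_on c a A) \<longleftrightarrow> c = restrict x (V - A)"
  using assms by (auto simp: agree_def conf_iff override_on_def fun_eq_iff)

text \<open>The trace-preserving conditional expectation onto the operators on the factor \<open>A\<close>. Summing over all of
  \<open>conf d V\<close> counts each configuration of \<open>V - A\<close> equally often, which makes the normalization the same for every \<open>A\<close>.\<close>

definition cond_expect ::
  "('v \<Rightarrow> nat) \<Rightarrow> 'v set \<Rightarrow> 'v set \<Rightarrow> ('v \<Rightarrow> nat) opr \<Rightarrow> ('v \<Rightarrow> nat) opr" where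
  "cond_expect d V A M = (\<lambda>x y. if x \<in> conf d V \<and> y \<in> conf d V \<and> agree V A x y
     then (\<Sum>z\<in>conf d V. M (override_on z x A) (override_on z y A)) / of_nat (card (conf d V)) else 0)"

text \<open>The commuting square behind strong subadditivity. Merging the replacements leaves a
  summand that depends on the two summation variables only through \<open>override_on w z B\<close>,
  so \<open>sum_conf_swap\<close> absorbs one of the two averages.\<close>

lemma cond_expect_compose:
  assumes "finite V"
  shows "cond_expect d V A (cond_expect d V B M) = cond_expect d V (A \<inter> B) M"
proof (intro ext)
  fix x y
  let ?n = "of_nat (card (conf d V)) :: complex"
  show "cond_expect d V A (cond_expect d V B M) x y = cond_expect d V (A \<inter> B) M x y"
  proof (cases "x \<in> conf d V \<and> y \<in> conf d V \<and> agree V A x y")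
    case True
    have iff: "agree V B (override_on z x A) (override_on z y A) \<longleftrightarrow> agree V (A \<inter> B) x y" for z
      using True unfolding agree_override_on by (auto simp: agree_def)
    have n: "?n \<noteq> 0" using True finite_conf[OF assms, of d] by auto
    show ?thesis
    proof (cases "agree V (A \<inter> B) x y")
      case agr: True
      have "cond_expect d V A (cond_expect d V B M) x y =
        (\<Sum>z\<in>conf d V. (\<Sum>w\<in>conf d V. M (override_on (override_on w z B) x (A \<inter> B))
            (override_on (override_on w z B) y (A \<inter> B))) / ?n) / ?n"
        using True agr by (simp add: cond_expect_def override_on_conf iff override_on_override_on)
      also have "\<dots> = (?n * (\<Sum>z\<in>conf d V. M (override_on z x (A \<inter> B)) (override_on z y (A \<inter> B)))) / ?n / ?n"
        unfolding sum_divide_distrib[symmetric]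
        by (subst sum_conf_swap[where g = "\<lambda>z. M (override_on z x (A \<inter> B)) (override_on z y (A \<inter> B))"]) simp
      also have "\<dots> = cond_expect d V (A \<inter> B) M x y" using n True agr by (simp add: cond_expect_def)
      finally show ?thesis .
    next
      case False
      then show ?thesis using True by (simp add: cond_expect_def override_on_conf iff)
    qed
  next
    case False
    then show ?thesis by (auto simp: cond_expect_def agree_def)
  qed
qed

lemma cond_expect_trace:
  assumes "finite V"
  shows "opr_trace (conf d V) (cond_expect d V A M) = opr_trace (conf d V) M"
proof (cases "conf d V = {}")
  case False
  then have n: "of_nat (card (conf d V)) \<noteq> (0::complex)" using finite_conf[OF assms, of d] by auto
  have "opr_trace (conf d V) (cond_expect d V A M) =
      (\<Sum>x\<in>conf d V. \<Sum>z\<in>conf d V. M (override_on z x A) (override_on z x A)) / of_nat (card (conf d V))"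
    by (simp add: opr_trace_def cond_expect_def agree_def sum_divide_distrib)
  also have "\<dots> = opr_trace (conf d V) M"
    by (subst sum_conf_swap[where g = "\<lambda>z. M z z"]) (use n in \<open>simp add: opr_trace_def\<close>)
  finally show ?thesis .
qed (simp add: opr_trace_def)

text \<open>A fixed point vanishes off pairs agreeing outside \<open>A\<close> and does not change
  when their common coordinates there are replaced, so \<open>N\<close> can be pulled out of the
  average.\<close>

lemma cond_expect_mult_right:
  assumes fin: "finite V" and N: "cond_expect d V A N = N"
  shows "cond_expect d V A (opr_mult (conf d V) M N) = opr_mult (conf d V) (cond_expect d V A M) N"
proof (intro ext)
  fix x y
  let ?I = "conf d V" and ?n = "of_nat (card (conf d V)) :: complex"
  have N0: "N w y = 0" if "\<not> (w \<in> ?I \<and> y \<in> ?I \<and> agree V A w y)" for w y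
  proof -
    have "cond_expect d V A N w y = 0" unfolding cond_expect_def using that by (rule if_not_P)
    then show ?thesis using N by simp
  qed
  have N1: "N (override_on z w A) (override_on z y A) = N w y"
    if "w \<in> ?I" "y \<in> ?I" "z \<in> ?I" "agree V A w y" for w y z
  proof -
    have "agree V A (override_on z w A) (override_on z y A)" by (simp add: agree_def)
    then have "cond_expect d V A N (override_on z w A) (override_on z y A) = cond_expect d V A N w y"
      using that by (simp add: cond_expect_def override_on_conf override_on_collapse)
    then show ?thesis using N by simp
  qed
  show "cond_expect d V A (opr_mult ?I M N) x y = opr_mult ?I (cond_expect d V A M) N x y"
  proof (cases "x \<in> ?I \<and> y \<in> ?I \<and> agree V A x y")
    case True
    have inner: "(\<Sum>w\<in>?I. M (override_on z x A) w * N w (override_on z y A)) =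
        (\<Sum>w\<in>{w \<in> ?I. agree V A w y}. M (override_on z x A) (override_on z w A) * N w y)"
      if z: "z \<in> ?I" for z
    proof -
      have "(\<Sum>w\<in>?I. M (override_on z x A) w * N w (override_on z y A)) =
          (\<Sum>w\<in>{w \<in> ?I. agree V A w z}. M (override_on z x A) w * N w (override_on z y A))"
      proof (rule sum.mono_neutral_right)
        show "\<forall>w\<in>?I - {w \<in> ?I. agree V A w z}. M (override_on z x A) w * N w (override_on z y A) = 0"
          using N0 by (auto simp: agree_def)
      qed (auto simp: finite_conf fin)
      \<comment> \<open>Intermediate configurations agreeing with \<open>z\<close> outside
        \<open>A\<close> are traded for those agreeing with \<open>y\<close> there, which makes the
        range of \<open>w\<close> independent of \<open>z\<close>.\<close>
      also have "\<dots> = (\<Sum>w\<in>{w \<in> ?I. agree V A w y}. M (override_on z x A) (override_on z w A) * N (override_on z w A) (override_on z y A))"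
      proof (rule sum.reindex_bij_witness[where i = "\<lambda>w. override_on z w A" and j = "\<lambda>w. override_on y w A"])
        fix w assume w: "w \<in> {w \<in> ?I. agree V A w z}"
        then show "override_on z (override_on y w A) A = w"
          unfolding override_on_collapse using z
          by (auto intro: override_on_agree)
        then show "M (override_on z x A) (override_on z (override_on y w A) A) *
            N (override_on z (override_on y w A) A) (override_on z y A) =
            M (override_on z x A) w * N w (override_on z y A)" by simp
        show "override_on y w A \<in> {w \<in> ?I. agree V A w y}" using w True by (auto simp: override_on_conf agree_def)
      next
        fix w assume w: "w \<in> {w \<in> ?I. agree V A w y}"
        then show "override_on y (override_on z w A) A = w"
          unfolding override_on_collapse using True
          by (auto intro: override_on_agree)
        show "override_on z w A \<in> {w \<in> ?I. agree V A w z}" using w z by (auto simp: override_on_conf agree_def)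
      qed
      also have "\<dots> = (\<Sum>w\<in>{w \<in> ?I. agree V A w y}. M (override_on z x A) (override_on z w A) * N w y)"
        using N1 z True by (intro sum.cong refl) auto
      finally show ?thesis .
    qed
    have "cond_expect d V A (opr_mult ?I M N) x y =
       (\<Sum>z\<in>?I. \<Sum>w\<in>{w \<in> ?I. agree V A w y}. M (override_on z x A) (override_on z w A) * N w y) / ?n"
      using True inner by (simp add: cond_expect_def opr_mult_def)
    also have "\<dots> = (\<Sum>w\<in>{w \<in> ?I. agree V A w y}. ((\<Sum>z\<in>?I. M (override_on z x A) (override_on z w A)) / ?n) * N w y)"
      by (subst sum.swap) (simp add: sum_divide_distrib sum_distrib_right)
    also have "\<dots> = (\<Sum>w\<in>{w \<in> ?I. agree V A w y}. cond_expect d V A M x w * N w y)"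
      using True by (intro sum.cong refl) (auto simp: cond_expect_def agree_def)
    also have "\<dots> = (\<Sum>w\<in>?I. cond_expect d V A M x w * N w y)"
      using N0 by (intro sum.mono_neutral_left) (auto simp: finite_conf fin)
    finally show ?thesis by (simp add: opr_mult_def)
  next
    case False
    have "cond_expect d V A M x w * N w y = 0" if "w \<in> ?I" for w
    proof (cases "agree V A w y \<and> y \<in> ?I")
      case True
      with False have "\<not> (x \<in> ?I \<and> w \<in> ?I \<and> agree V A x w)" by (auto simp: agree_def)
      then have "cond_expect d V A M x w = 0" unfolding cond_expect_def by (rule if_not_P)
      then show ?thesis by simp
    qed (use N0 in auto)
    then have "opr_mult ?I (cond_expect d V A M) N x y = 0"
      unfolding opr_mult_def by (intro sum.neutral ballI)
    moreover have "cond_expect d V A (opr_mult ?I M N) x y = 0"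
      unfolding cond_expect_def using False by (rule if_not_P)
    ultimately show ?thesis by simp
  qed
qed

lemma conditional_expectation_cond_expect:
  assumes "finite V"
  shows "conditional_expectation (conf d V) (cond_expect d V A)"
proof
  show "finite (conf d V)" by (rule finite_conf[OF assms])
  show "cond_expect d V A M \<in> oprs (conf d V)" for M by (simp add: cond_expect_def oprs_def)
  show "cond_expect d V A (\<lambda>x y. a * M x y + b * N x y) =
      (\<lambda>x y. a * cond_expect d V A M x y + b * cond_expect d V A N x y)" for a b M N
    by (auto simp: cond_expect_def fun_eq_iff sum.distrib sum_distrib_left add_divide_distrib)
  have sym: "agree V A x y \<longleftrightarrow> agree V A y x" for x y by (auto simp: agree_def)
  show "cond_expect d V A (opr_adj M) = opr_adj (cond_expect d V A M)" for M
    by (auto simp: cond_expect_def opr_adj_def fun_eq_iff sym)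
  show "opr_trace (conf d V) (cond_expect d V A M) = opr_trace (conf d V) M" for M
    by (rule cond_expect_trace[OF assms])
  show "cond_expect d V A (cond_expect d V A M) = cond_expect d V A M" for M
    by (simp add: cond_expect_compose[OF assms])
  show "cond_expect d V A (opr_mult (conf d V) M N) = opr_mult (conf d V) (cond_expect d V A M) N"
    if "cond_expect d V A N = N" for M N
    by (rule cond_expect_mult_right[OF assms that])
qed

lemma embed_agree:
  "embed d V A M = (\<lambda>x y. if x \<in> conf d V \<and> y \<in> conf d V \<and> agree V A x y then M (restrict x A) (restrict y A) else 0)"
  by (simp add: embed_def agree_def)

lemma cond_expect_embed:
  assumes "finite V" "B \<subseteq> A" "A \<subseteq> V"
  shows "cond_expect d V A (embed d V B M) = embed d V B M"
proof (intro ext)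
  fix x y
  show "cond_expect d V A (embed d V B M) x y = embed d V B M x y"
  proof (cases "x \<in> conf d V \<and> y \<in> conf d V \<and> agree V A x y")
    case True
    then have n: "of_nat (card (conf d V)) \<noteq> (0::complex)" using finite_conf[OF assms(1), of d] by auto
    have "restrict (override_on z x A) B = restrict x B" for z x :: "'a \<Rightarrow> nat"
      using assms by (auto simp: fun_eq_iff override_on_def)
    moreover have "agree V B (override_on z x A) (override_on z y A) \<longleftrightarrow> agree V B x y" for z
      using True assms unfolding agree_override_on by (auto simp: agree_def)
    ultimately show ?thesis using True n by (simp add: cond_expect_def embed_agree override_on_conf)
  next
    case False
    then have "\<not> (x \<in> conf d V \<and> y \<in> conf d V \<and> agree V B x y)" using assms by (auto simp: agree_def)
    then show ?thesis using False by (auto simp: cond_expect_def embed_agree)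
  qed
qed

text \<open>The summand does not see \<open>z\<close> on \<open>A\<close>, so each configuration of
  \<open>V - A\<close> is counted \<open>card (conf d A)\<close> times; hence the factor.\<close>

lemma cond_expect_eq_embed:
  assumes "A \<subseteq> V"
  shows "cond_expect d V A M x y =
    of_real (real (card (conf d A)) / real (card (conf d V))) * embed d V A (marginal d V M A) x y"
proof (cases "x \<in> conf d V \<and> y \<in> conf d V \<and> agree V A x y")
  case True
  have r: "override_on c (restrict x A) A = override_on c x A" for c x :: "'a \<Rightarrow> nat"
    by (auto simp: override_on_def fun_eq_iff)
  have "(\<Sum>z\<in>conf d V. M (override_on z x A) (override_on z y A)) =
      of_nat (card (conf d A)) * (\<Sum>c\<in>conf d (V - A). M (override_on c x A) (override_on c y A))"
  proof -
    have "override_on (override_on c a A) x A = override_on c x A" for c a x :: "'a \<Rightarrow> nat"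
      by (auto simp: override_on_def fun_eq_iff)
    then show ?thesis by (simp add: sum_conf_split[OF assms] sum_distrib_left)
  qed
  moreover have "restrict x A \<in> conf d A" "restrict y A \<in> conf d A"
    using True assms by (auto intro: restrict_conf)
  ultimately show ?thesis using True by (simp add: cond_expect_def embed_agree marginal_def r)
qed (auto simp: cond_expect_def embed_agree)

section \<open>Embedded eigenbases and partial traces\<close>

text \<open>The tensor product of the basis \<open>u\<close> on \<open>A\<close> with the standard
  basis on \<open>V - A\<close>; the restrictions of \<open>k\<close> to the two factors label the
  two tensor components.\<close>

definition embed_vec :: "'v set \<Rightarrow> 'v set \<Rightarrow> (('v \<Rightarrow> nat) \<Rightarrow> ('v \<Rightarrow> nat) \<Rightarrow> complex) \<Rightarrow> ('v \<Rightarrow> nat) \<Rightarrow> ('v \<Rightarrow> nat) \<Rightarrow> complex" where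
  "embed_vec V A u k x = (if agree V A x k then u (restrict k A) (restrict x A) else 0)"

lemma orthonormal_basis_embed_vec:
  assumes fin: "finite V" and A: "A \<subseteq> V" and u: "orthonormal_basis (conf d A) u"
  shows "orthonormal_basis (conf d V) (embed_vec V A u)"
  unfolding orthonormal_basis_def
proof (intro ballI)
  fix j k assume j: "j \<in> conf d V" and k: "k \<in> conf d V"
  have finA: "finite (conf d (V - A))" using fin by (simp add: finite_conf)
  have "(\<Sum>x\<in>conf d V. cnj (embed_vec V A u j x) * embed_vec V A u k x) =
    (\<Sum>c\<in>conf d (V - A). \<Sum>a\<in>conf d A. if c = restrict j (V - A) then
       (if restrict j (V - A) = restrict k (V - A) then cnj (u (restrict j A) a) * u (restrict k A) a else 0) else 0)"
    unfolding sum_conf_split[OF A]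
    using A j k by (intro sum.cong refl) (auto simp: embed_vec_def agree_split_iff restrict_override_on)
  also have "\<dots> = (if restrict j (V - A) = restrict k (V - A) then
      \<Sum>a\<in>conf d A. cnj (u (restrict j A) a) * u (restrict k A) a else 0)"
    using j finA restrict_conf[OF j, of "V - A"] by (subst sum.swap) (auto intro!: sum.cong simp: restrict_conf)
  also have "(\<Sum>a\<in>conf d A. cnj (u (restrict j A) a) * u (restrict k A) a) = (if restrict j A = restrict k A then 1 else 0)"
    using u restrict_conf[OF j A] restrict_conf[OF k A] unfolding orthonormal_basis_def by blast
  also have "(if restrict j (V - A) = restrict k (V - A) then if restrict j A = restrict k A then 1 else 0 else 0)
      = (if j = k then 1 else (0::complex))"
  proof -
    have "j = k" if "restrict j (V - A) = restrict k (V - A)" "restrict j A = restrict k A"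
    proof
      fix v
      show "j v = k v"
        using fun_cong[OF that(1), of v] fun_cong[OF that(2), of v] j k
        by (cases "v \<in> A"; cases "v \<in> V") (auto simp: conf_iff)
    qed
    then show ?thesis by auto
  qed
  finally show "(\<Sum>x\<in>conf d V. cnj (embed_vec V A u j x) * embed_vec V A u k x) = (if j = k then 1 else 0)" .
qed

lemma embed_spectral_opr:
  assumes fin: "finite V" and A: "A \<subseteq> V"
  shows "embed d V A (spectral_opr (conf d A) u l) =
    spectral_opr (conf d V) (embed_vec V A u) (\<lambda>k. l (restrict k A))"
proof (intro ext)
  fix x y
  have finA: "finite (conf d (V - A))" using fin by (simp add: finite_conf)
  show "embed d V A (spectral_opr (conf d A) u l) x y =
    spectral_opr (conf d V) (embed_vec V A u) (\<lambda>k. l (restrict k A)) x y"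
  proof (cases "x \<in> conf d V \<and> y \<in> conf d V")
    case True
    then have x: "x \<in> conf d V" and y: "y \<in> conf d V" by auto
    have "spectral_opr (conf d V) (embed_vec V A u) (\<lambda>k. l (restrict k A)) x y =
      (\<Sum>c\<in>conf d (V - A). \<Sum>a\<in>conf d A. if c = restrict x (V - A) then
        (if restrict x (V - A) = restrict y (V - A) then
          of_real (l a) * u a (restrict x A) * cnj (u a (restrict y A)) else 0) else 0)"
      unfolding spectral_opr_def sum_conf_split[OF A]
      using A x y by (simp, intro sum.cong refl) (auto simp: embed_vec_def agree_split_iff restrict_override_on)
    also have "\<dots> = (if restrict x (V - A) = restrict y (V - A) then
      \<Sum>a\<in>conf d A. of_real (l a) * u a (restrict x A) * cnj (u a (restrict y A)) else 0)"
      using x finA restrict_conf[OF x, of "V - A"] by (subst sum.swap) (auto intro!: sum.cong simp: restrict_conf)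
    also have "restrict x (V - A) = restrict y (V - A) \<longleftrightarrow> agree V A x y"
      by (auto simp: agree_def fun_eq_iff)
    also have "(if agree V A x y then
      \<Sum>a\<in>conf d A. of_real (l a) * u a (restrict x A) * cnj (u a (restrict y A)) else 0) =
      embed d V A (spectral_opr (conf d A) u l) x y"
      using x y restrict_conf[OF x A] restrict_conf[OF y A] by (simp add: embed_agree spectral_opr_def)
    finally show ?thesis by (rule sym)
  qed (auto simp: embed_agree spectral_opr_def)
qed

text \<open>The partial trace is the adjoint of the embedding.\<close>

lemma hs_embed:
  assumes fin: "finite V" and A: "A \<subseteq> V"
  shows "hs_inner (conf d V) N (embed d V A M) = hs_inner (conf d A) (marginal d V N A) M"
proof -
  have finA: "finite (conf d (V - A))" using fin by (simp add: finite_conf)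
  have "hs_inner (conf d V) N (embed d V A M) =
    (\<Sum>c\<in>conf d (V - A). \<Sum>a\<in>conf d A. \<Sum>c'\<in>conf d (V - A). \<Sum>b\<in>conf d A. if c' = c then
      cnj (N (override_on c a A) (override_on c b A)) * M a b else 0)"
  proof -
    have "agree V A (override_on c a A) (override_on c' b A) \<longleftrightarrow> c' = c"
      if "c \<in> conf d (V - A)" "c' \<in> conf d (V - A)" for c c' a b
    proof -
      have "c' = c" if "\<forall>v\<in>V - A. c v = c' v"
      proof
        fix v
        show "c' v = c v"
          using that \<open>c \<in> conf d (V - A)\<close> \<open>c' \<in> conf d (V - A)\<close>
          by (cases "v \<in> V - A") (auto simp: conf_iff)
      qed
      then show ?thesis by (auto simp: agree_def override_on_def)
    qed
    then show ?thesis
      unfolding hs_inner_def sum_conf_split[OF A]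
      using A by (intro sum.cong refl) (auto simp: embed_agree restrict_override_on override_on_conf_split)
  qed
  also have "\<dots> = (\<Sum>c\<in>conf d (V - A). \<Sum>a\<in>conf d A. \<Sum>b\<in>conf d A.
      cnj (N (override_on c a A) (override_on c b A)) * M a b)"
  proof (rule sum.cong[OF refl], rule sum.cong[OF refl])
    fix c a assume "c \<in> conf d (V - A)"
    then show "(\<Sum>c'\<in>conf d (V - A). \<Sum>b\<in>conf d A. if c' = c then
        cnj (N (override_on c a A) (override_on c b A)) * M a b else 0) =
      (\<Sum>b\<in>conf d A. cnj (N (override_on c a A) (override_on c b A)) * M a b)"
      using finA by (subst sum.swap) simp
  qed
  also have "\<dots> = (\<Sum>a\<in>conf d A. \<Sum>b\<in>conf d A. \<Sum>c\<in>conf d (V - A).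
      cnj (N (override_on c a A) (override_on c b A)) * M a b)"
    by (rule sum_rotate)
  also have "\<dots> = hs_inner (conf d A) (marginal d V N A) M"
    unfolding hs_inner_def marginal_def by (simp add: sum_distrib_right)
  finally show ?thesis .
qed

section \<open>Strong subadditivity\<close>

locale quantum_state =
  fixes d :: "'v \<Rightarrow> nat" and V :: "'v set" and \<sigma> :: "('v \<Rightarrow> nat) opr"
  assumes finite_V: "finite V" and state: "\<sigma> \<in> states d V"
begin

lemma conf_nonempty: "conf d V \<noteq> {}"
  using state by (auto simp: states_def opr_trace_def)

lemma d_pos: "v \<in> V \<Longrightarrow> d v > 0"
  using conf_nonempty by (force simp: conf_iff)

lemma card_conf_pos: "A \<subseteq> V \<Longrightarrow> card (conf d A) > 0"
  using d_pos finite_V by (auto simp: card_conf finite_subset intro!: prod_pos)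

text \<open>The quadratic form of the marginal at \<open>f\<close> is the sum, over the standard
  basis of the traced-out factor, of the form of \<open>\<sigma>\<close> at \<open>f\<close>
  tensored with the basis vector; \<open>g c\<close> is that tensor product.\<close>

lemma positive_definite_marginal:
  assumes A: "A \<subseteq> V"
  shows "positive_definite (conf d A) (marginal d V \<sigma> A)"
proof -
  have pd: "positive_definite (conf d V) \<sigma>" using state by (simp add: states_def)
  have sa: "\<sigma> y x = cnj (\<sigma> x y)" if "x \<in> conf d V" "y \<in> conf d V" for x y
    using pd that unfolding positive_definite_def self_adjoint_def by blast
  have "self_adjoint (conf d A) (marginal d V \<sigma> A)"
    unfolding self_adjoint_def
  proof (intro ballI)
    fix x y assume xy: "x \<in> conf d A" "y \<in> conf d A"
    have "(\<Sum>z\<in>conf d (V - A). \<sigma> (override_on z y A) (override_on z x A)) =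
       (\<Sum>z\<in>conf d (V - A). cnj (\<sigma> (override_on z x A) (override_on z y A)))"
      using xy A by (intro sum.cong refl sa) (auto intro: override_on_conf_split)
    then show "marginal d V \<sigma> A y x = cnj (marginal d V \<sigma> A x y)"
      using xy by (simp add: marginal_def)
  qed
  moreover have "0 < Re (\<Sum>x\<in>conf d A. \<Sum>y\<in>conf d A. cnj (f x) * marginal d V \<sigma> A x y * f y)"
    if f: "\<exists>x\<in>conf d A. f x \<noteq> 0" for f
  proof -
    define g where "g c x = (if restrict x (V - A) = c then f (restrict x A) else 0)" for c x
    have g: "g c (override_on c' a A) = (if c' = c then f a else 0)"
      if "c' \<in> conf d (V - A)" "a \<in> conf d A" for c c' a
      using that by (simp add: g_def restrict_override_on restrict_override_on_diff)
    have fin: "finite (conf d (V - A))" using finite_V by (simp add: finite_conf)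
    have eq: "(\<Sum>x\<in>conf d V. \<Sum>y\<in>conf d V. cnj (g c x) * \<sigma> x y * g c y) =
        (\<Sum>a\<in>conf d A. \<Sum>b\<in>conf d A. cnj (f a) * \<sigma> (override_on c a A) (override_on c b A) * f b)"
      if c: "c \<in> conf d (V - A)" for c
    proof -
      have inner: "(\<Sum>y\<in>conf d V. \<sigma> x y * g c y) = (\<Sum>b\<in>conf d A. \<sigma> x (override_on c b A) * f b)" for x
      proof -
        have "(\<Sum>y\<in>conf d V. \<sigma> x y * g c y) = (\<Sum>c'\<in>conf d (V - A). \<Sum>b\<in>conf d A.
            if c' = c then \<sigma> x (override_on c b A) * f b else 0)"
          unfolding sum_conf_split[OF A] by (intro sum.cong refl) (auto simp: g)
        also have "\<dots> = (\<Sum>b\<in>conf d A. \<sigma> x (override_on c b A) * f b)"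
          using fin c by (subst sum.swap) simp
        finally show ?thesis .
      qed
      have "(\<Sum>x\<in>conf d V. \<Sum>y\<in>conf d V. cnj (g c x) * \<sigma> x y * g c y) =
          (\<Sum>x\<in>conf d V. cnj (g c x) * (\<Sum>b\<in>conf d A. \<sigma> x (override_on c b A) * f b))"
        unfolding inner[symmetric] by (simp add: sum_distrib_left mult.assoc)
      also have "\<dots> = (\<Sum>c'\<in>conf d (V - A). \<Sum>a\<in>conf d A. if c' = c then
          cnj (f a) * (\<Sum>b\<in>conf d A. \<sigma> (override_on c a A) (override_on c b A) * f b) else 0)"
        unfolding sum_conf_split[OF A] by (intro sum.cong refl) (auto simp: g)
      also have "\<dots> = (\<Sum>a\<in>conf d A. cnj (f a) * (\<Sum>b\<in>conf d A. \<sigma> (override_on c a A) (override_on c b A) * f b))"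
        using fin c by (subst sum.swap) simp
      finally show ?thesis by (simp add: sum_distrib_left mult.assoc)
    qed
    have pos: "0 < Re (\<Sum>x\<in>conf d V. \<Sum>y\<in>conf d V. cnj (g c x) * \<sigma> x y * g c y)" if c: "c \<in> conf d (V - A)" for c
    proof -
      obtain a where a: "a \<in> conf d A" "f a \<noteq> 0" using f by blast
      have "g c (override_on c a A) \<noteq> 0" using a c by (simp add: g)
      moreover have "override_on c a A \<in> conf d V" using A c a by (intro override_on_conf_split)
      ultimately show ?thesis using pd unfolding positive_definite_def by blast
    qed
    have "(\<Sum>x\<in>conf d A. \<Sum>y\<in>conf d A. cnj (f x) * marginal d V \<sigma> A x y * f y) =
       (\<Sum>a\<in>conf d A. \<Sum>b\<in>conf d A. \<Sum>c\<in>conf d (V - A).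
          cnj (f a) * \<sigma> (override_on c a A) (override_on c b A) * f b)"
      by (simp add: marginal_def sum_distrib_left sum_distrib_right)
    also have "\<dots> = (\<Sum>c\<in>conf d (V - A). \<Sum>a\<in>conf d A. \<Sum>b\<in>conf d A.
          cnj (f a) * \<sigma> (override_on c a A) (override_on c b A) * f b)"
      by (rule sum_rotate[symmetric])
    also have "\<dots> = (\<Sum>c\<in>conf d (V - A). \<Sum>x\<in>conf d V. \<Sum>y\<in>conf d V. cnj (g c x) * \<sigma> x y * g c y)"
      by (rule sum.cong[OF refl]) (simp add: eq)
    finally have *: "Re (\<Sum>x\<in>conf d A. \<Sum>y\<in>conf d A. cnj (f x) * marginal d V \<sigma> A x y * f y) =
        (\<Sum>c\<in>conf d (V - A). Re (\<Sum>x\<in>conf d V. \<Sum>y\<in>conf d V. cnj (g c x) * \<sigma> x y * g c y))"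
      by (simp only: Re_sum)
    have "conf d (V - A) \<noteq> {}" using card_conf_pos[of "V - A"] by auto
    then show ?thesis unfolding * using fin pos by (intro sum_pos) auto
  qed
  ultimately show ?thesis by (auto simp: positive_definite_def)
qed

lemma marginal_spectral:
  assumes "A \<subseteq> V"
  obtains u l where "orthonormal_basis (conf d A) u" "marginal d V \<sigma> A = spectral_opr (conf d A) u l"
    "\<forall>k\<in>conf d A. l k > 0"
proof -
  have fin: "finite (conf d A)" using assms finite_V by (auto intro: finite_conf finite_subset)
  have "marginal d V \<sigma> A \<in> oprs (conf d A)" by (simp add: marginal_def oprs_def)
  then show ?thesis
  proof (rule positive_definite_spectral[OF fin positive_definite_marginal[OF assms]])
    fix u l
    assume "orthonormal_basis (conf d A) u" "marginal d V \<sigma> A = spectral_opr (conf d A) u l"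
      "\<And>k. k \<in> conf d A \<Longrightarrow> 0 < l k"
    then show ?thesis by (intro that ballI)
  qed
qed

section \<open>Embedded logarithms and entropies\<close>

definition elog :: "'v set \<Rightarrow> ('v \<Rightarrow> nat) opr" where
  "elog A = embed d V A (log_marginal d V \<sigma> A)"

text \<open>The normalization relating \<open>cond_expect d V A \<sigma>\<close> to the embedded marginal; its logarithm is modular in \<open>A\<close>, so it
  drops out of strong subadditivity.\<close>

definition dim_ratio :: "'v set \<Rightarrow> real" where
  "dim_ratio A = real (card (conf d A)) / real (card (conf d V))"

lemma frac_pos: "A \<subseteq> V \<Longrightarrow> dim_ratio A > 0"
  by (simp add: dim_ratio_def card_conf_pos)

text \<open>\<open>card (conf d X)\<close> is a product over the sites in \<open>X\<close>, so its
  logarithm is a sum over sites.\<close>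

lemma ln_frac_modular:
  assumes "X \<subseteq> V" "Y \<subseteq> V"
  shows "ln (dim_ratio (X \<union> Y)) + ln (dim_ratio (X \<inter> Y)) = ln (dim_ratio X) + ln (dim_ratio Y)"
proof -
  have fin: "finite X" "finite Y" using assms finite_V finite_subset by blast+
  have "card (conf d (X \<union> Y)) * card (conf d (X \<inter> Y)) = card (conf d X) * card (conf d Y)"
    using fin by (simp add: card_conf prod.union_inter)
  then have "dim_ratio (X \<union> Y) * dim_ratio (X \<inter> Y) = dim_ratio X * dim_ratio Y"
    by (simp add: dim_ratio_def flip: of_nat_mult)
  moreover have "dim_ratio (X \<union> Y) > 0" "dim_ratio (X \<inter> Y) > 0" "dim_ratio X > 0" "dim_ratio Y > 0"
    using assms by (auto intro!: frac_pos)
  ultimately show ?thesis by (metis ln_mult_pos)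
qed

text \<open>Monotonicity concerns logarithms of conditional expectations, entropy those of
  marginals. The two operators differ by a positive factor, which shifts the logarithm by a multiple
  of the identity.\<close>

lemma elog_spectral:
  assumes A: "A \<subseteq> V"
  obtains u l where "orthonormal_basis (conf d V) u" "\<forall>k\<in>conf d V. l k > 0"
    "cond_expect d V A \<sigma> = spectral_opr (conf d V) u l"
    "elog A = (\<lambda>x y. spectral_opr (conf d V) u (\<lambda>k. ln (l k)) x y - of_real (ln (dim_ratio A)) * opr_id (conf d V) x y)"
proof -
  obtain u l where u: "orthonormal_basis (conf d A) u" and l: "marginal d V \<sigma> A = spectral_opr (conf d A) u l"
    and pos: "\<forall>k\<in>conf d A. l k > 0" using marginal_spectral[OF A] .
  have finA: "finite (conf d A)" using A finite_V by (auto intro: finite_conf finite_subset)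
  let ?u = "embed_vec V A u"
  let ?l = "\<lambda>k. dim_ratio A * l (restrict k A)"
  have u': "orthonormal_basis (conf d V) ?u" by (rule orthonormal_basis_embed_vec[OF finite_V A u])
  have pos': "\<forall>k\<in>conf d V. l (restrict k A) > 0" using pos A restrict_conf by blast
  have 1: "cond_expect d V A \<sigma> = spectral_opr (conf d V) ?u ?l"
    unfolding fun_eq_iff cond_expect_eq_embed[OF A] l embed_spectral_opr[OF finite_V A] dim_ratio_def[symmetric]
    by (simp add: spectral_opr_def sum_distrib_left mult.assoc)
  have "elog A = spectral_opr (conf d V) ?u (\<lambda>k. ln (l (restrict k A)))"
    unfolding elog_def log_marginal_def l opr_log_spectral_opr[OF finA u]
    by (rule embed_spectral_opr[OF finite_V A])
  also have "\<dots> = (\<lambda>x y. spectral_opr (conf d V) ?u (\<lambda>k. ln (?l k)) x y - of_real (ln (dim_ratio A)) * opr_id (conf d V) x y)"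
  proof -
    have "spectral_opr (conf d V) ?u (\<lambda>k. ln (?l k)) x y = of_real (ln (dim_ratio A)) * opr_id (conf d V) x y
        + spectral_opr (conf d V) ?u (\<lambda>k. ln (l (restrict k A))) x y" for x y
    proof -
      have "spectral_opr (conf d V) ?u (\<lambda>k. ln (?l k)) x y =
         spectral_opr (conf d V) ?u (\<lambda>k. ln (dim_ratio A) + ln (l (restrict k A))) x y"
        using pos' frac_pos[OF A] by (auto simp: spectral_opr_def ln_mult_pos intro!: sum.cong)
      then show ?thesis
        unfolding opr_id_spectral_opr[OF finite_conf[OF finite_V] u']
        by (simp add: spectral_opr_def sum_distrib_left sum.distrib algebra_simps)
    qed
    then show ?thesis by simp
  qed
  finally show ?thesis using that[OF u' _ 1] pos' frac_pos[OF A] by simp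
qed

text \<open>Duality of embedding and partial trace moves every entropy to the full space, as a
  pairing with the one state \<open>\<sigma>\<close>.\<close>

lemma entropy_eq:
  assumes A: "A \<subseteq> V"
  shows "entropy d V \<sigma> A = - Re (hs_inner (conf d V) \<sigma> (elog A))"
proof -
  have "self_adjoint (conf d A) (marginal d V \<sigma> A)"
    using positive_definite_marginal[OF A] by (simp add: positive_definite_def)
  then have "opr_adj (marginal d V \<sigma> A) = marginal d V \<sigma> A"
    by (auto simp: self_adjoint_def opr_adj_def marginal_def fun_eq_iff)
  then have "hs_inner (conf d V) \<sigma> (elog A) =
      opr_trace (conf d A) (opr_mult (conf d A) (marginal d V \<sigma> A) (log_marginal d V \<sigma> A))"
    unfolding elog_def hs_embed[OF finite_V A] by (simp add: hs_trace)
  then show ?thesis by (simp add: entropy_def)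
qed

text \<open>The identity is the embedding of the scalar one from the empty factor.\<close>

lemma cond_expect_opr_id:
  assumes "A \<subseteq> V" shows "cond_expect d V A (opr_id (conf d V)) = opr_id (conf d V)"
proof -
  have "opr_id (conf d V) = embed d V {} (opr_id (conf d {}))"
  proof (intro ext)
    fix x y :: "'v \<Rightarrow> nat"
    have "x = y" if "x \<in> conf d V" "y \<in> conf d V" "\<forall>v\<in>V. x v = y v"
    proof
      fix v show "x v = y v" using that by (cases "v \<in> V") (auto simp: conf_iff)
    qed
    then show "opr_id (conf d V) x y = embed d V {} (opr_id (conf d {})) x y"
      by (auto simp: opr_id_def embed_def conf_def)
  qed
  then show ?thesis using cond_expect_embed[OF finite_V empty_subsetI assms] by metis
qed

lemma hs_cond_expect:
  assumes "cond_expect d V A N = N"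
  shows "hs_inner (conf d V) (cond_expect d V A \<sigma>) N = hs_inner (conf d V) \<sigma> N"
  using conditional_expectation.hs_F[OF conditional_expectation_cond_expect[OF finite_V] assms, of \<sigma>]
  by (metis cnj_hs)

section \<open>Strong subadditivity and its equality case\<close>

text \<open>Monotonicity under \<open>cond_expect d V X\<close>, applied to the conditional
  expectations of \<open>\<sigma>\<close> onto \<open>X \<union> Y\<close> and onto
  \<open>Y\<close>. By \<open>cond_expect_compose\<close> their images are those onto
  \<open>X\<close> and onto \<open>X \<inter> Y\<close>.\<close>

lemma ssa:
  assumes X: "X \<subseteq> V" and Y: "Y \<subseteq> V"
  shows "Re (hs_inner (conf d V) \<sigma> (elog Y)) - Re (hs_inner (conf d V) \<sigma> (elog (X \<union> Y))) \<le>
      Re (hs_inner (conf d V) \<sigma> (elog (X \<inter> Y))) - Re (hs_inner (conf d V) \<sigma> (elog X))"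
    and "Re (hs_inner (conf d V) \<sigma> (elog Y)) - Re (hs_inner (conf d V) \<sigma> (elog (X \<union> Y))) =
      Re (hs_inner (conf d V) \<sigma> (elog (X \<inter> Y))) - Re (hs_inner (conf d V) \<sigma> (elog X)) \<Longrightarrow>
      elog Y x y - elog (X \<union> Y) x y = elog (X \<inter> Y) x y - elog X x y"
proof -
  let ?I = "conf d V"
  interpret conditional_expectation ?I "cond_expect d V X"
    by (rule conditional_expectation_cond_expect[OF finite_V])
  have Z: "X \<union> Y \<subseteq> V" and W: "X \<inter> Y \<subseteq> V" using X Y by auto
  obtain u p where u: "orthonormal_basis ?I u" "\<forall>k\<in>?I. p k > 0"
    and Ep: "cond_expect d V (X \<union> Y) \<sigma> = spectral_opr ?I u p"
    and Lp: "elog (X \<union> Y) = (\<lambda>x y. spectral_opr ?I u (\<lambda>k. ln (p k)) x y - of_real (ln (dim_ratio (X \<union> Y))) * opr_id ?I x y)"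
    using elog_spectral[OF Z] .
  obtain w q where w: "orthonormal_basis ?I w" "\<forall>k\<in>?I. q k > 0"
    and Eq: "cond_expect d V Y \<sigma> = spectral_opr ?I w q"
    and Lq: "elog Y = (\<lambda>x y. spectral_opr ?I w (\<lambda>k. ln (q k)) x y - of_real (ln (dim_ratio Y)) * opr_id ?I x y)"
    using elog_spectral[OF Y] .
  obtain u1 p1 where u1: "orthonormal_basis ?I u1" "\<forall>k\<in>?I. p1 k > 0"
    and Ep1: "cond_expect d V X \<sigma> = spectral_opr ?I u1 p1"
    and Lp1: "elog X = (\<lambda>x y. spectral_opr ?I u1 (\<lambda>k. ln (p1 k)) x y - of_real (ln (dim_ratio X)) * opr_id ?I x y)"
    using elog_spectral[OF X] .
  obtain w1 q1 where w1: "orthonormal_basis ?I w1" "\<forall>k\<in>?I. q1 k > 0"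
    and Eq1: "cond_expect d V (X \<inter> Y) \<sigma> = spectral_opr ?I w1 q1"
    and Lq1: "elog (X \<inter> Y) = (\<lambda>x y. spectral_opr ?I w1 (\<lambda>k. ln (q1 k)) x y - of_real (ln (dim_ratio (X \<inter> Y))) * opr_id ?I x y)"
    using elog_spectral[OF W] .
  have "X \<inter> (X \<union> Y) = X" by auto
  then have Fp: "cond_expect d V X (spectral_opr ?I u p) = spectral_opr ?I u1 p1"
    unfolding Ep[symmetric] Ep1[symmetric] cond_expect_compose[OF finite_V] by simp
  have Fq: "cond_expect d V X (spectral_opr ?I w q) = spectral_opr ?I w1 q1"
    unfolding Eq[symmetric] Eq1[symmetric] cond_expect_compose[OF finite_V] by simp
  \<comment> \<open>By modularity the normalizations contribute the same multiple of the identity to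
    both differences, so it cancels.\<close>
  define K where "K = ln (dim_ratio Y) - ln (dim_ratio (X \<union> Y))"
  have K1: "K = ln (dim_ratio (X \<inter> Y)) - ln (dim_ratio X)" using ln_frac_modular[OF X Y] by (simp add: K_def)
  have L: "(\<lambda>x y. 1 * spectral_opr ?I w (\<lambda>k. ln (q k)) x y + (-1) * spectral_opr ?I u (\<lambda>k. ln (p k)) x y) =
      (\<lambda>x y. 1 * (1 * elog Y x y + (-1) * elog (X \<union> Y) x y) + of_real K * opr_id ?I x y)"
    unfolding Lp Lq K_def by (simp add: algebra_simps)
  have L1: "(\<lambda>x y. 1 * spectral_opr ?I w1 (\<lambda>k. ln (q1 k)) x y + (-1) * spectral_opr ?I u1 (\<lambda>k. ln (p1 k)) x y) =
      (\<lambda>x y. 1 * (1 * elog (X \<inter> Y) x y + (-1) * elog X x y) + of_real K * opr_id ?I x y)"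
    unfolding Lp1 Lq1 K1 by (simp add: algebra_simps)
  \<comment> \<open>The logarithms that get paired are fixed points, so each conditional expectation
    of \<open>\<sigma>\<close> may be replaced by \<open>\<sigma>\<close>.\<close>
  have fixed: "hs_inner ?I (cond_expect d V A \<sigma>) (elog B) = hs_inner ?I \<sigma> (elog B)" if "B \<subseteq> A" "A \<subseteq> V" for A B
    unfolding elog_def using cond_expect_embed[OF finite_V that] by (rule hs_cond_expect)
  have fixed_id: "hs_inner ?I (cond_expect d V A \<sigma>) (opr_id ?I) = hs_inner ?I \<sigma> (opr_id ?I)" if "A \<subseteq> V" for A
    using cond_expect_opr_id[OF that] by (rule hs_cond_expect)
  have H: "Re (hs_inner ?I (spectral_opr ?I u p) (\<lambda>x y. 1 * spectral_opr ?I w (\<lambda>k. ln (q k)) x y + (-1) * spectral_opr ?I u (\<lambda>k. ln (p k)) x y)) =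
    Re (hs_inner ?I \<sigma> (elog Y)) - Re (hs_inner ?I \<sigma> (elog (X \<union> Y))) + K * Re (hs_inner ?I \<sigma> (opr_id ?I))"
    unfolding L Ep[symmetric] hs_lincomb_right fixed[OF Un_upper2 Z] fixed[OF order_refl Z] fixed_id[OF Z] by simp
  have H1: "Re (hs_inner ?I (spectral_opr ?I u1 p1) (\<lambda>x y. 1 * spectral_opr ?I w1 (\<lambda>k. ln (q1 k)) x y + (-1) * spectral_opr ?I u1 (\<lambda>k. ln (p1 k)) x y)) =
    Re (hs_inner ?I \<sigma> (elog (X \<inter> Y))) - Re (hs_inner ?I \<sigma> (elog X)) + K * Re (hs_inner ?I \<sigma> (opr_id ?I))"
    unfolding L1 Ep1[symmetric] hs_lincomb_right fixed[OF Int_lower1 X] fixed[OF order_refl X] fixed_id[OF X] by simp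
  note mono = relative_entropy_mono[OF u(1) w(1) u1(1) w1(1) u(2) w(2) u1(2) w1(2) Fp Fq, unfolded H H1]
  show "Re (hs_inner ?I \<sigma> (elog Y)) - Re (hs_inner ?I \<sigma> (elog (X \<union> Y))) \<le> Re (hs_inner ?I \<sigma> (elog (X \<inter> Y))) - Re (hs_inner ?I \<sigma> (elog X))"
    using mono(1) by simp
  assume "Re (hs_inner ?I \<sigma> (elog Y)) - Re (hs_inner ?I \<sigma> (elog (X \<union> Y))) = Re (hs_inner ?I \<sigma> (elog (X \<inter> Y))) - Re (hs_inner ?I \<sigma> (elog X))"
  with mono(2) have "(\<lambda>x y. 1 * (1 * elog Y x y + (-1) * elog (X \<union> Y) x y) + of_real K * opr_id ?I x y) =
     (\<lambda>x y. 1 * (1 * elog (X \<inter> Y) x y + (-1) * elog X x y) + of_real K * opr_id ?I x y)"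
    unfolding L L1 by simp
  from fun_cong[OF fun_cong[OF this, of x], of y]
  show "elog Y x y - elog (X \<union> Y) x y = elog (X \<inter> Y) x y - elog X x y" by simp
qed

text \<open>With \<open>X = A \<union> C\<close> and \<open>Y = B \<union> C\<close> the
  intersection reduces to \<open>C\<close>, and \<open>ssa\<close> becomes the claim.\<close>

lemma cond_mutual_info_nonneg:
  assumes "A \<subseteq> V" "B \<subseteq> V" "C \<subseteq> V" "A \<inter> B \<subseteq> C"
  shows "cond_mutual_info d V \<sigma> A B C \<ge> 0"
proof -
  have eqs: "(A \<union> C) \<union> (B \<union> C) = A \<union> B \<union> C" "(A \<union> C) \<inter> (B \<union> C) = C" using assms(4) by auto
  have sub: "A \<union> C \<subseteq> V" "B \<union> C \<subseteq> V" "A \<union> B \<union> C \<subseteq> V" using assms by auto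
  show ?thesis
    using ssa(1)[OF sub(1,2)] assms(3) sub unfolding eqs by (simp add: cond_mutual_info_def entropy_eq)
qed

lemma cond_indep_elog:
  assumes "A \<subseteq> V" "B \<subseteq> V" "C \<subseteq> V" "A \<inter> B \<subseteq> C" "cond_indep d V \<sigma> A B C"
  shows "elog (A \<union> B \<union> C) x y - elog (B \<union> C) x y = elog (A \<union> C) x y - elog C x y"
proof -
  have eqs: "(A \<union> C) \<union> (B \<union> C) = A \<union> B \<union> C" "(A \<union> C) \<inter> (B \<union> C) = C" using assms(4) by auto
  have sub: "A \<union> C \<subseteq> V" "B \<union> C \<subseteq> V" "A \<union> B \<union> C \<subseteq> V" using assms by auto
  have "elog (B \<union> C) x y - elog (A \<union> B \<union> C) x y = elog C x y - elog (A \<union> C) x y"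
    using ssa(2)[OF sub(1,2), of x y] assms(3,5) sub unfolding eqs
    by (simp add: cond_indep_def cond_mutual_info_def entropy_eq)
  then show ?thesis by (simp add: algebra_simps)
qed

end

section \<open>Directed Markov properties of semigraphoids\<close>

definition connected_by ::
  "'v set \<Rightarrow> ('v \<times> 'v) set \<Rightarrow> 'v set \<Rightarrow> 'v list \<Rightarrow> 'v \<Rightarrow> 'v \<Rightarrow> bool" where
  "connected_by V E S p a b \<longleftrightarrow> walk V E p \<and> active E S p \<and> hd p = a \<and> last p = b"

lemma d_separated_iff:
  "d_separated V E A B S \<longleftrightarrow> (\<forall>a\<in>A. \<forall>b\<in>B. \<forall>p. \<not> connected_by V E S p a b)"
  by (auto simp: d_separated_def connected_by_def)

lemma collider_rev:
  assumes "i < length p"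
  shows "collider E (rev p) i \<longleftrightarrow> collider E p (length p - Suc i)"
proof (cases "0 < i \<and> Suc i < length p")
  case True
  then have "rev p ! (i - 1) = p ! Suc (length p - Suc i)" "rev p ! i = p ! (length p - Suc i)"
    "rev p ! Suc i = p ! (length p - Suc i - 1)"
    by (auto simp: rev_nth intro!: arg_cong[of _ _ "(!) p"])
  with True show ?thesis by (auto simp: collider_def)
next
  case False
  with assms show ?thesis by (auto simp: collider_def)
qed

lemma connected_by_rev:
  assumes "connected_by V E S p a b"
  shows "connected_by V E S (rev p) b a"
proof -
  have p: "walk V E p" "active E S p" "hd p = a" "last p = b" using assms by (auto simp: connected_by_def)
  then have "p \<noteq> []" by (simp add: walk_def)
  have "walk V E (rev p)"
    unfolding walk_def
  proof (intro conjI allI impI)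
    fix i assume i: "Suc i < length (rev p)"
    define j where "j = length p - Suc (Suc i)"
    have "rev p ! i = p ! Suc j" "rev p ! Suc i = p ! j" "Suc j < length p"
      using i by (auto simp: rev_nth j_def Suc_diff_Suc)
    then show "(rev p ! i, rev p ! Suc i) \<in> E \<or> (rev p ! Suc i, rev p ! i) \<in> E"
      using p(1) unfolding walk_def by metis
  qed (use p(1) in \<open>auto simp: walk_def\<close>)
  moreover have "active E S (rev p)"
    unfolding active_def
  proof (intro allI impI)
    fix i assume "i < length (rev p)"
    then have "i < length p" "length p - Suc i < length p" by auto
    then show "(\<not> collider E (rev p) i \<longrightarrow> rev p ! i \<notin> S) \<and> (collider E (rev p) i \<longrightarrow> rev p ! i \<in> S)"
      using p(2) by (simp add: collider_rev rev_nth active_def)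
  qed
  ultimately show ?thesis using p \<open>p \<noteq> []\<close> by (simp add: connected_by_def hd_rev last_rev)
qed

lemma d_separated_sym: "d_separated V E A B S \<Longrightarrow> d_separated V E B A S"
  unfolding d_separated_iff using connected_by_rev by metis

text \<open>The arrow from \<open>x\<close> to \<open>v\<close> keeps \<open>x\<close> from being a
  collider once \<open>v\<close> is put in front, and \<open>x\<close> lies outside
  \<open>S\<close>; the later positions keep their status.\<close>

lemma connected_by_Cons:
  assumes p: "connected_by V E S p x b" and xv: "(x, v) \<in> E" "(v, x) \<notin> E" and v: "v \<in> V" "v \<notin> S" and x: "x \<notin> S"
  shows "connected_by V E S (v # p) v b"
proof -
  have w: "walk V E p" "active E S p" "hd p = x" "last p = b" using p by (auto simp: connected_by_def)
  then have ne: "p \<noteq> []" by (simp add: walk_def)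
  then have p0: "p ! 0 = x" using w by (simp add: hd_conv_nth)
  have "walk V E (v # p)"
    unfolding walk_def
  proof (intro conjI allI impI)
    fix i assume "Suc i < length (v # p)"
    then show "((v # p) ! i, (v # p) ! Suc i) \<in> E \<or> ((v # p) ! Suc i, (v # p) ! i) \<in> E"
      using w(1) p0 xv(1) by (cases i) (auto simp: walk_def)
  qed (use w v in \<open>auto simp: walk_def\<close>)
  moreover have "active E S (v # p)"
    unfolding active_def
  proof (intro allI impI)
    fix i assume i: "i < length (v # p)"
    consider "i = 0" | "i = 1" | j where "i = Suc (Suc j)" by (metis One_nat_def not0_implies_Suc)
    then show "(\<not> collider E (v # p) i \<longrightarrow> (v # p) ! i \<notin> S) \<and> (collider E (v # p) i \<longrightarrow> (v # p) ! i \<in> S)"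
    proof cases
      case 1
      then show ?thesis using v by (simp add: collider_def)
    next
      case 2
      then have "\<not> collider E (v # p) i" using p0 xv by (simp add: collider_def)
      then show ?thesis using 2 p0 x by simp
    next
      case 3
      then have "collider E (v # p) i \<longleftrightarrow> collider E p (Suc j)" by (simp add: collider_def)
      then show ?thesis using 3 i w(2) by (simp add: active_def)
    qed
  qed
  ultimately show ?thesis using w ne by (simp add: connected_by_def)
qed

text \<open>With no arrow from it to the walk, an interior vertex receives the arrows of both
  neighbours, so it is a collider.\<close>

lemma connected_by_interior:
  assumes p: "connected_by V E S p a b" and i: "i < length p" and ends: "p ! i \<noteq> a" "p ! i \<noteq> b"
    and sink: "\<And>y. y \<in> set p \<Longrightarrow> (p ! i, y) \<notin> E"
  shows "p ! i \<in> S"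
proof -
  have w: "walk V E p" "active E S p" "hd p = a" "last p = b" using p by (auto simp: connected_by_def)
  then have ne: "p \<noteq> []" by (simp add: walk_def)
  have "i \<noteq> 0" using ends(1) w(3) ne by (metis hd_conv_nth)
  moreover have "i \<noteq> length p - 1" using ends(2) w(4) ne by (metis last_conv_nth)
  ultimately have i': "0 < i" "Suc i < length p" using i by auto
  have "(p ! i, p ! Suc i) \<in> E \<or> (p ! Suc i, p ! i) \<in> E"
    using w(1) i' by (simp add: walk_def)
  then have "(p ! Suc i, p ! i) \<in> E" using sink[of "p ! Suc i"] i' by auto
  moreover have "Suc (i - 1) < length p" "Suc (i - 1) = i" using i' by auto
  then have "(p ! (i - 1), p ! i) \<in> E \<or> (p ! i, p ! (i - 1)) \<in> E"
    using w(1) unfolding walk_def by metis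
  then have "(p ! (i - 1), p ! i) \<in> E" using sink[of "p ! (i - 1)"] i' by auto
  ultimately have "collider E p i" using i' by (simp add: collider_def)
  then show ?thesis using w(2) i by (simp add: active_def)
qed

text \<open>At the junction \<open>v\<close> receives an arrow from either side and becomes a
  collider. It occurs nowhere else: the end points differ from it, and another interior occurrence
  would be a collider outside \<open>S\<close>. Adding \<open>v\<close> to \<open>S\<close>
  therefore blocks nothing else.\<close>

lemma connected_by_join:
  assumes p: "connected_by V E S p a v" and q: "connected_by V E S q v b" and v: "v \<notin> S" "a \<noteq> v" "b \<noteq> v"
    and sink: "\<And>y. y \<in> set p \<union> set q \<Longrightarrow> (v, y) \<notin> E"
  shows "connected_by V E (insert v S) (p @ tl q) a b"
proof -
  have wp: "walk V E p" "active E S p" "hd p = a" "last p = v" using p by (auto simp: connected_by_def)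
  have wq: "walk V E q" "active E S q" "hd q = v" "last q = b" using q by (auto simp: connected_by_def)
  have ne: "p \<noteq> []" "q \<noteq> []" using wp wq by (auto simp: walk_def)
  define m where "m = length p - 1"
  have lp: "length p = Suc m" using ne by (simp add: m_def)
  have pm: "p ! m = v" using wp ne by (simp add: last_conv_nth m_def)
  have q0: "q ! 0 = v" using wq ne by (simp add: hd_conv_nth)
  have m: "m > 0" using pm v wp(3) ne by (cases m) (auto simp: hd_conv_nth)
  have lq: "length q > 1" using q0 v wq(4) ne by (cases "length q - 1") (auto simp: last_conv_nth)
  let ?w = "p @ tl q"
  have len: "length ?w = m + length q" using lp lq by simp
  have n1: "?w ! i = p ! i" if "i \<le> m" for i using that lp by (simp add: nth_append)
  \<comment> \<open>The last vertex of \<open>p\<close> and the first of \<open>q\<close> coincide,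
    so the index shift by \<open>m\<close> is correct at \<open>j = 0\<close> as well.\<close>
  have n2: "?w ! (m + j) = q ! j" if "j < length q" for j
    using that lp pm q0 by (cases j) (auto simp: nth_append nth_tl)
  have pv: "p ! i \<noteq> v" if "i < m" for i
  proof
    assume "p ! i = v"
    have ends: "i \<noteq> 0" using \<open>p ! i = v\<close> v wp(3) ne by (cases i) (auto simp: hd_conv_nth)
    have "(p ! Suc i, v) \<in> E"
      using wp(1) that lp sink[of "p ! Suc i"] \<open>p ! i = v\<close> by (force simp: walk_def)
    moreover have "(p ! (i - 1), v) \<in> E"
    proof -
      have "Suc (i - 1) < length p" "Suc (i - 1) = i" using ends that lp by auto
      then have "(p ! (i - 1), p ! i) \<in> E \<or> (p ! i, p ! (i - 1)) \<in> E" using wp(1) unfolding walk_def by metis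
      then show ?thesis using sink[of "p ! (i - 1)"] \<open>p ! i = v\<close> \<open>Suc (i - 1) < length p\<close> by auto
    qed
    ultimately have "collider E p i" using that lp ends \<open>p ! i = v\<close> by (simp add: collider_def)
    then show False using wp(2) that lp v \<open>p ! i = v\<close> by (auto simp: active_def)
  qed
  have qv: "q ! j \<noteq> v" if j: "0 < j" "j < length q" for j
  proof
    assume "q ! j = v"
    have ends: "j \<noteq> length q - 1" using \<open>q ! j = v\<close> v wq(4) ne by (auto simp: last_conv_nth)
    then have j': "Suc j < length q" using j by simp
    have "(q ! Suc j, v) \<in> E"
      using wq(1) j' sink[of "q ! Suc j"] \<open>q ! j = v\<close> by (force simp: walk_def)
    moreover have "(q ! (j - 1), v) \<in> E"
    proof -
      have "Suc (j - 1) < length q" "Suc (j - 1) = j" using j by auto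
      then have "(q ! (j - 1), q ! j) \<in> E \<or> (q ! j, q ! (j - 1)) \<in> E" using wq(1) unfolding walk_def by metis
      then show ?thesis using sink[of "q ! (j - 1)"] \<open>q ! j = v\<close> \<open>Suc (j - 1) < length q\<close> by auto
    qed
    ultimately have "collider E q j" using j j' \<open>q ! j = v\<close> by (simp add: collider_def)
    then show False using wq(2) j v \<open>q ! j = v\<close> by (auto simp: active_def)
  qed
  have walk: "walk V E ?w"
    unfolding walk_def
  proof (intro conjI allI impI)
    show "?w \<noteq> []" using ne by simp
    show "set ?w \<subseteq> V" using wp(1) wq(1) list.set_sel(2)[OF ne(2)] by (auto simp: walk_def)
    fix i assume i: "Suc i < length ?w"
    show "(?w ! i, ?w ! Suc i) \<in> E \<or> (?w ! Suc i, ?w ! i) \<in> E"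
    proof (cases "i < m")
      case True
      then show ?thesis using wp(1) lp n1[of i] n1[of "Suc i"] by (simp add: walk_def)
    next
      case False
      then obtain j where j: "i = m + j" by (metis le_add_diff_inverse not_less)
      then have "Suc j < length q" using i len by simp
      then show ?thesis using wq(1) n2[of j] n2[of "Suc j"] j by (simp add: walk_def)
    qed
  qed
  have act: "active E (insert v S) ?w"
    unfolding active_def
  proof (intro allI impI)
    fix i assume i: "i < length ?w"
    consider "i < m" | "i = m" | j where "i = m + j" "0 < j" by (metis less_imp_add_positive linorder_neqE_nat)
    then show "(\<not> collider E ?w i \<longrightarrow> ?w ! i \<notin> insert v S) \<and> (collider E ?w i \<longrightarrow> ?w ! i \<in> insert v S)"
    proof cases
      case 1
      then have "collider E ?w i \<longleftrightarrow> collider E p i"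
        using n1[of i] n1[of "i - 1"] n1[of "Suc i"] lp len lq by (simp add: collider_def)
      then show ?thesis using 1 n1[of i] pv[of i] wp(2) lp by (simp add: active_def)
    next
      case 2
      have "Suc (m - 1) < length p" "Suc (m - 1) = m" using m lp by auto
      then have "(p ! (m - 1), p ! m) \<in> E \<or> (p ! m, p ! (m - 1)) \<in> E"
        using wp(1) unfolding walk_def by metis
      then have e1: "(p ! (m - 1), v) \<in> E" using sink[of "p ! (m - 1)"] pm lp by auto
      have "(q ! 0, q ! 1) \<in> E \<or> (q ! 1, q ! 0) \<in> E"
        using wq(1) lq by (simp add: walk_def)
      then have e2: "(q ! 1, v) \<in> E" using sink[of "q ! 1"] q0 lq by auto
      have "collider E ?w m"
        using e1 e2 m len lq n1[of m] n1[of "m - 1"] n2[of 1] pm by (simp add: collider_def)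
      then show ?thesis using 2 n1[of m] pm by simp
    next
      case 3
      then have j: "j < length q" using i len by simp
      have "i - 1 = m + (j - 1)" "Suc i = m + Suc j" using 3 by auto
      then have "collider E ?w i \<longleftrightarrow> collider E q j"
        using n2[of j] n2[of "j - 1"] n2[of "Suc j"] 3 j len by (auto simp: collider_def)
      then show ?thesis using 3 j n2[of j] qv[of j] wq(2) by (simp add: active_def)
    qed
  qed
  have "last ?w = b" using lq wq(4) ne by (cases q) auto
  then show ?thesis using walk act wp(3) ne by (simp add: connected_by_def)
qed

lemma connected_by_delete:
  assumes "connected_by V E S p a b" "v \<notin> set p"
  shows "connected_by V E (insert v S) p a b"
proof -
  have "p ! i \<noteq> v" if "i < length p" for i using assms(2) that by auto
  then show ?thesis using assms(1) by (auto simp: connected_by_def active_def)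
qed

section \<open>Topological orderings and initial segments\<close>

locale ordered_dag =
  fixes V :: "'v set" and E :: "('v \<times> 'v) set" and r :: "('v \<times> 'v) set"
  assumes dag: "dag V E" and top: "topological_ordering V E r"
begin

lemma finite_V: "finite V" using dag by (simp add: dag_def)

lemma r_facts: "r \<subseteq> V \<times> V" "trans r" "irrefl r" "total_on V r" "E \<subseteq> r"
  using top by (auto simp: topological_ordering_def strict_linear_order_on_def)

lemma r_asym: "(x, y) \<in> r \<Longrightarrow> (y, x) \<notin> r"
  using r_facts(2,3) by (meson irrefl_def transD)

lemma trancl_E_r: "(x, y) \<in> E\<^sup>+ \<Longrightarrow> (x, y) \<in> r"
  using r_facts(2,5) by (metis trancl_id trancl_mono)

lemma exists_r_maximal:
  assumes "X \<subseteq> V" "X \<noteq> {}"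
  shows "\<exists>v\<in>X. \<forall>w\<in>X. (v, w) \<notin> r"
proof -
  have "finite r" using r_facts(1) finite_V by (meson finite_SigmaI finite_subset)
  moreover have "acyclic r" using r_facts(2,3) by (simp add: acyclic_irrefl)
  ultimately have "wf (r\<inverse>)" by (rule finite_acyclic_wf_converse)
  then show ?thesis using assms(2) unfolding wf_eq_minimal by (metis converse_iff ex_in_conv)
qed

text \<open>Initial segments of the ordering, along which the inductions run.\<close>

definition lower :: "'v set \<Rightarrow> bool" where
  "lower W \<longleftrightarrow> W \<subseteq> V \<and> (\<forall>w\<in>W. pr V r w \<subseteq> W)"

lemma lower_pr: "lower (pr V r v)"
  using r_facts(2) by (auto simp: lower_def pr_def dest: transD)

lemma lower_insert_pr: "v \<in> V \<Longrightarrow> lower (insert v (pr V r v))"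
  using lower_pr[of v] by (auto simp: lower_def)

lemma not_in_pr: "v \<notin> pr V r v"
  using r_facts(3) by (auto simp: pr_def irrefl_def)

text \<open>By totality a nonempty initial segment consists of its greatest element and the
  predecessors of that element, which form a smaller segment.\<close>

lemma ordering_induct [consumes 1, case_names empty insert]:
  assumes "lower W" "P {}"
    and step: "\<And>v. v \<in> V \<Longrightarrow> P (pr V r v) \<Longrightarrow> P (insert v (pr V r v))"
  shows "P W"
proof -
  have "finite W" using assms(1) finite_V finite_subset by (auto simp: lower_def)
  then show ?thesis using assms(1)
  proof (induction W rule: finite_psubset_induct)
    case (psubset W)
    show ?case
    proof (cases "W = {}")
      case False
      have "W \<subseteq> V" using psubset.prems by (simp add: lower_def)
      then obtain v where v: "v \<in> W" "\<And>w. w \<in> W \<Longrightarrow> (v, w) \<notin> r"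
        using exists_r_maximal[of W] False by blast
      have "pr V r v \<subseteq> W" using v(1) psubset.prems unfolding lower_def by blast
      moreover have "w \<in> pr V r v" if "w \<in> W" "w \<noteq> v" for w
      proof -
        have "(w, v) \<in> r \<or> (v, w) \<in> r"
          using r_facts(4) that v(1) \<open>W \<subseteq> V\<close> unfolding total_on_def by blast
        then show ?thesis using v(2) that \<open>W \<subseteq> V\<close> by (auto simp: pr_def)
      qed
      ultimately have "pr V r v = W - {v}" using not_in_pr[of v] by blast
      then have "pr V r v \<subset> W" "W = insert v (pr V r v)" using v(1) by auto
      moreover have "v \<in> V" using v(1) psubset.prems by (auto simp: lower_def)
      ultimately show ?thesis using psubset.IH[of "pr V r v"] step[of v] lower_pr[of v] by simp
    qed (simp add: assms(2))
  qed
qed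

text \<open>Consecutive initial segments differ by one vertex, and \<open>pr V r v\<close> is the
  segment just before \<open>v\<close> is added.\<close>

lemma sum_telescope:
  fixes f :: "'v set \<Rightarrow> 'a :: ab_group_add"
  assumes "lower W"
  shows "(\<Sum>v\<in>W. f (insert v (pr V r v)) - f (pr V r v)) = f W - f {}"
  using assms
proof (induction W rule: ordering_induct)
  case (insert v)
  have "finite (pr V r v)" using finite_V by (simp add: pr_def)
  then show ?case using insert.IH not_in_pr by simp
qed simp

lemma lower_V: "lower V"
  by (auto simp: lower_def pr_def)

lemma pa_subset_pr: "pa E v \<subseteq> pr V r v"
  using r_facts(1,5) by (auto simp: pa_def pr_def)

lemma pr_subset_nd: "pr V r v \<subseteq> nd V E v"
  using trancl_E_r r_asym not_in_pr[of v] by (auto simp: pr_def nd_def de_def)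

text \<open>A last vertex of the walk outside \<open>W\<close> would be a collider, hence in \<open>S\<close>.\<close>

lemma active_walk_in_lower:
  assumes W: "lower W" and p: "connected_by V E S p a b" and "a \<in> W" "b \<in> W" "S \<subseteq> W"
  shows "set p \<subseteq> W"
proof (rule ccontr)
  assume "\<not> set p \<subseteq> W"
  then have ne: "set p - W \<noteq> {}" by auto
  have pV: "set p \<subseteq> V" using p by (simp add: connected_by_def walk_def)
  then have "set p - W \<subseteq> V" by auto
  then obtain x where x: "x \<in> set p - W" "\<And>y. y \<in> set p - W \<Longrightarrow> (x, y) \<notin> r"
    using exists_r_maximal[of "set p - W"] ne by blast
  then obtain i where i: "i < length p" "p ! i = x" by (auto simp: in_set_conv_nth)
  have "p ! i \<in> S"
  proof (rule connected_by_interior[OF p i(1)])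
    show "p ! i \<noteq> a" "p ! i \<noteq> b" using x i assms by auto
    fix y assume y: "y \<in> set p"
    show "(p ! i, y) \<notin> E"
    proof
      assume "(p ! i, y) \<in> E"
      then have xy: "(x, y) \<in> r" using r_facts(5) i by auto
      with x(2) y have "y \<in> W" by auto
      then have "pr V r y \<subseteq> W" using W unfolding lower_def by blast
      moreover have "x \<in> pr V r y" using xy x(1) pV by (auto simp: pr_def)
      ultimately have "x \<in> W" by blast
      with x show False by simp
    qed
  qed
  with i x assms show False by auto
qed

end

section \<open>Semigraphoids and the global Markov property\<close>

text \<open>\<open>indep_chain\<close> packs decomposition, weak union and contraction into one
  equivalence, the shape in which the chain rule for conditional mutual information delivers
  them.\<close>

locale semigraphoid =
  fixes V :: "'v set" and indep :: "'v set \<Rightarrow> 'v set \<Rightarrow> 'v set \<Rightarrow> bool"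
  assumes indep_empty: "indep A {} C"
    and indep_sym: "indep A B C \<Longrightarrow> indep B A C"
    and indep_chain: "A \<subseteq> V \<Longrightarrow> B \<subseteq> V \<Longrightarrow> C \<subseteq> V \<Longrightarrow> D \<subseteq> V \<Longrightarrow>
      A \<inter> B = {} \<Longrightarrow> A \<inter> C = {} \<Longrightarrow> A \<inter> D = {} \<Longrightarrow> B \<inter> C = {} \<Longrightarrow> B \<inter> D = {} \<Longrightarrow> C \<inter> D = {} \<Longrightarrow>
      indep A (B \<union> D) C \<longleftrightarrow> indep A B C \<and> indep A D (B \<union> C)"

locale ordered_markov = ordered_dag + semigraphoid +
  assumes ordered: "v \<in> V \<Longrightarrow> indep {v} (pr V r v - pa E v) (pa E v)"
begin

text \<open>The side \<open>A\<close> is enlarged by the parents of \<open>v\<close> outside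
  \<open>S\<close>. Given these, \<open>A\<close> and \<open>S\<close>, the vertex \<open>v\<close>
  is independent of \<open>B\<close> by the ordered property. Contraction adds \<open>v\<close> to
  the independence from the induction hypothesis, and decomposition discards the extra
  parents.\<close>

lemma indep_top:
  assumes v: "v \<in> V"
    and IH: "\<And>A B S. A \<subseteq> pr V r v \<Longrightarrow> B \<subseteq> pr V r v \<Longrightarrow> S \<subseteq> pr V r v \<Longrightarrow>
      A \<inter> B = {} \<Longrightarrow> A \<inter> S = {} \<Longrightarrow> B \<inter> S = {} \<Longrightarrow> d_separated V E A B S \<Longrightarrow> indep A B S"
    and A: "A \<subseteq> pr V r v" and B: "B \<subseteq> pr V r v" and S: "S \<subseteq> pr V r v"
    and disj: "A \<inter> B = {}" "A \<inter> S = {}" "B \<inter> S = {}" and sep: "d_separated V E (insert v A) B S"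
  shows "indep (insert v A) B S"
proof -
  let ?W = "pr V r v" and ?P = "pa E v - S - A"
  have W: "?W \<subseteq> V" "v \<notin> ?W" "pa E v \<subseteq> ?W" using not_in_pr pa_subset_pr by (auto simp: pr_def)
  have P: "?P \<subseteq> ?W" using pa_subset_pr by blast
  \<comment> \<open>An active walk from such a parent extends to one from \<open>v\<close>, so the
    parent inherits the separation of \<open>v\<close> from \<open>B\<close>.\<close>
  have prepend: "\<exists>q. connected_by V E S q v b" if "x \<in> pa E v" "x \<notin> S" "connected_by V E S p x b" for x p b
  proof -
    have "(x, v) \<in> E" using that by (simp add: pa_def)
    moreover have "(v, x) \<notin> E" using calculation r_facts(5) r_asym by blast
    moreover have "v \<notin> S" using S W by auto
    ultimately show ?thesis using connected_by_Cons[OF that(3)] v that(2) by blast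
  qed
  have sepP: "\<not> connected_by V E S p x b" if "x \<in> pa E v" "x \<notin> S" "b \<in> B" for x p b
    using prepend[OF that(1,2)] sep that(3) unfolding d_separated_iff by blast
  \<comment> \<open>A parent in \<open>B\<close> would be joined to \<open>B\<close> by the
    one-vertex walk, and then so would \<open>v\<close>.\<close>
  have paB: "pa E v \<inter> B = {}"
  proof -
    have "connected_by V E S [b] b b" if "b \<in> B" for b
      using that disj B W by (auto simp: connected_by_def walk_def active_def collider_def)
    then show ?thesis using sepP disj by blast
  qed
  have "d_separated V E (A \<union> ?P) B S" using sep sepP unfolding d_separated_iff by blast
  then have "indep (A \<union> ?P) B S"
    using A B S P disj paB by (intro IH) auto
  then have i1: "indep B (A \<union> ?P) S" by (rule indep_sym)
  have "?W - pa E v = ((A \<union> S) - pa E v) \<union> (?W - pa E v - A - S)" using A S by blast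
  then have "indep {v} (((A \<union> S) - pa E v) \<union> (?W - pa E v - A - S)) (pa E v)" using ordered[OF v] by simp
  \<comment> \<open>Weak union moves \<open>A\<close> and \<open>S\<close> into the condition, which
    then equals \<open>A \<union> ?P \<union> S\<close>.\<close>
  then have "indep {v} (?W - pa E v - A - S) (((A \<union> S) - pa E v) \<union> pa E v)"
    using A S W v pa_subset_pr[of v] by (subst (asm) indep_chain) auto
  also have "((A \<union> S) - pa E v) \<union> pa E v = (A \<union> ?P) \<union> S" by blast
  also have "?W - pa E v - A - S = B \<union> (?W - pa E v - A - S - B)" using B disj paB by blast
  finally have "indep {v} B ((A \<union> ?P) \<union> S)"
    using A B S W P v disj paB by (subst (asm) indep_chain) auto
  then have "indep B {v} ((A \<union> ?P) \<union> S)" by (rule indep_sym)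
  with i1 have "indep B ((A \<union> ?P) \<union> {v}) S"
    using A B S W P v disj paB by (subst indep_chain) auto
  also have "(A \<union> ?P) \<union> {v} = insert v A \<union> ?P" by blast
  finally have "indep B (insert v A) S"
    using A B S W P v disj paB by (subst (asm) indep_chain) auto
  then show ?thesis by (rule indep_sym)
qed

text \<open>Induction along the ordering. When the last vertex \<open>v\<close> lies in the conditioning set it is a collider on every
  active walk through it, so walks joining both \<open>A\<close> and \<open>B\<close> to \<open>v\<close> would concatenate to an active one; hence \<open>v\<close> can be
  moved to one of the two sides.\<close>

lemma global_markov_lower:
  assumes "lower W" "A \<subseteq> W" "B \<subseteq> W" "S \<subseteq> W"
    "A \<inter> B = {}" "A \<inter> S = {}" "B \<inter> S = {}" "d_separated V E A B S"
  shows "indep A B S"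
  using assms
proof (induction W arbitrary: A B S rule: ordering_induct)
  case empty
  then show ?case by (simp add: indep_empty)
next
  case (insert v)
  let ?W = "pr V r v"
  have W: "?W \<subseteq> V" "v \<notin> ?W" using not_in_pr by (auto simp: pr_def)
  have top_left: "indep A B S"
    if "v \<in> A" "A \<subseteq> insert v ?W" "B \<subseteq> insert v ?W" "S \<subseteq> insert v ?W"
      "A \<inter> B = {}" "A \<inter> S = {}" "B \<inter> S = {}" "d_separated V E A B S" for A B S
  proof -
    have eq: "insert v (A - {v}) = A" using that(1) by auto
    have "indep (insert v (A - {v})) B S"
      by (rule indep_top[OF insert.hyps insert.IH]) (use that in \<open>auto simp: insert_absorb\<close>)
    then show ?thesis by (simp only: eq)
  qed
  have top_right: "indep A B S"
    if "v \<in> B" "A \<subseteq> insert v ?W" "B \<subseteq> insert v ?W" "S \<subseteq> insert v ?W"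
      "A \<inter> B = {}" "A \<inter> S = {}" "B \<inter> S = {}" "d_separated V E A B S" for A B S
    by (rule indep_sym, rule top_left) (use that d_separated_sym in \<open>auto\<close>)
  consider "v \<in> A" | "v \<in> B" | "v \<in> S" | "v \<notin> A" "v \<notin> B" "v \<notin> S" by blast
  then show ?case
  proof cases
    case 3
    define S' where "S' = S - {v}"
    have S: "S = insert v S'" "v \<notin> S'" using 3 by (auto simp: S'_def)
    have AB: "A \<subseteq> ?W" "B \<subseteq> ?W" "S' \<subseteq> ?W" "v \<notin> A" "v \<notin> B"
      using insert.prems 3 by (auto simp: S'_def)
    \<comment> \<open>Dropping \<open>v\<close> from the conditioning set opens no walk between
      \<open>A\<close> and \<open>B\<close>: an active one stays among the predecessors of
      \<open>v\<close>, so it avoids \<open>v\<close> and would be active given \<open>S\<close> as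
      well.\<close>
    have no: "\<not> connected_by V E S' p a b" if "a \<in> A" "b \<in> B" for p a b
    proof
      assume p: "connected_by V E S' p a b"
      then have "set p \<subseteq> ?W"
        by (rule active_walk_in_lower[OF lower_pr]) (use that AB in auto)
      then have "v \<notin> set p" using W by auto
      from connected_by_delete[OF p this] show False
        using insert.prems(7) that unfolding d_separated_iff S(1) by blast
    qed
    have sink: "(v, y) \<notin> E" if "y \<in> insert v ?W" for y
      using that r_facts(3,5) r_asym by (auto simp: pr_def irrefl_def)
    have "d_separated V E (insert v A) B S' \<or> d_separated V E A (insert v B) S'"
    proof (rule ccontr)
      assume "\<not> ?thesis"
      then obtain a b p q where ab: "a \<in> A" "b \<in> B"
        and p: "connected_by V E S' p a v" and q: "connected_by V E S' q v b"
        unfolding d_separated_iff using no by blast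
      have "set p \<subseteq> insert v ?W" "set q \<subseteq> insert v ?W"
        using active_walk_in_lower[OF lower_insert_pr[OF insert.hyps] p]
          active_walk_in_lower[OF lower_insert_pr[OF insert.hyps] q] ab AB by auto
      then have "connected_by V E (insert v S') (p @ tl q) a b"
        using S(2) ab AB sink by (intro connected_by_join[OF p q]) auto
      then show False using insert.prems(7) ab unfolding d_separated_iff S(1) by blast
    qed
    then show ?thesis
    proof
      assume "d_separated V E (insert v A) B S'"
      then have "indep (insert v A) B S'"
        using AB W S insert.prems by (intro top_left) auto
      then have "indep B (insert v A) S'" by (rule indep_sym)
      then have "indep B ({v} \<union> A) S'" by simp
      then have "indep B A ({v} \<union> S')"
        using AB W S insert.prems insert.hyps by (subst (asm) indep_chain) auto
      then have "indep B A S" using S by simp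
      then show ?thesis by (rule indep_sym)
    next
      assume "d_separated V E A (insert v B) S'"
      then have "indep A (insert v B) S'"
        using AB W S insert.prems by (intro top_right) auto
      then have "indep A ({v} \<union> B) S'" by simp
      then have "indep A B ({v} \<union> S')"
        using AB W S insert.prems insert.hyps by (subst (asm) indep_chain) auto
      then show ?thesis using S by simp
    qed
  next
    case 4
    then show ?thesis using insert.prems by (intro insert.IH) auto
  next
    case 1
    then show ?thesis using insert.prems by (rule top_left)
  next
    case 2
    then show ?thesis using insert.prems by (rule top_right)
  qed
qed

end

section \<open>The local property and the existence of orderings\<close>

text \<open>An active walk must leave \<open>v\<close> along an outgoing arrow, since a parent next
  to \<open>v\<close> would be a non-collider in the conditioning set. It never turns round, since a
  collider would be a descendant of \<open>v\<close> that is also a parent. It thus ends at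
  \<open>v\<close> or at a descendant.\<close>

lemma d_separated_nd:
  assumes dag: "dag V E"
  shows "d_separated V E {v} (nd V E v - pa E v) (pa E v)"
  unfolding d_separated_iff
proof (intro ballI allI notI)
  fix a b p assume a: "a \<in> {v}" and b: "b \<in> nd V E v - pa E v" and "connected_by V E (pa E v) p a b"
  then have w: "walk V E p" "active E (pa E v) p" "hd p = v" "last p = b" by (auto simp: connected_by_def)
  have acyc: "(x, x) \<notin> E\<^sup>+" for x using dag by (auto simp: dag_def acyclic_def)
  have ne: "p \<noteq> []" using w by (simp add: walk_def)
  have p0: "p ! 0 = v" using w ne by (simp add: hd_conv_nth)
  have desc: "(v, p ! Suc i) \<in> E\<^sup>+ \<and> (p ! i, p ! Suc i) \<in> E" if "Suc i < length p" for i
    using that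
  proof (induction i)
    case 0
    have "(p ! Suc 0, v) \<notin> E"
    proof
      assume e: "(p ! Suc 0, v) \<in> E"
      then have "(v, p ! Suc 0) \<notin> E" using acyc by (meson r_into_trancl trancl_trans)
      then have "\<not> collider E p (Suc 0)" by (simp add: collider_def p0)
      then have "p ! Suc 0 \<notin> pa E v" using w(2) 0 by (simp add: active_def)
      then show False using e by (simp add: pa_def)
    qed
    moreover have "(p ! 0, p ! Suc 0) \<in> E \<or> (p ! Suc 0, p ! 0) \<in> E"
      using w(1) 0 unfolding walk_def by blast
    ultimately show ?case by (auto simp: p0)
  next
    case (Suc i)
    then have IH: "(v, p ! Suc i) \<in> E\<^sup>+" "(p ! i, p ! Suc i) \<in> E" by auto
    have "(p ! Suc (Suc i), p ! Suc i) \<notin> E"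
    proof
      assume "(p ! Suc (Suc i), p ! Suc i) \<in> E"
      then have "collider E p (Suc i)" using Suc.prems IH by (simp add: collider_def)
      then have "p ! Suc i \<in> pa E v" using w(2) Suc.prems by (simp add: active_def)
      then have "(v, v) \<in> E\<^sup>+" using IH(1) by (auto simp: pa_def intro: trancl_into_trancl)
      then show False using acyc by blast
    qed
    then have "(p ! Suc i, p ! Suc (Suc i)) \<in> E"
      using w(1) Suc.prems unfolding walk_def by blast
    then show ?case using IH by (auto intro: trancl_into_trancl)
  qed
  show False
  proof (cases "length p - 1")
    case 0
    then have "b = v" using w ne p0 by (simp add: last_conv_nth)
    then show False using b by (simp add: nd_def)
  next
    case (Suc i)
    then have "b = p ! Suc i" "Suc i < length p" using w ne by (auto simp: last_conv_nth)
    then have "(v, b) \<in> E\<^sup>+" using desc by blast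
    then show False using b by (simp add: nd_def de_def)
  qed
qed

text \<open>Vertices are ranked by the number of their strict ancestors, which grows along every
  arrow by acyclicity; an injection into the naturals breaks ties.\<close>

lemma exists_topological_ordering:
  assumes "dag V E"
  shows "\<exists>r. topological_ordering V E r"
proof -
  have fin: "finite V" and EV: "E \<subseteq> V \<times> V" and ac: "acyclic E" using assms by (auto simp: dag_def)
  obtain g :: "'a \<Rightarrow> nat" where g: "inj_on g V" using fin finite_imp_inj_to_nat_seg by metis
  define f where "f x = card {u. (u, x) \<in> E\<^sup>+}" for x
  have sub: "{u. (u, x) \<in> E\<^sup>+} \<subseteq> V" for x using trancl_subset_Sigma[OF EV] by auto
  have mono: "f x < f y" if "(x, y) \<in> E" for x y
    unfolding f_def
  proof (rule psubset_card_mono)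
    show "finite {u. (u, y) \<in> E\<^sup>+}" using sub fin finite_subset by blast
    have "x \<notin> {u. (u, x) \<in> E\<^sup>+}" using ac by (auto simp: acyclic_def)
    then show "{u. (u, x) \<in> E\<^sup>+} \<subset> {u. (u, y) \<in> E\<^sup>+}"
      using that by (auto intro: trancl_into_trancl)
  qed
  define r where "r = {(x, y) \<in> V \<times> V. f x < f y \<or> f x = f y \<and> g x < g y}"
  have "trans r" by (auto simp: r_def trans_def)
  moreover have "irrefl r" by (auto simp: r_def irrefl_def)
  moreover have "total_on V r" using g by (force simp: r_def total_on_def inj_on_def)
  moreover have "E \<subseteq> r" using mono EV by (auto simp: r_def)
  moreover have "r \<subseteq> V \<times> V" by (auto simp: r_def)
  ultimately show ?thesis by (auto simp: topological_ordering_def strict_linear_order_on_def)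
qed

section \<open>The fixed points of the directed Markov map\<close>

context quantum_state
begin

section \<open>Chain rule and semigraphoid axioms\<close>

text \<open>The entropies of \<open>B \<union> C\<close> and of
  \<open>A \<union> B \<union> C\<close> cancel.\<close>

lemma cond_mutual_info_chain:
  "cond_mutual_info d V \<sigma> A (B \<union> D) C = cond_mutual_info d V \<sigma> A B C + cond_mutual_info d V \<sigma> A D (B \<union> C)"
proof -
  have "B \<union> D \<union> C = D \<union> (B \<union> C)" "A \<union> (B \<union> D) \<union> C = A \<union> D \<union> (B \<union> C)" "A \<union> (B \<union> C) = A \<union> B \<union> C" by auto
  then show ?thesis by (simp add: cond_mutual_info_def)
qed

lemma semigraphoid_cond_indep: "semigraphoid V (cond_indep d V \<sigma>)"
proof
  show "cond_indep d V \<sigma> A {} C" for A C by (simp add: cond_indep_def cond_mutual_info_def)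
  show "cond_indep d V \<sigma> B A C" if "cond_indep d V \<sigma> A B C" for A B C
    using that by (simp add: cond_indep_def cond_mutual_info_def Un_commute[of B A])
  fix A B C D
  assume "A \<subseteq> V" "B \<subseteq> V" "C \<subseteq> V" "D \<subseteq> V" "A \<inter> B = {}" "A \<inter> C = {}" "A \<inter> D = {}"
    "B \<inter> C = {}" "B \<inter> D = {}" "C \<inter> D = {}"
  then have "cond_mutual_info d V \<sigma> A B C \<ge> 0" "cond_mutual_info d V \<sigma> A D (B \<union> C) \<ge> 0"
    by (auto intro!: cond_mutual_info_nonneg)
  then show "cond_indep d V \<sigma> A (B \<union> D) C \<longleftrightarrow> cond_indep d V \<sigma> A B C \<and> cond_indep d V \<sigma> A D (B \<union> C)"
    unfolding cond_indep_def cond_mutual_info_chain by linarith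
qed

section \<open>The exponent of the Markov map\<close>

lemma elog_oprs: "elog A \<in> oprs (conf d V)"
  by (auto simp: elog_def embed_def oprs_def)

lemma cnj_elog:
  assumes "A \<subseteq> V"
  shows "cnj (elog A y x) = elog A x y"
proof -
  obtain u l where "elog A = (\<lambda>x y. spectral_opr (conf d V) u (\<lambda>k. ln (l k)) x y
      - of_real (ln (dim_ratio A)) * opr_id (conf d V) x y)"
    using elog_spectral[OF assms] .
  moreover have "cnj (opr_id (conf d V) y x) = opr_id (conf d V) x y" by (auto simp: opr_id_def)
  moreover have "cnj (spectral_opr (conf d V) u (\<lambda>k. ln (l k)) y x) = spectral_opr (conf d V) u (\<lambda>k. ln (l k)) x y"
    by (auto simp: spectral_opr_def mult_ac)
  ultimately show ?thesis by simp
qed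

text \<open>For \<open>A = V\<close> the conditional expectation fixes \<open>\<sigma>\<close> and
  the normalization is one, so \<open>elog V\<close> is the logarithm of
  \<open>\<sigma>\<close>.\<close>

lemma elog_V:
  obtains u l where "orthonormal_basis (conf d V) u" "\<forall>k\<in>conf d V. l k > 0"
    "\<sigma> = spectral_opr (conf d V) u l" "elog V = spectral_opr (conf d V) u (\<lambda>k. ln (l k))"
proof -
  obtain u l where u: "orthonormal_basis (conf d V) u" "\<forall>k\<in>conf d V. l k > 0"
    and E: "cond_expect d V V \<sigma> = spectral_opr (conf d V) u l"
    and L: "elog V = (\<lambda>x y. spectral_opr (conf d V) u (\<lambda>k. ln (l k)) x y - of_real (ln (dim_ratio V)) * opr_id (conf d V) x y)"
    using elog_spectral[OF order_refl] .
  have n: "card (conf d V) > 0" using card_conf_pos by simp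
  have ov: "override_on z x V = x" if "z \<in> conf d V" "x \<in> conf d V" for z x
    by (rule override_on_agree) (use that in \<open>auto simp: agree_def\<close>)
  have "\<sigma> \<in> oprs (conf d V)" using state by (simp add: states_def)
  then have "cond_expect d V V \<sigma> x y = \<sigma> x y" for x y
    using n by (cases "x \<in> conf d V \<and> y \<in> conf d V") (auto simp: cond_expect_def oprs_def agree_def ov)
  then have "cond_expect d V V \<sigma> = \<sigma>" by blast
  moreover have "dim_ratio V = 1" using n by (simp add: dim_ratio_def)
  ultimately show ?thesis using that[OF u] E L by simp
qed

text \<open>The marginal on the empty set is the trace of \<open>\<sigma>\<close>, which is one; the
  telescoping sum starts from this value.\<close>

lemma elog_empty: "elog {} = (\<lambda>x y. 0)"
proof -
  obtain u l where u: "orthonormal_basis (conf d {}) u" and M: "marginal d V \<sigma> {} = spectral_opr (conf d {}) u l"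
    and "\<forall>k\<in>conf d {}. l k > 0"
    using marginal_spectral[OF empty_subsetI] .
  let ?e = "\<lambda>_::'v. undefined :: nat"
  have c: "conf d {} = {?e}" by (simp add: conf_def)
  have "cnj (u ?e ?e) * u ?e ?e = 1" using u by (simp add: orthonormal_basis_def c)
  then have "marginal d V \<sigma> {} ?e ?e = of_real (l ?e)"
    unfolding M by (simp add: spectral_opr_def c mult.assoc mult.commute[of "u ?e ?e"])
  moreover have "marginal d V \<sigma> {} ?e ?e = 1"
    using state by (simp add: marginal_def c states_def opr_trace_def)
  ultimately have "l ?e = 1" by simp
  then have "log_marginal d V \<sigma> {} = (\<lambda>x y. 0)"
    unfolding log_marginal_def M opr_log_spectral_opr[OF finite_conf[OF finite.emptyI] u]
    by (simp add: spectral_opr_def c fun_eq_iff)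
  then show ?thesis by (simp add: elog_def embed_def fun_eq_iff)
qed

lemma T_dag_elog:
  "T_dag d V E \<sigma> = opr_exp (conf d V) (\<lambda>x y. \<Sum>v\<in>V. elog ({v} \<union> pa E v) x y - elog (pa E v) x y)"
  by (simp add: T_dag_def elog_def)

text \<open>The exponential is injective on self-adjoint operators, because the spectral logarithm
  inverts it.\<close>

lemma T_dag_eq_iff:
  assumes "\<And>v. v \<in> V \<Longrightarrow> pa E v \<subseteq> V"
  shows "T_dag d V E \<sigma> = \<sigma> \<longleftrightarrow> (\<lambda>x y. \<Sum>v\<in>V. elog ({v} \<union> pa E v) x y - elog (pa E v) x y) = elog V"
proof -
  define H where "H = (\<lambda>x y. \<Sum>v\<in>V. elog ({v} \<union> pa E v) x y - elog (pa E v) x y)"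
  have fin: "finite (conf d V)" by (rule finite_conf[OF finite_V])
  obtain u l where u: "orthonormal_basis (conf d V) u" "\<forall>k\<in>conf d V. l k > 0"
    and \<sigma>: "\<sigma> = spectral_opr (conf d V) u l" and L: "elog V = spectral_opr (conf d V) u (\<lambda>k. ln (l k))"
    using elog_V .
  have "opr_exp (conf d V) H = \<sigma> \<longleftrightarrow> H = elog V"
  proof
    assume "H = elog V"
    then have "opr_exp (conf d V) H = spectral_opr (conf d V) u (\<lambda>k. exp (ln (l k)))"
      unfolding L by (simp add: opr_exp_spectral_opr[OF fin u(1)])
    also have "\<dots> = \<sigma>" unfolding \<sigma> using u(2) by (simp add: spectral_opr_def fun_eq_iff)
    finally show "opr_exp (conf d V) H = \<sigma>" .
  next
    assume exp: "opr_exp (conf d V) H = \<sigma>"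
    have "cnj (H y x) = H x y" for x y
      unfolding H_def using assms by (auto simp: cnj_elog intro!: sum.cong)
    then have "self_adjoint (conf d V) H" unfolding self_adjoint_def by metis
    moreover have "H \<in> oprs (conf d V)" using elog_oprs by (auto simp: H_def oprs_def)
    ultimately obtain w h where w: "orthonormal_basis (conf d V) w" and H: "H = spectral_opr (conf d V) w h"
      using spectral_theorem[OF fin] by blast
    have "\<sigma> = spectral_opr (conf d V) w (\<lambda>k. exp (h k))"
      using exp unfolding H opr_exp_spectral_opr[OF fin w] by simp
    then have "opr_log (conf d V) \<sigma> = H" by (simp add: opr_log_spectral_opr[OF fin w] H)
    moreover have "opr_log (conf d V) \<sigma> = elog V"
      unfolding L by (subst \<sigma>) (rule opr_log_spectral_opr[OF fin u(1)])
    ultimately show "H = elog V" by simp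
  qed
  then show ?thesis by (simp add: T_dag_elog H_def)
qed

end

section \<open>Equivalence of the Markov properties with the fixed-point equation\<close>

lemma markov_O_iff_T_dag:
  assumes "dag V E" "\<sigma> \<in> states d V" "topological_ordering V E r"
  shows "markov_O d V E r \<sigma> \<longleftrightarrow> T_dag d V E \<sigma> = \<sigma>"
proof -
  interpret ordered_dag V E r using assms by unfold_locales
  interpret quantum_state d V \<sigma> using assms finite_V by unfold_locales
  have pr_V: "pr V r v \<subseteq> V" for v by (auto simp: pr_def)
  then have pa_V: "pa E v \<subseteq> V" for v using pa_subset_pr by blast
  have eqs: "(pr V r v - pa E v) \<union> pa E v = pr V r v"
    "{v} \<union> (pr V r v - pa E v) \<union> pa E v = insert v (pr V r v)" for v
    using pa_subset_pr by blast+
  have disj: "{v} \<inter> (pr V r v - pa E v) \<subseteq> pa E v" for v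
    using not_in_pr by blast
  show ?thesis
  proof
    assume O: "markov_O d V E r \<sigma>"
    \<comment> \<open>Equality in strong subadditivity lets the full set of predecessors replace the
      parents in each summand, after which the sum telescopes.\<close>
    have "elog ({v} \<union> pa E v) x y - elog (pa E v) x y = elog (insert v (pr V r v)) x y - elog (pr V r v) x y"
      if "v \<in> V" for v x y
      using cond_indep_elog[of "{v}" "pr V r v - pa E v" "pa E v" x y] O that pr_V pa_V disj
      unfolding eqs markov_O_def by (metis Diff_subset empty_subsetI insert_subset subset_trans)
    then have "(\<lambda>x y. \<Sum>v\<in>V. elog ({v} \<union> pa E v) x y - elog (pa E v) x y) =
        (\<lambda>x y. \<Sum>v\<in>V. elog (insert v (pr V r v)) x y - elog (pr V r v) x y)"
      by (intro ext sum.cong refl)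
    also have "\<dots> = elog V"
      using sum_telescope[OF lower_V, of "\<lambda>A. elog A x y" for x y] by (simp add: elog_empty fun_eq_iff)
    finally show "T_dag d V E \<sigma> = \<sigma>" using T_dag_eq_iff pa_V by simp
  next
    assume "T_dag d V E \<sigma> = \<sigma>"
    then have H: "(\<lambda>x y. \<Sum>v\<in>V. elog ({v} \<union> pa E v) x y - elog (pa E v) x y) = elog V"
      using T_dag_eq_iff pa_V by simp
    let ?I = "\<lambda>v. cond_mutual_info d V \<sigma> {v} (pr V r v - pa E v) (pa E v)"
    define h where "h A = Re (hs_inner (conf d V) \<sigma> (elog A))" for A
    \<comment> \<open>Each conditional mutual information compares the increment of \<open>h\<close>
      along the ordering with its increment over the parents. Summed, the former telescope and the
      latter are fixed by the hypothesis.\<close>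
    have I: "?I v = (h (insert v (pr V r v)) - h (pr V r v)) - (h ({v} \<union> pa E v) - h (pa E v))"
      if "v \<in> V" for v
      using that pr_V pa_V unfolding cond_mutual_info_def eqs by (simp add: entropy_eq h_def)
    have "(\<Sum>v\<in>V. h ({v} \<union> pa E v) - h (pa E v)) = h V"
      using arg_cong[OF H, of "\<lambda>L. Re (hs_inner (conf d V) \<sigma> L)"] by (simp add: hs_sum hs_diff h_def)
    moreover have "h {} = 0" by (simp add: h_def elog_empty hs_inner_def)
    ultimately have "(\<Sum>v\<in>V. ?I v) = 0"
      using sum_telescope[OF lower_V, of h] by (simp add: I sum_subtractf)
    moreover have "?I v \<ge> 0" if "v \<in> V" for v
      using that pr_V[of v] pa_V[of v] disj[of v] by (intro cond_mutual_info_nonneg) auto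
    ultimately show "markov_O d V E r \<sigma>"
      using finite_V by (simp add: markov_O_def cond_indep_def sum_nonneg_eq_0_iff)
  qed
qed

lemma markov_O_imp_markov_G:
  assumes "dag V E" "\<sigma> \<in> states d V" "topological_ordering V E r" "markov_O d V E r \<sigma>"
  shows "markov_G d V E \<sigma>"
proof -
  interpret ordered_dag V E r using assms by unfold_locales
  interpret quantum_state d V \<sigma> using assms finite_V by unfold_locales
  interpret semigraphoid V "cond_indep d V \<sigma>" by (rule semigraphoid_cond_indep)
  interpret ordered_markov V E r "cond_indep d V \<sigma>"
    using assms(4) by unfold_locales (simp add: markov_O_def)
  show ?thesis unfolding markov_G_def using global_markov_lower[OF lower_V] by blast
qed

lemma markov_G_imp_markov_L:
  assumes "dag V E" "markov_G d V E \<sigma>"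
  shows "markov_L d V E \<sigma>"
  unfolding markov_L_def
proof
  fix v assume v: "v \<in> V"
  have "v \<notin> pa E v" using assms(1) by (auto simp: pa_def dag_def acyclic_def)
  moreover have "pa E v \<subseteq> V" using assms(1) by (auto simp: pa_def dag_def)
  moreover have "nd V E v \<subseteq> V - {v}" by (auto simp: nd_def)
  ultimately show "cond_indep d V \<sigma> {v} (nd V E v - pa E v) (pa E v)"
    using assms(2)[unfolded markov_G_def, rule_format, of "{v}" "nd V E v - pa E v" "pa E v"]
      d_separated_nd[OF assms(1), of v] v by auto
qed

text \<open>Predecessors are non-descendants, so decomposition suffices.\<close>

lemma markov_L_imp_markov_O:
  assumes "dag V E" "\<sigma> \<in> states d V" "topological_ordering V E r" "markov_L d V E \<sigma>"
  shows "markov_O d V E r \<sigma>"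
  unfolding markov_O_def
proof
  fix v assume v: "v \<in> V"
  interpret ordered_dag V E r using assms by unfold_locales
  interpret quantum_state d V \<sigma> using assms finite_V by unfold_locales
  interpret semigraphoid V "cond_indep d V \<sigma>" by (rule semigraphoid_cond_indep)
  have L: "cond_indep d V \<sigma> {v} (nd V E v - pa E v) (pa E v)" using assms(4) v by (simp add: markov_L_def)
  have eq: "nd V E v - pa E v = (pr V r v - pa E v) \<union> (nd V E v - pa E v - pr V r v)"
    using pr_subset_nd by blast
  have nd: "nd V E v \<subseteq> V - {v}" by (auto simp: nd_def)
  have pr: "pr V r v \<subseteq> V - {v}" by (rule subset_trans[OF pr_subset_nd nd])
  have pa: "pa E v \<subseteq> V - {v}" by (rule subset_trans[OF pa_subset_pr pr])
  show "cond_indep d V \<sigma> {v} (pr V r v - pa E v) (pa E v)"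
    using L nd pr pa v by (subst (asm) eq, subst (asm) indep_chain) auto
qed

theorem corollary5p3:
  fixes V :: "'v set" and E :: "('v \<times> 'v) set" and d :: "'v \<Rightarrow> nat"
    and \<sigma> :: "('v \<Rightarrow> nat) \<Rightarrow> ('v \<Rightarrow> nat) \<Rightarrow> complex"
  assumes "dag V E"
    and "\<sigma> \<in> states d V"
  shows "(\<forall>r. topological_ordering V E r \<longrightarrow> (markov_O d V E r \<sigma> \<longleftrightarrow> T_dag d V E \<sigma> = \<sigma>))
       \<and> (markov_L d V E \<sigma> \<longleftrightarrow> T_dag d V E \<sigma> = \<sigma>)
       \<and> (markov_G d V E \<sigma> \<longleftrightarrow> T_dag d V E \<sigma> = \<sigma>)"
proof -
  \<comment> \<open>(L) and (G) do not mention an ordering, so one is chosen to reach them through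
    (O).\<close>
  obtain r where r: "topological_ordering V E r"
    using exists_topological_ordering[OF assms(1)] by blast
  have "markov_O d V E r \<sigma> \<longleftrightarrow> markov_G d V E \<sigma>" "markov_O d V E r \<sigma> \<longleftrightarrow> markov_L d V E \<sigma>"
    using markov_O_imp_markov_G[OF assms r] markov_G_imp_markov_L[OF assms(1)]
      markov_L_imp_markov_O[OF assms r] by blast+
  then show ?thesis using markov_O_iff_T_dag[OF assms] r by blast
qed

end
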